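(* Let $I_1,I_2\subset\mathbb{R}^d$ be relatively separated discrete sets. For $n=1,2$ let $\mathcal{A}_n$ be chosen from $\{\mathcal{J}_s(I_n),\ \mathcal{S}^1_\delta(I_n),\ \mathcal{C}_\nu\}$ (with $I_n=\mathbb{Z}^d$ if $\mathcal{A}_n=\mathcal{C}_\nu$), where $s>d$, $\delta\in(0,1]$, and $\nu$ is a submultiplicative and symmetric weight satisfying $\lim_{n\to\infty}\nu(nz)^{1/n}=1$ for every $z\in\mathbb{R}^d$. Let $\mathcal{A}=\widetilde{\mathcal{A}}_1\cap\widetilde{\mathcal{A}}_2$ be the associated space of rank-four tensors (as defined in the context), with norm $\|A\|_{\mathcal{A}}=\max\{\|A\|_{\widetilde{\mathcal{A}}_1},\|A\|_{\widetilde{\mathcal{A}}_2}\}$, the doubly contracted tensor product $:$ as multiplication and the adjoint $A\mapsto A^*$ as involution. Then $\mathcal{A}$ is an inverse-closed involutive Banach algebra.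
   Context: A set $I\subset\mathbb{R}^d$ is relatively separated if $\sup_{x\in\mathbb{R}^d}|I\cap(x+[0,1]^d)|<\infty$. A weight $\nu:\mathbb{R}^d\to(0,\infty)$ is submultiplicative if $\nu(x+y)\le\nu(x)\nu(y)$ and symmetric if $\nu(-x)=\nu(x)$ for all $x,y$. Put $\vartheta_s(x)=(1+|x|)^s$. The matrix algebras (complex matrices indexed by $I^2$, resp. $(\mathbb{Z}^d)^2$), with norms $\|\cdot\|_{\mathcal{A}_n}$ given by the displayed quantities, are: - Jaffard algebra $\mathcal{J}_s(I)$: all $M$ with $\sup_{(i,j)\in I^2}|M_{i,j}|\,\vartheta_s(i-j)<\infty$. - Weighted Schur-type algebra $\mathcal{S}^1_\delta(I)$: all $M$ with $\max\{\sup_{i\in I}\sum_{j\in I}|M_{i,j}|\vartheta_\delta(i-j),\ \sup_{j\in I}\sum_{i\in I}|M_{i,j}|\vartheta_\delta(i-j)\}<\infty$. - Sjöstrand algebra $\mathcal{C}_\nu$ (index set $\mathbb{Z}^d$): all $M$ with $\sum_{i\in\mathbb{Z}^d}\sup_{j\in\mathbb{Z}^d}|M_{j,j-i}|\,\nu(i)<\infty$. Let $\mathcal{T}$ be the vector space of all rank-four tensors $A=(A_{i,k,l,j})_{(i,k,l,j)\in I_1\times I_2^2\times I_1}$ with complex entries. For $A\in\mathcal{T}$ and $(i,j)\in I_1^2$ let $A|_{\{i\}\times I_2^2\times\{j\}}$ be the matrix $(A_{i,k,l,j})_{(k,l)\in I_2^2}$, and for $(k,l)\in I_2^2$ let $A|_{I_1\times\{(k,l)\}\times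 I_1}$ be the matrix $(A_{i,k,l,j})_{(i,j)\in I_1^2}$. Define $$\|A\|_{\widetilde{\mathcal{A}}_1} := \Big\| \big( \| A|_{\{i\}\times I_2^2\times\{j\}} \|_{\mathcal{B}(\ell^2(I_2))} \big)_{(i,j)\in I_1^2} \Big\|_{\mathcal{A}_1},\qquad \|A\|_{\widetilde{\mathcal{A}}_2} := \Big\| \big( \| A|_{I_1\times\{(k,l)\}\times I_1} \|_{\mathcal{B}(\ell^2(I_1))} \big)_{(k,l)\in I_2^2} \Big\|_{\mathcal{A}_2},$$ where $\|\cdot\|_{\mathcal{B}(\ell^2)}$ is the operator norm, and the expressions are taken to be $+\infty$ if some restricted matrix does not define a bounded operator or if the resulting matrix of norms does not lie in $\mathcal{A}_1$ (resp. $\mathcal{A}_2$). Set $\widetilde{\mathcal{A}}_n := \{A\in\mathcal{T} : \|A\|_{\widetilde{\mathcal{A}}_n}<\infty\}$ for $n=1,2$. Multiplication and involution of tensors: $(A:B)_{i,k,l,j} := \sum_{n\in I_2}\sum_{m\in I_1} A_{i,k,n,m}B_{m,n,l,j}$ and $(A^* )_{i,k,l,j} := \overline{A_{j,l,k,i}}$. A tensor $A$ acts on sequences $c$ on $I_1\times I_2$ by $(Ac)_{i,k}=\sum_{m\in I_1}\sum_{n\in I_2}A_{i,k,n,m}c_{m,n}$, so that $:$ corresponds to composition of operators. $\mathcal{A}$ is inverse-closed if, whenever $A\in\mathcal{A}$ is invertible in $\mathcal{B}(\ell^2(I_1\times I_2))$, the tensor representing $A^{-1}$ belongs to $\mathc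al{A}$.
   Formalization: If some A_n is the Jaffard algebra, the stated norm is submultiplicative only up to a constant, so the Banach algebra norm is C·‖A‖_A for some C>0; C=1 if neither A_1 nor A_2 has the Jaffard norm (on an empty or one-point index set the Schur and Jaffard norms coincide). *)

theory Defs
  imports "HOL-Analysis.Analysis" "HOL-Library.Function_Algebras"
begin

section \<open>Index sets and weights\<close>

definition relatively_separated :: "(real ^ 'd) set \<Rightarrow> bool" where
  "relatively_separated I \<longleftrightarrow>
     (\<exists>N. \<forall>x. finite (I \<inter> (+) x ` cbox 0 1) \<and> card (I \<inter> (+) x ` cbox 0 1) \<le> N)"

definition int_lattice :: "(real ^ 'd) set" where
  "int_lattice = {x. \<forall>a. x $ a \<in> \<int>}"

definition poly_weight :: "real \<Rightarrow> real ^ 'd \<Rightarrow> real" where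
  "poly_weight s x = (1 + norm x) powr s"

definition submultiplicative_weight :: "(real ^ 'd \<Rightarrow> real) \<Rightarrow> bool" where
  "submultiplicative_weight \<nu> \<longleftrightarrow> (\<forall>x. 0 < \<nu> x) \<and> (\<forall>x y. \<nu> (x + y) \<le> \<nu> x * \<nu> y)"

definition symmetric_weight :: "(real ^ 'd \<Rightarrow> real) \<Rightarrow> bool" where
  "symmetric_weight \<nu> \<longleftrightarrow> (\<forall>x. \<nu> (- x) = \<nu> x)"

definition GRS_condition :: "(real ^ 'd \<Rightarrow> real) \<Rightarrow> bool" where
  "GRS_condition \<nu> \<longleftrightarrow>
     (\<forall>z. (\<lambda>n::nat. \<nu> (real n *\<^sub>R z) powr (1 / real n)) \<longlonglongrightarrow> 1)"

section \<open>Matrix algebras\<close>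

text \<open>A matrix over an index set \<open>I\<close> is a function of two arguments of which only the values
  on \<open>I \<times> I\<close> are used. The norms take values in \<open>[0, \<infinity>]\<close>; the matrix algebra in question
  consists of the matrices of finite norm.\<close>

type_synonym 'a cmatrix = "'a \<Rightarrow> 'a \<Rightarrow> complex"

text \<open>This norm is submultiplicative only up to a constant factor: with two indices, the matrix
  \<open>M i j = 1 / poly_weight s (i - j)\<close> has norm \<open>1\<close>, but its square has diagonal entries
  greater than \<open>1\<close>. A Banach algebra norm in the strict sense is a multiple of it.\<close>

definition jaffard_norm :: "real \<Rightarrow> (real ^ 'd) set \<Rightarrow> (real ^ 'd) cmatrix \<Rightarrow> ennreal" where
  "jaffard_norm s I M =
     (SUP (i, j) \<in> I \<times> I. ennreal (cmod (M i j) * poly_weight s (i - j)))"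

definition schur_norm :: "real \<Rightarrow> (real ^ 'd) set \<Rightarrow> (real ^ 'd) cmatrix \<Rightarrow> ennreal" where
  "schur_norm \<delta> I M =
     max (SUP i\<in>I. \<Sum>\<^sub>\<infinity>j\<in>I. ennreal (cmod (M i j) * poly_weight \<delta> (i - j)))
         (SUP j\<in>I. \<Sum>\<^sub>\<infinity>i\<in>I. ennreal (cmod (M i j) * poly_weight \<delta> (i - j)))"

definition sjostrand_norm :: "(real ^ 'd \<Rightarrow> real) \<Rightarrow> (real ^ 'd) cmatrix \<Rightarrow> ennreal" where
  "sjostrand_norm \<nu> M =
     (\<Sum>\<^sub>\<infinity>i\<in>int_lattice. SUP j\<in>int_lattice. ennreal (cmod (M j (j - i)) * \<nu> i))"

section \<open>Bounded operators on square-summable sequences\<close>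

text \<open>Sequences on \<open>I\<close> are total functions that vanish outside \<open>I\<close>.\<close>

definition ell2 :: "'a set \<Rightarrow> ('a \<Rightarrow> complex) set" where
  "ell2 I = {c. (\<forall>x. x \<notin> I \<longrightarrow> c x = 0) \<and> (\<lambda>x. (cmod (c x))\<^sup>2) summable_on I}"

definition ell2_norm :: "'a set \<Rightarrow> ('a \<Rightarrow> complex) \<Rightarrow> real" where
  "ell2_norm I c = sqrt (\<Sum>\<^sub>\<infinity>x\<in>I. (cmod (c x))\<^sup>2)"

definition bounded_op_on :: "'a set \<Rightarrow> (('a \<Rightarrow> complex) \<Rightarrow> ('a \<Rightarrow> complex)) \<Rightarrow> bool" where
  "bounded_op_on I T \<longleftrightarrow>
     (\<forall>c\<in>ell2 I. T c \<in> ell2 I) \<and>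
     (\<forall>c\<in>ell2 I. \<forall>c'\<in>ell2 I. \<forall>a. T (\<lambda>x. a * c x + c' x) = (\<lambda>x. a * T c x + T c' x)) \<and>
     (\<exists>K. \<forall>c\<in>ell2 I. ell2_norm I (T c) \<le> K * ell2_norm I c)"

definition op_norm_on :: "'a set \<Rightarrow> (('a \<Rightarrow> complex) \<Rightarrow> ('a \<Rightarrow> complex)) \<Rightarrow> real" where
  "op_norm_on I T = (SUP c \<in> {c \<in> ell2 I. ell2_norm I c \<le> 1}. ell2_norm I (T c))"

definition matrix_op :: "'a set \<Rightarrow> 'a cmatrix \<Rightarrow> ('a \<Rightarrow> complex) \<Rightarrow> ('a \<Rightarrow> complex)" where
  "matrix_op I M c = (\<lambda>k. if k \<in> I then \<Sum>\<^sub>\<infinity>l\<in>I. M k l * c l else 0)"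

text \<open>The convergence of the series is demanded explicitly because \<open>infsum\<close> is \<open>0\<close> on
  families that are not summable.\<close>

definition matrix_bounded :: "'a set \<Rightarrow> 'a cmatrix \<Rightarrow> bool" where
  "matrix_bounded I M \<longleftrightarrow>
     (\<forall>c\<in>ell2 I. \<forall>k\<in>I. (\<lambda>l. M k l * c l) summable_on I) \<and> bounded_op_on I (matrix_op I M)"

section \<open>Rank-four tensors\<close>

text \<open>The entry \<open>A\<close> with indices \<open>i, k, l, j\<close> (outer two in \<open>I1\<close>, inner two in \<open>I2\<close>)
  is \<open>A i k l j\<close>.\<close>

type_synonym 'a tensor = "'a \<Rightarrow> 'a \<Rightarrow> 'a \<Rightarrow> 'a \<Rightarrow> complex"

definition tensors :: "'a set \<Rightarrow> 'a set \<Rightarrow> 'a tensor set" where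
  "tensors I1 I2 =
     {A. \<forall>i k l j. \<not> (i \<in> I1 \<and> k \<in> I2 \<and> l \<in> I2 \<and> j \<in> I1) \<longrightarrow> A i k l j = 0}"

definition tensor_scale :: "complex \<Rightarrow> 'a tensor \<Rightarrow> 'a tensor" where
  "tensor_scale a A = (\<lambda>i k l j. a * A i k l j)"

definition tensor_mult :: "'a set \<Rightarrow> 'a set \<Rightarrow> 'a tensor \<Rightarrow> 'a tensor \<Rightarrow> 'a tensor" where
  "tensor_mult I1 I2 A B =
     (\<lambda>i k l j. \<Sum>\<^sub>\<infinity>n\<in>I2. \<Sum>\<^sub>\<infinity>m\<in>I1. A i k n m * B m n l j)"

definition tensor_mult_converges :: "'a set \<Rightarrow> 'a set \<Rightarrow> 'a tensor \<Rightarrow> 'a tensor \<Rightarrow> bool" where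
  "tensor_mult_converges I1 I2 A B \<longleftrightarrow>
     (\<forall>i\<in>I1. \<forall>k\<in>I2. \<forall>l\<in>I2. \<forall>j\<in>I1.
        (\<lambda>(n, m). A i k n m * B m n l j) summable_on (I2 \<times> I1))"

definition tensor_star :: "'a tensor \<Rightarrow> 'a tensor" where
  "tensor_star A = (\<lambda>i k l j. cnj (A j l k i))"

text \<open>In the next two definitions \<open>N\<close> is the norm of a matrix algebra over \<open>I1\<close> and \<open>I2\<close>,
  respectively; it is applied to the matrix of the operator norms of the slices.\<close>

definition tensor_norm1 :: "('a cmatrix \<Rightarrow> ennreal) \<Rightarrow> 'a set \<Rightarrow> 'a set \<Rightarrow> 'a tensor \<Rightarrow> ennreal" where
  "tensor_norm1 N I1 I2 A =
     (if \<forall>i\<in>I1. \<forall>j\<in>I1. matrix_bounded I2 (\<lambda>k l. A i k l j)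
      then N (\<lambda>i j. complex_of_real (op_norm_on I2 (matrix_op I2 (\<lambda>k l. A i k l j))))
      else \<infinity>)"

definition tensor_norm2 :: "('a cmatrix \<Rightarrow> ennreal) \<Rightarrow> 'a set \<Rightarrow> 'a set \<Rightarrow> 'a tensor \<Rightarrow> ennreal" where
  "tensor_norm2 N I1 I2 A =
     (if \<forall>k\<in>I2. \<forall>l\<in>I2. matrix_bounded I1 (\<lambda>i j. A i k l j)
      then N (\<lambda>k l. complex_of_real (op_norm_on I1 (matrix_op I1 (\<lambda>i j. A i k l j))))
      else \<infinity>)"

definition tensor_algebra ::
  "('a cmatrix \<Rightarrow> ennreal) \<Rightarrow> ('a cmatrix \<Rightarrow> ennreal) \<Rightarrow> 'a set \<Rightarrow> 'a set \<Rightarrow> 'a tensor set" where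
  "tensor_algebra N1 N2 I1 I2 =
     {A \<in> tensors I1 I2. tensor_norm1 N1 I1 I2 A < \<infinity>} \<inter>
     {A \<in> tensors I1 I2. tensor_norm2 N2 I1 I2 A < \<infinity>}"

definition tensor_algebra_norm ::
  "('a cmatrix \<Rightarrow> ennreal) \<Rightarrow> ('a cmatrix \<Rightarrow> ennreal) \<Rightarrow> 'a set \<Rightarrow> 'a set \<Rightarrow> 'a tensor \<Rightarrow> real" where
  "tensor_algebra_norm N1 N2 I1 I2 A =
     enn2real (max (tensor_norm1 N1 I1 I2 A) (tensor_norm2 N2 I1 I2 A))"

section \<open>Involutive Banach algebras and inverse-closedness\<close>

text \<open>The vector space operations are those of an ambient complex vector space, of which the
  algebra is a subspace \<open>V\<close>.\<close>

locale involutive_banach_algebra =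
  vector_space scale for scale :: "complex \<Rightarrow> 'v::ab_group_add \<Rightarrow> 'v" +
  fixes V :: "'v set"
    and mult :: "'v \<Rightarrow> 'v \<Rightarrow> 'v"
    and star :: "'v \<Rightarrow> 'v"
    and nrm :: "'v \<Rightarrow> real"
  assumes subspace_V: "subspace V"
    and nrm_nonneg: "x \<in> V \<Longrightarrow> 0 \<le> nrm x"
    and nrm_eq_0_iff: "x \<in> V \<Longrightarrow> nrm x = 0 \<longleftrightarrow> x = 0"
    and nrm_scale: "x \<in> V \<Longrightarrow> nrm (scale a x) = cmod a * nrm x"
    and nrm_triangle: "x \<in> V \<Longrightarrow> y \<in> V \<Longrightarrow> nrm (x + y) \<le> nrm x + nrm y"
    and complete_V: "range X \<subseteq> V \<Longrightarrow>
          (\<forall>e>0. \<exists>N::nat. \<forall>m\<ge>N. \<forall>n\<ge>N. nrm (X m - X n) < e) \<Longrightarrow>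
          \<exists>x\<in>V. (\<lambda>n. nrm (X n - x)) \<longlonglongrightarrow> 0"
    and mult_closed: "x \<in> V \<Longrightarrow> y \<in> V \<Longrightarrow> mult x y \<in> V"
    and mult_assoc: "x \<in> V \<Longrightarrow> y \<in> V \<Longrightarrow> z \<in> V \<Longrightarrow> mult (mult x y) z = mult x (mult y z)"
    and mult_add_left: "x \<in> V \<Longrightarrow> y \<in> V \<Longrightarrow> z \<in> V \<Longrightarrow> mult (x + y) z = mult x z + mult y z"
    and mult_add_right: "x \<in> V \<Longrightarrow> y \<in> V \<Longrightarrow> z \<in> V \<Longrightarrow> mult x (y + z) = mult x y + mult x z"
    and mult_scale_left: "x \<in> V \<Longrightarrow> y \<in> V \<Longrightarrow> mult (scale a x) y = scale a (mult x y)"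
    and mult_scale_right: "x \<in> V \<Longrightarrow> y \<in> V \<Longrightarrow> mult x (scale a y) = scale a (mult x y)"
    and nrm_mult: "x \<in> V \<Longrightarrow> y \<in> V \<Longrightarrow> nrm (mult x y) \<le> nrm x * nrm y"
    and star_closed: "x \<in> V \<Longrightarrow> star x \<in> V"
    and star_star: "x \<in> V \<Longrightarrow> star (star x) = x"
    and star_add: "x \<in> V \<Longrightarrow> y \<in> V \<Longrightarrow> star (x + y) = star x + star y"
    and star_scale: "x \<in> V \<Longrightarrow> star (scale a x) = scale (cnj a) (star x)"
    and star_mult: "x \<in> V \<Longrightarrow> y \<in> V \<Longrightarrow> star (mult x y) = mult (star y) (star x)"
    and nrm_star: "x \<in> V \<Longrightarrow> nrm (star x) = nrm x"

definition tensor_represents ::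
  "'a set \<Rightarrow> 'a set \<Rightarrow> 'a tensor \<Rightarrow> (('a \<times> 'a \<Rightarrow> complex) \<Rightarrow> ('a \<times> 'a \<Rightarrow> complex)) \<Rightarrow> bool" where
  "tensor_represents I1 I2 A T \<longleftrightarrow>
     bounded_op_on (I1 \<times> I2) T \<and>
     (\<forall>c\<in>ell2 (I1 \<times> I2). \<forall>i\<in>I1. \<forall>k\<in>I2.
        (\<lambda>(m, n). A i k n m * c (m, n)) summable_on (I1 \<times> I2) \<and>
        T c (i, k) = (\<Sum>\<^sub>\<infinity>m\<in>I1. \<Sum>\<^sub>\<infinity>n\<in>I2. A i k n m * c (m, n)))"

text \<open>The first conjunct is the inclusion in the bounded operators that the notion presupposes;
  \<open>S\<close> is the inverse of \<open>T\<close> in the algebra of bounded operators.\<close>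

definition inverse_closed :: "'a set \<Rightarrow> 'a set \<Rightarrow> 'a tensor set \<Rightarrow> bool" where
  "inverse_closed I1 I2 \<A> \<longleftrightarrow>
     (\<forall>A\<in>\<A>. \<exists>T. tensor_represents I1 I2 A T) \<and>
     (\<forall>A\<in>\<A>. \<forall>T S.
        tensor_represents I1 I2 A T \<and> bounded_op_on (I1 \<times> I2) S \<and>
        (\<forall>c\<in>ell2 (I1 \<times> I2). S (T c) = c \<and> T (S c) = c)
        \<longrightarrow> (\<exists>B\<in>\<A>. tensor_represents I1 I2 B S))"

end

theory Submission
  imports Defs
begin

text \<open>
  Regard a tensor as a matrix over \<open>I1 \<times> I2\<close>; the slices of the two norms are its blocks with respect
  to the two projections, so it is enough to treat one matrix norm \<open>N\<close>, applied to the matrix of the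
  norms of the blocks of an operator. If \<open>S\<close> is the inverse of \<open>T\<close>, then
  \<open>S = (T\<^sup>* T)\<^sup>-\<^sup>1 T\<^sup>*\<close>, and \<open>R = 1 - c T\<^sup>* T\<close> has operator norm less than \<open>1\<close> for a small \<open>c > 0\<close>. Hence
  inverse-closedness follows by a Neumann series once \<open>N (R ^ n)\<close> becomes arbitrarily small for every
  \<open>R\<close> of finite norm \<open>N\<close> and of operator norm less than \<open>1\<close>.

  For the Jaffard and Schur norms this is Brandenburg's trick: \<open>N (R\<^sup>2)\<close> is bounded by \<open>N R\<close> times the
  unweighted Schur norm of \<open>R\<close>, which interpolates between \<open>N R\<close> and the operator norm.

  For the Sjostrand norm, cut-off functions at a large scale \<open>n\<close> almost commute with \<open>R\<close>. So the norms of
  \<open>R ^ m\<close> localized to cells of size \<open>n\<close> are dominated by the \<open>m\<close>-fold convolution power of a positive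
  summable sequence on the coarse lattice with sum less than \<open>1\<close>. By the GRS condition the convolution
  powers still decay geometrically in the weighted norm.
\<close>

section \<open>Matrices bounded on square-summable sequences\<close>

text \<open>Passing to \<open>adj T * T\<close> is essential: for a general invertible operator no
  multiple need lie within distance less than 1 of the identity, whereas for a positive one
  invertibility forces this. The difficulty is that smallness is then known in the operator norm,
  while the series has to converge in \<open>N\<close>. A single small power is enough: the series
  is regrouped along multiples of its exponent, and lower semicontinuity of \<open>N\<close> carries
  the bound over to the sum.

  Interpolation needs spare decay: the weight must grow so that a bound on single blocks can be
  traded against it. In the Schur case \<delta> > 0 provides this growth, in the Jaffard case the
  excess of s over the dimension. For the Sjostrand norm \<nu> may be constant, nothing can be
  traded, and the operator norm has to be used on whole cells instead of single blocks.

  Matrices are indexed by a whole type, and index sets occur only as supports. Hence the identity on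
  an index set is a diagonal projection \<open>p\<close>, and inverses are inverses relative to
  \<open>p\<close>.\<close>

definition l2 :: "('x \<Rightarrow> complex) \<Rightarrow> bool" where
  "l2 c \<longleftrightarrow> (\<lambda>x. (cmod (c x))\<^sup>2) summable_on UNIV"

abbreviation l2n :: "('x \<Rightarrow> complex) \<Rightarrow> real" where
  "l2n \<equiv> ell2_norm UNIV"

lemma L2_set_le_l2n:
  assumes "l2 c" "finite F"
  shows "L2_set (\<lambda>x. cmod (c x)) F \<le> l2n c"
  using assms unfolding l2_def ell2_norm_def L2_set_def
  by (auto intro!: finite_sum_le_infsum)

lemma l2n_nonneg: "0 \<le> l2n c"
  unfolding ell2_norm_def by (auto intro!: infsum_nonneg)

lemma l2I:
  assumes "\<And>F. finite F \<Longrightarrow> L2_set (\<lambda>x. cmod (c x)) F \<le> B"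
  shows "l2 c" "l2n c \<le> B"
proof -
  have B0: "0 \<le> B" using assms[of "{}"] by simp
  have le: "(\<Sum>x\<in>F. (cmod (c x))\<^sup>2) \<le> B\<^sup>2" if "finite F" for F
  proof -
    have "(L2_set (\<lambda>x. cmod (c x)) F)\<^sup>2 \<le> B\<^sup>2"
      using assms[OF that] by (intro power_mono) (auto simp: L2_set_nonneg)
    thus ?thesis unfolding L2_set_def by (simp add: sum_nonneg)
  qed
  show l: "l2 c" unfolding l2_def
    by (rule nonneg_bdd_above_summable_on) (auto intro!: bdd_aboveI2[where M="B\<^sup>2"] le)
  have "(\<Sum>\<^sub>\<infinity>x. (cmod (c x))\<^sup>2) \<le> B\<^sup>2"
    using l unfolding l2_def by (rule infsum_le_finite_sums) (use le in auto)
  thus "l2n c \<le> B" unfolding ell2_norm_def using B0 real_le_lsqrt by blast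
qed

text \<open>Density of finitely supported sequences. It drives \<open>app_transpose\<close> and
  \<open>bounded_op_matrix\<close>, where sums are truncated to finite sets.\<close>

lemma l2n_tail:
  assumes "l2 c"
  shows "((\<lambda>F. l2n (\<lambda>x. if x \<in> F then 0 else c x)) \<longlongrightarrow> 0) (finite_subsets_at_top UNIV)"
proof -
  let ?f = "\<lambda>x. (cmod (c x))\<^sup>2"
  have s: "?f summable_on UNIV" using assms unfolding l2_def .
  have eq: "(\<Sum>\<^sub>\<infinity>x. (cmod (if x \<in> F then 0 else c x))\<^sup>2) = infsum ?f UNIV - sum ?f F"
    if "finite F" for F
  proof -
    have "(\<Sum>\<^sub>\<infinity>x. (cmod (if x \<in> F then 0 else c x))\<^sup>2) = infsum ?f (UNIV - F)"
      by (rule infsum_cong_neutral) auto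
    also have "\<dots> = infsum ?f UNIV - infsum ?f F"
      using s that by (intro infsum_Diff) auto
    finally show ?thesis using that by simp
  qed
  have "((\<lambda>F. infsum ?f UNIV - sum ?f F) \<longlongrightarrow> infsum ?f UNIV - infsum ?f UNIV) (finite_subsets_at_top UNIV)"
    by (intro tendsto_diff tendsto_const infsum_tendsto s)
  hence "((\<lambda>F. sqrt (infsum ?f UNIV - sum ?f F)) \<longlongrightarrow> 0) (finite_subsets_at_top UNIV)"
    using tendsto_real_sqrt by fastforce
  thus ?thesis
    by (rule Lim_transform_eventually)
      (auto simp: ell2_norm_def eq intro!: eventually_finite_subsets_at_top_weakI)
qed

lemma l2_if:
  assumes "l2 c"
  shows "l2 (\<lambda>x. if P x then c x else 0)" "l2n (\<lambda>x. if P x then c x else 0) \<le> l2n c"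
proof -
  have "L2_set (\<lambda>x. cmod (if P x then c x else 0)) F \<le> l2n c" if "finite F" for F
    using L2_set_le_l2n[OF assms that]
    by (rule order_trans[rotated]) (rule L2_set_mono, auto)
  from l2I[OF this]
  show "l2 (\<lambda>x. if P x then c x else 0)" "l2n (\<lambda>x. if P x then c x else 0) \<le> l2n c"
    by auto
qed

lemma l2_if_not: "l2 c \<Longrightarrow> l2 (\<lambda>x. if P x then 0 else c x)"
  by (drule l2_if(1)[of c "\<lambda>x. \<not> P x"]) (erule back_subst[of l2], auto)

lemma l2_finite:
  assumes "finite G"
  shows "l2 (\<lambda>x. if x \<in> G then c x else 0)"
    "l2n (\<lambda>x. if x \<in> G then c x else 0) = L2_set (\<lambda>x. cmod (c x)) G"
proof -
  have "((\<lambda>x. (cmod (if x \<in> G then c x else 0))\<^sup>2) has_sum (\<Sum>x\<in>G. (cmod (c x))\<^sup>2)) UNIV"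
    by (rule has_sum_finite_neutralI[OF assms]) auto
  thus "l2 (\<lambda>x. if x \<in> G then c x else 0)"
    "l2n (\<lambda>x. if x \<in> G then c x else 0) = L2_set (\<lambda>x. cmod (c x)) G"
    unfolding l2_def ell2_norm_def L2_set_def by (auto simp: has_sum_iff)
qed

lemma l2_cnj: "l2 (\<lambda>x. cnj (c x)) \<longleftrightarrow> l2 c" "l2n (\<lambda>x. cnj (c x)) = l2n c"
  unfolding l2_def ell2_norm_def by simp_all

lemma l2_Cauchy_Schwarz:
  assumes "l2 a" "l2 b"
  shows "(\<lambda>x. cmod (a x * b x)) summable_on UNIV"
    "cmod (\<Sum>\<^sub>\<infinity>x. a x * b x) \<le> l2n a * l2n b"
proof -
  have le: "(\<Sum>x\<in>F. cmod (a x * b x)) \<le> l2n a * l2n b" if "finite F" for F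
  proof -
    have "(\<Sum>x\<in>F. cmod (a x * b x)) = (\<Sum>x\<in>F. \<bar>cmod (a x)\<bar> * \<bar>cmod (b x)\<bar>)"
      by (simp add: norm_mult)
    also have "\<dots> \<le> L2_set (\<lambda>x. cmod (a x)) F * L2_set (\<lambda>x. cmod (b x)) F"
      by (rule L2_set_mult_ineq)
    also have "\<dots> \<le> l2n a * l2n b"
      by (intro mult_mono L2_set_le_l2n assms that l2n_nonneg L2_set_nonneg)
    finally show ?thesis .
  qed
  show s: "(\<lambda>x. cmod (a x * b x)) summable_on UNIV"
    by (rule nonneg_bdd_above_summable_on) (auto intro!: bdd_aboveI2[where M="l2n a * l2n b"] le)
  have "cmod (\<Sum>\<^sub>\<infinity>x. a x * b x) \<le> (\<Sum>\<^sub>\<infinity>x. cmod (a x * b x))"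
    by (rule norm_infsum_bound) (use s in simp)
  also have "\<dots> \<le> l2n a * l2n b"
    by (rule infsum_le_finite_sums[OF s]) (use le in auto)
  finally show "cmod (\<Sum>\<^sub>\<infinity>x. a x * b x) \<le> l2n a * l2n b" .
qed

lemma l2_summable: "l2 a \<Longrightarrow> l2 b \<Longrightarrow> (\<lambda>x. a x * b x) summable_on UNIV"
  using l2_Cauchy_Schwarz(1) summable_on_iff_abs_summable_on_complex by blast

text \<open>Boundedness is tested on finite sections, which makes it stable under entrywise limits.\<close>

definition mbd :: "real \<Rightarrow> ('x \<Rightarrow> 'x \<Rightarrow> complex) \<Rightarrow> bool" where
  "mbd K M \<longleftrightarrow> 0 \<le> K \<and> (\<forall>F G c d. finite F \<longrightarrow> finite G \<longrightarrow>
     cmod (\<Sum>x\<in>F. \<Sum>y\<in>G. d x * M x y * c y)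
       \<le> K * L2_set (\<lambda>x. cmod (d x)) F * L2_set (\<lambda>y. cmod (c y)) G)"

lemma mbd_nonneg: "mbd K M \<Longrightarrow> 0 \<le> K"
  unfolding mbd_def by simp

lemma mbdD:
  "mbd K M \<Longrightarrow> finite F \<Longrightarrow> finite G \<Longrightarrow> cmod (\<Sum>x\<in>F. \<Sum>y\<in>G. d x * M x y * c y)
       \<le> K * L2_set (\<lambda>x. cmod (d x)) F * L2_set (\<lambda>y. cmod (c y)) G"
  unfolding mbd_def by blast

lemma mbd_mono: "mbd K M \<Longrightarrow> K \<le> L \<Longrightarrow> mbd L M"
  unfolding mbd_def
  by (meson L2_set_nonneg mult_right_mono order_trans)

lemma mbd_zero: "mbd 0 (\<lambda>x y. 0)"
  unfolding mbd_def by simp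

lemma mbd_scale: "mbd K M \<Longrightarrow> mbd (cmod a * K) (\<lambda>x y. a * M x y)"
proof -
  assume *: "mbd K M"
  { fix F G :: "'a set" and c d :: "'a \<Rightarrow> complex"
    assume "finite F" "finite G"
    have "(\<Sum>x\<in>F. \<Sum>y\<in>G. d x * (a * M x y) * c y) = a * (\<Sum>x\<in>F. \<Sum>y\<in>G. d x * M x y * c y)"
      by (simp add: sum_distrib_left mult_ac)
    hence "cmod (\<Sum>x\<in>F. \<Sum>y\<in>G. d x * (a * M x y) * c y)
      = cmod a * cmod (\<Sum>x\<in>F. \<Sum>y\<in>G. d x * M x y * c y)" by (simp add: norm_mult)
    also have "\<dots> \<le> cmod a * (K * L2_set (\<lambda>x. cmod (d x)) F * L2_set (\<lambda>y. cmod (c y)) G)"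
      by (intro mult_left_mono mbdD * \<open>finite F\<close> \<open>finite G\<close>) auto
    finally have "cmod (\<Sum>x\<in>F. \<Sum>y\<in>G. d x * (a * M x y) * c y)
      \<le> cmod a * K * L2_set (\<lambda>x. cmod (d x)) F * L2_set (\<lambda>y. cmod (c y)) G"
      by (simp add: mult_ac) }
  thus ?thesis using mbd_nonneg[OF *] unfolding mbd_def by simp
qed

lemma mbd_add: "mbd K M \<Longrightarrow> mbd L N \<Longrightarrow> mbd (K + L) (\<lambda>x y. M x y + N x y)"
proof -
  assume *: "mbd K M" "mbd L N"
  { fix F G :: "'a set" and c d :: "'a \<Rightarrow> complex"
    assume "finite F" "finite G"
    have "(\<Sum>x\<in>F. \<Sum>y\<in>G. d x * (M x y + N x y) * c y)
      = (\<Sum>x\<in>F. \<Sum>y\<in>G. d x * M x y * c y) + (\<Sum>x\<in>F. \<Sum>y\<in>G. d x * N x y * c y)"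
      by (simp add: algebra_simps sum.distrib)
    hence "cmod (\<Sum>x\<in>F. \<Sum>y\<in>G. d x * (M x y + N x y) * c y)
      \<le> K * L2_set (\<lambda>x. cmod (d x)) F * L2_set (\<lambda>y. cmod (c y)) G
        + L * L2_set (\<lambda>x. cmod (d x)) F * L2_set (\<lambda>y. cmod (c y)) G"
      using norm_triangle_mono[OF mbdD[OF *(1) \<open>finite F\<close> \<open>finite G\<close>] mbdD[OF *(2) \<open>finite F\<close> \<open>finite G\<close>]]
      by simp
    hence "cmod (\<Sum>x\<in>F. \<Sum>y\<in>G. d x * (M x y + N x y) * c y)
      \<le> (K + L) * L2_set (\<lambda>x. cmod (d x)) F * L2_set (\<lambda>y. cmod (c y)) G"
      by (simp add: algebra_simps) }
  thus ?thesis using mbd_nonneg[OF *(1)] mbd_nonneg[OF *(2)] unfolding mbd_def by simp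
qed

lemma mbd_transpose: "mbd K M \<Longrightarrow> mbd K (\<lambda>x y. M y x)"
proof -
  assume *: "mbd K M"
  { fix F G :: "'a set" and c d :: "'a \<Rightarrow> complex"
    assume "finite F" "finite G"
    have "(\<Sum>x\<in>F. \<Sum>y\<in>G. d x * M y x * c y) = (\<Sum>y\<in>G. \<Sum>x\<in>F. c y * M y x * d x)"
      by (subst sum.swap) (simp add: mult_ac)
    hence "cmod (\<Sum>x\<in>F. \<Sum>y\<in>G. d x * M y x * c y)
      \<le> K * L2_set (\<lambda>x. cmod (d x)) F * L2_set (\<lambda>y. cmod (c y)) G"
      using mbdD[OF * \<open>finite G\<close> \<open>finite F\<close>, of c d] by (simp add: mult_ac) }
  thus ?thesis using mbd_nonneg[OF *] unfolding mbd_def by simp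
qed

lemma mbd_cnj: "mbd K M \<Longrightarrow> mbd K (\<lambda>x y. cnj (M x y))"
proof -
  assume *: "mbd K M"
  { fix F G :: "'a set" and c d :: "'a \<Rightarrow> complex"
    assume "finite F" "finite G"
    have "(\<Sum>x\<in>F. \<Sum>y\<in>G. d x * cnj (M x y) * c y) = cnj (\<Sum>x\<in>F. \<Sum>y\<in>G. cnj (d x) * M x y * cnj (c y))"
      by simp
    hence "cmod (\<Sum>x\<in>F. \<Sum>y\<in>G. d x * cnj (M x y) * c y)
      = cmod (\<Sum>x\<in>F. \<Sum>y\<in>G. cnj (d x) * M x y * cnj (c y))"
      by (simp only: complex_mod_cnj)
    hence "cmod (\<Sum>x\<in>F. \<Sum>y\<in>G. d x * cnj (M x y) * c y)
      \<le> K * L2_set (\<lambda>x. cmod (d x)) F * L2_set (\<lambda>y. cmod (c y)) G"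
      using mbdD[OF * \<open>finite F\<close> \<open>finite G\<close>, of "\<lambda>x. cnj (d x)" "\<lambda>x. cnj (c x)"] by simp }
  thus ?thesis using mbd_nonneg[OF *] unfolding mbd_def by simp
qed

lemma mbd_diagonal:
  assumes "0 \<le> K" "\<And>x. cmod (f x) \<le> K"
  shows "mbd K (\<lambda>x y. if x = y then f x else 0)"
  unfolding mbd_def
proof (intro conjI allI impI assms)
  fix F G :: "'a set" and c d :: "'a \<Rightarrow> complex"
  assume fin: "finite F" "finite G"
  have "(\<Sum>x\<in>F. \<Sum>y\<in>G. d x * (if x = y then f x else 0) * c y)
    = (\<Sum>x\<in>F. if x \<in> G then d x * f x * c x else 0)"
    using fin by (intro sum.cong) (auto simp: if_distrib if_distribR sum.delta cong: if_cong)
  also have "\<dots> = (\<Sum>x\<in>F \<inter> G. d x * f x * c x)"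
    using fin by (simp add: sum.inter_restrict)
  also have "cmod \<dots> \<le> (\<Sum>x\<in>F \<inter> G. K * (cmod (d x) * cmod (c x)))"
  proof (intro sum_norm_le)
    fix x
    have "cmod (f x) * (cmod (d x) * cmod (c x)) \<le> K * (cmod (d x) * cmod (c x))"
      by (intro mult_right_mono assms) simp
    thus "cmod (d x * f x * c x) \<le> K * (cmod (d x) * cmod (c x))"
      by (simp add: norm_mult mult_ac)
  qed
  also have "\<dots> = K * (\<Sum>x\<in>F \<inter> G. \<bar>cmod (d x)\<bar> * \<bar>cmod (c x)\<bar>)" by (simp add: sum_distrib_left)
  also have "\<dots> \<le> K * (L2_set (\<lambda>x. cmod (d x)) (F \<inter> G) * L2_set (\<lambda>x. cmod (c x)) (F \<inter> G))"
    by (intro mult_left_mono L2_set_mult_ineq assms)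
  also have "\<dots> \<le> K * (L2_set (\<lambda>x. cmod (d x)) F * L2_set (\<lambda>x. cmod (c x)) G)"
    unfolding L2_set_def using fin
    by (intro mult_left_mono mult_mono real_sqrt_le_mono sum_mono2 assms)
       (auto intro!: sum_nonneg)
  finally show "cmod (\<Sum>x\<in>F. \<Sum>y\<in>G. d x * (if x = y then f x else 0) * c y)
       \<le> K * L2_set (\<lambda>x. cmod (d x)) F * L2_set (\<lambda>y. cmod (c y)) G"
    by (simp add: mult_ac)
qed

lemma mbd_limit:
  assumes lim: "\<And>x y. (\<lambda>n. M n x y) \<longlonglongrightarrow> L x y"
    and bd: "\<And>n. n \<ge> n0 \<Longrightarrow> mbd K (M n)"
  shows "mbd K L"
  unfolding mbd_def
proof (intro conjI allI impI)
  show "0 \<le> K" using bd[of n0] mbd_nonneg by auto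
  fix F G :: "'a set" and c d :: "'a \<Rightarrow> complex"
  assume fin: "finite F" "finite G"
  have "(\<lambda>n. cmod (\<Sum>x\<in>F. \<Sum>y\<in>G. d x * M n x y * c y))
    \<longlonglongrightarrow> cmod (\<Sum>x\<in>F. \<Sum>y\<in>G. d x * L x y * c y)"
    by (intro tendsto_intros lim)
  thus "cmod (\<Sum>x\<in>F. \<Sum>y\<in>G. d x * L x y * c y)
       \<le> K * L2_set (\<lambda>x. cmod (d x)) F * L2_set (\<lambda>y. cmod (c y)) G"
    by (rule tendsto_upperbound)
       (auto simp: eventually_sequentially intro!: exI[of _ n0] mbdD[OF bd] fin)
qed

section \<open>The operator of a bounded matrix\<close>

definition app :: "('x \<Rightarrow> 'x \<Rightarrow> complex) \<Rightarrow> ('x \<Rightarrow> complex) \<Rightarrow> 'x \<Rightarrow> complex" where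
  "app M c = (\<lambda>x. \<Sum>\<^sub>\<infinity>y. M x y * c y)"

text \<open>Duality: the bilinear form is tested with the conjugate of the output \<open>v\<close>
  itself, which produces the square of its norm; one factor cancels unless it is 0.\<close>

lemma mbd_finite_app:
  assumes "mbd K M" "finite F" "finite G"
  shows "L2_set (\<lambda>x. cmod (\<Sum>y\<in>G. M x y * c y)) F \<le> K * L2_set (\<lambda>y. cmod (c y)) G"
proof -
  define v where "v x = (\<Sum>y\<in>G. M x y * c y)" for x
  let ?v = "L2_set (\<lambda>x. cmod (v x)) F"
  have "(\<Sum>x\<in>F. \<Sum>y\<in>G. cnj (v x) * M x y * c y) = (\<Sum>x\<in>F. cnj (v x) * v x)"
  proof (rule sum.cong)
    fix x assume "x \<in> F"
    have "cnj (v x) * v x = (\<Sum>y\<in>G. cnj (v x) * (M x y * c y))"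
      by (subst (2) v_def) (simp add: sum_distrib_left)
    thus "(\<Sum>y\<in>G. cnj (v x) * M x y * c y) = cnj (v x) * v x" by (simp add: mult.assoc)
  qed simp
  also have "\<dots> = of_real (\<Sum>x\<in>F. (cmod (v x))\<^sup>2)"
    by (simp only: of_real_sum complex_norm_square mult.commute)
  also have "(\<Sum>x\<in>F. (cmod (v x))\<^sup>2) = ?v\<^sup>2"
    unfolding L2_set_def by (simp add: sum_nonneg)
  finally have "?v\<^sup>2 \<le> K * ?v * L2_set (\<lambda>y. cmod (c y)) G"
    using mbdD[OF assms, of "\<lambda>x. cnj (v x)" c] by (simp add: norm_power)
  hence "?v * ?v \<le> ?v * (K * L2_set (\<lambda>y. cmod (c y)) G)" by (simp add: power2_eq_square mult_ac)
  moreover have "0 \<le> ?v" by (simp add: L2_set_nonneg)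
  ultimately have "?v \<le> K * L2_set (\<lambda>y. cmod (c y)) G"
    using mbd_nonneg[OF assms(1)]
    by (metis L2_set_nonneg mult_le_cancel_left_pos mult_nonneg_nonneg order_le_less)
  thus ?thesis unfolding v_def .
qed

text \<open>The row is paired with its own conjugate. Since rows lie in l2, the series in
  \<open>app M c\<close> converges for every \<open>c\<close> in l2.\<close>

lemma mbd_row:
  assumes "mbd K M"
  shows "l2 (M x)" "l2n (M x) \<le> K"
proof -
  have le: "L2_set (\<lambda>y. cmod (M x y)) G \<le> K" if "finite G" for G
  proof -
    let ?v = "L2_set (\<lambda>y. cmod (M x y)) G"
    have "cmod (\<Sum>y\<in>G. M x y * cnj (M x y)) \<le> K * ?v"
      using mbd_finite_app[OF assms, of "{x}" G "\<lambda>y. cnj (M x y)"] that by simp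
    moreover have "(\<Sum>y\<in>G. M x y * cnj (M x y)) = of_real (?v\<^sup>2)"
    proof -
      have "?v\<^sup>2 = (\<Sum>y\<in>G. (cmod (M x y))\<^sup>2)"
        unfolding L2_set_def by (simp add: sum_nonneg)
      thus ?thesis by (simp only: of_real_sum complex_norm_square)
    qed
    ultimately have "?v * ?v \<le> ?v * K" by (simp add: norm_mult power2_eq_square mult_ac)
    moreover have "0 \<le> ?v" by (simp add: L2_set_nonneg)
    ultimately show ?thesis
      using mbd_nonneg[OF assms] by (metis mult_le_cancel_left_pos order_le_less)
  qed
  show "l2 (M x)" "l2n (M x) \<le> K" using l2I[OF le] by auto
qed

lemma mbd_column:
  assumes "mbd K M"
  shows "l2 (\<lambda>y. M y x)" "l2n (\<lambda>y. M y x) \<le> K"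
  using mbd_row[OF mbd_transpose[OF assms]] by auto

lemma mbd_app:
  assumes "mbd K M" "l2 c"
  shows "l2 (app M c)" "l2n (app M c) \<le> K * l2n c"
proof -
  have "L2_set (\<lambda>x. cmod (app M c x)) F \<le> K * l2n c" if F: "finite F" for F
  proof -
    have "((\<lambda>G. L2_set (\<lambda>x. cmod (\<Sum>y\<in>G. M x y * c y)) F) \<longlongrightarrow> L2_set (\<lambda>x. cmod (app M c x)) F)
      (finite_subsets_at_top UNIV)"
      unfolding L2_set_def app_def
      by (intro tendsto_intros infsum_tendsto l2_summable mbd_row[OF assms(1)] assms)
    thus ?thesis
    proof (rule tendsto_upperbound)
      have "L2_set (\<lambda>x. cmod (\<Sum>y\<in>G. M x y * c y)) F \<le> K * l2n c" if "finite G" for G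
        using mbd_finite_app[OF assms(1) F that, of c]
          mult_left_mono[OF L2_set_le_l2n[OF assms(2) that] mbd_nonneg[OF assms(1)]]
        by linarith
      thus "\<forall>\<^sub>F G in finite_subsets_at_top UNIV. L2_set (\<lambda>x. cmod (\<Sum>y\<in>G. M x y * c y)) F \<le> K * l2n c"
        by (auto intro!: eventually_finite_subsets_at_top_weakI)
    qed simp
  qed
  from l2I[OF this] show "l2 (app M c)" "l2n (app M c) \<le> K * l2n c" by auto
qed

lemma app_finite:
  assumes "finite G"
  shows "app M (\<lambda>y. if y \<in> G then c y else 0) x = (\<Sum>y\<in>G. M x y * c y)"
proof -
  have "((\<lambda>y. M x y * (if y \<in> G then c y else 0)) has_sum (\<Sum>y\<in>G. M x y * c y)) UNIV"
    by (rule has_sum_finite_neutralI[OF assms]) auto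
  thus ?thesis unfolding app_def by (simp add: has_sum_iff)
qed

lemma infsum_of_finite_sum:
  fixes f :: "'i \<Rightarrow> 'x \<Rightarrow> complex"
  assumes "finite F" "\<And>i. i \<in> F \<Longrightarrow> f i summable_on A"
  shows "(\<Sum>\<^sub>\<infinity>x\<in>A. \<Sum>i\<in>F. f i x) = (\<Sum>i\<in>F. infsum (f i) A)"
proof -
  have "(\<lambda>x. \<Sum>i\<in>F. f i x) summable_on A \<and> (\<Sum>\<^sub>\<infinity>x\<in>A. \<Sum>i\<in>F. f i x) = (\<Sum>i\<in>F. infsum (f i) A)"
    using assms
    by (induction F) (auto simp: infsum_add intro!: summable_on_add)
  thus ?thesis by blast
qed

text \<open>For \<open>c\<close> cut off to \<open>G\<close> the series is a finite sum, and
  Cauchy-Schwarz against \<open>d\<close> gives the bound. Together with \<open>mbd_app\<close> this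
  shows that testing on finite sections loses nothing.\<close>

lemma mbdI_app:
  assumes "0 \<le> K" "\<And>c. l2 c \<Longrightarrow> l2 (app M c) \<and> l2n (app M c) \<le> K * l2n c"
  shows "mbd K M"
  unfolding mbd_def
proof (intro conjI allI impI assms)
  fix F G :: "'a set" and c d :: "'a \<Rightarrow> complex"
  assume fin: "finite F" "finite G"
  let ?c = "\<lambda>y. if y \<in> G then c y else 0"
  have "cmod (\<Sum>x\<in>F. \<Sum>y\<in>G. d x * M x y * c y) = cmod (\<Sum>x\<in>F. d x * app M ?c x)"
    by (simp add: app_finite[OF fin(2)] sum_distrib_left mult_ac)
  also have "\<dots> \<le> (\<Sum>x\<in>F. \<bar>cmod (d x)\<bar> * \<bar>cmod (app M ?c x)\<bar>)"
    by (intro sum_norm_le) (simp add: norm_mult)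
  also have "\<dots> \<le> L2_set (\<lambda>x. cmod (d x)) F * L2_set (\<lambda>x. cmod (app M ?c x)) F"
    by (rule L2_set_mult_ineq)
  also have "\<dots> \<le> L2_set (\<lambda>x. cmod (d x)) F * (K * l2n ?c)"
    using assms(2)[OF l2_finite(1)[OF fin(2)], of c] L2_set_le_l2n[OF _ fin(1), of "app M ?c"]
    by (intro mult_left_mono L2_set_nonneg) auto
  finally show "cmod (\<Sum>x\<in>F. \<Sum>y\<in>G. d x * M x y * c y)
       \<le> K * L2_set (\<lambda>x. cmod (d x)) F * L2_set (\<lambda>y. cmod (c y)) G"
    by (simp add: l2_finite[OF fin(2)] mult_ac)
qed

lemma app_add:
  assumes "mbd K M" "l2 c" "l2 d"
  shows "app M (\<lambda>x. a * c x + d x) = (\<lambda>x. a * app M c x + app M d x)"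
proof
  fix x
  have "(\<lambda>y. a * (M x y * c y)) summable_on UNIV" "(\<lambda>y. M x y * d y) summable_on UNIV"
    by (intro summable_on_cmult_right l2_summable mbd_row[OF assms(1)] assms)+
  hence "(\<Sum>\<^sub>\<infinity>y. a * (M x y * c y) + M x y * d y) = (\<Sum>\<^sub>\<infinity>y. a * (M x y * c y)) + (\<Sum>\<^sub>\<infinity>y. M x y * d y)"
    by (rule infsum_add)
  thus "app M (\<lambda>x. a * c x + d x) x = a * app M c x + app M d x"
    unfolding app_def by (simp add: algebra_simps infsum_cmult_right')
qed

text \<open>The double series need not converge absolutely, so the sums cannot simply be exchanged.
  If \<open>a\<close> is cut off to a finite set, the outer sum is finite and may be moved inside;
  the error is at most \<open>K\<close> times the norm of the tail of \<open>a\<close> times the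
  norm of \<open>c\<close>.\<close>

lemma app_transpose:
  assumes "mbd K M" "l2 a" "l2 c"
  shows "(\<Sum>\<^sub>\<infinity>x. a x * app M c x) = (\<Sum>\<^sub>\<infinity>y. app (\<lambda>x y. M y x) a y * c y)"
proof -
  let ?T = "finite_subsets_at_top (UNIV :: 'a set)"
  let ?MT = "\<lambda>x y. M y x"
  note MT = mbd_transpose[OF assms(1)]
  have 1: "((\<lambda>F. \<Sum>x\<in>F. a x * app M c x) \<longlongrightarrow> (\<Sum>\<^sub>\<infinity>x. a x * app M c x)) ?T"
    by (intro infsum_tendsto l2_summable mbd_app[OF assms(1)] assms)
  have eq: "(\<Sum>\<^sub>\<infinity>y. app ?MT a y * c y) - (\<Sum>x\<in>F. a x * app M c x)
    = (\<Sum>\<^sub>\<infinity>y. app ?MT (\<lambda>x. if x \<in> F then 0 else a x) y * c y)" if F: "finite F" for F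
  proof -
    let ?aF = "\<lambda>x. if x \<in> F then a x else 0" and ?aG = "\<lambda>x. if x \<in> F then 0 else a x"
    have G: "l2 ?aG" by (rule l2_if_not[OF assms(2)])
    have "(\<Sum>x\<in>F. a x * app M c x) = (\<Sum>x\<in>F. \<Sum>\<^sub>\<infinity>y. a x * M x y * c y)"
      unfolding app_def by (simp add: infsum_cmult_right' mult.assoc)
    also have "\<dots> = (\<Sum>\<^sub>\<infinity>y. \<Sum>x\<in>F. a x * M x y * c y)"
      using F
      by (intro infsum_of_finite_sum[symmetric])
        (auto simp: mult.assoc intro!: summable_on_cmult_right l2_summable mbd_row[OF assms(1)] assms)
    also have "\<dots> = (\<Sum>\<^sub>\<infinity>y. app ?MT ?aF y * c y)"
      by (intro infsum_cong, subst app_finite[OF F], subst sum_distrib_right) (simp only: mult_ac)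
    finally have e: "(\<Sum>x\<in>F. a x * app M c x) = (\<Sum>\<^sub>\<infinity>y. app ?MT ?aF y * c y)" .
    have "a = (\<lambda>x. 1 * ?aF x + ?aG x)" by auto
    hence "app ?MT a = (\<lambda>x. 1 * app ?MT ?aF x + app ?MT ?aG x)"
      using app_add[OF MT l2_finite(1)[OF F] G, of 1] by metis
    hence "(\<Sum>\<^sub>\<infinity>y. app ?MT a y * c y) = (\<Sum>\<^sub>\<infinity>y. app ?MT ?aF y * c y + app ?MT ?aG y * c y)"
      by (simp add: algebra_simps)
    also have "\<dots> = (\<Sum>\<^sub>\<infinity>y. app ?MT ?aF y * c y) + (\<Sum>\<^sub>\<infinity>y. app ?MT ?aG y * c y)"
      by (intro infsum_add l2_summable mbd_app[OF MT] l2_finite F assms G)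
    finally show ?thesis using e by simp
  qed
  have le: "cmod ((\<Sum>\<^sub>\<infinity>y. app ?MT a y * c y) - (\<Sum>x\<in>F. a x * app M c x))
    \<le> K * l2n (\<lambda>x. if x \<in> F then 0 else a x) * l2n c" if F: "finite F" for F
  proof -
    let ?aG = "\<lambda>x. if x \<in> F then 0 else a x"
    have G: "l2 ?aG" by (rule l2_if_not[OF assms(2)])
    have "cmod (\<Sum>\<^sub>\<infinity>y. app ?MT ?aG y * c y) \<le> l2n (app ?MT ?aG) * l2n c"
      by (intro l2_Cauchy_Schwarz mbd_app[OF MT] G assms)
    also have "\<dots> \<le> K * l2n ?aG * l2n c"
      by (intro mult_right_mono mbd_app[OF MT] G l2n_nonneg)
    finally show ?thesis unfolding eq[OF F] .
  qed
  have "((\<lambda>F. K * l2n (\<lambda>x. if x \<in> F then 0 else a x) * l2n c) \<longlongrightarrow> K * 0 * l2n c) ?T"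
    by (intro tendsto_intros l2n_tail assms)
  hence lim0: "((\<lambda>F. K * l2n (\<lambda>x. if x \<in> F then 0 else a x) * l2n c) \<longlongrightarrow> 0) ?T" by simp
  have "((\<lambda>F. (\<Sum>\<^sub>\<infinity>y. app ?MT a y * c y) - (\<Sum>x\<in>F. a x * app M c x)) \<longlongrightarrow> 0) ?T"
    by (rule Lim_null_comparison[OF eventually_finite_subsets_at_top_weakI lim0], rule le)
  moreover have "((\<lambda>F. (\<Sum>\<^sub>\<infinity>y. app ?MT a y * c y) - (\<Sum>x\<in>F. a x * app M c x))
    \<longlongrightarrow> (\<Sum>\<^sub>\<infinity>y. app ?MT a y * c y) - (\<Sum>\<^sub>\<infinity>x. a x * app M c x)) ?T"
    by (intro tendsto_intros 1)
  ultimately have "(\<Sum>\<^sub>\<infinity>y. app ?MT a y * c y) - (\<Sum>\<^sub>\<infinity>x. a x * app M c x) = 0"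
    by (intro tendsto_unique[OF finite_subsets_at_top_neq_bot])
  thus ?thesis by simp
qed

section \<open>Products of bounded matrices\<close>

definition mmul :: "('x \<Rightarrow> 'x \<Rightarrow> complex) \<Rightarrow> ('x \<Rightarrow> 'x \<Rightarrow> complex) \<Rightarrow> 'x \<Rightarrow> 'x \<Rightarrow> complex" where
  "mmul M N x y = (\<Sum>\<^sub>\<infinity>z. M x z * N z y)"

text \<open>This is \<open>app_transpose\<close> for \<open>N\<close>, with the row
  \<open>M x\<close> of the left factor as test sequence.\<close>

lemma app_mmul:
  assumes "mbd K M" "mbd L N" "l2 c"
  shows "app (mmul M N) c = app M (app N c)"
proof
  fix x
  have "app (mmul M N) c x = (\<Sum>\<^sub>\<infinity>y. app (\<lambda>x y. N y x) (M x) y * c y)"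
    unfolding app_def mmul_def by (simp add: mult.commute)
  also have "\<dots> = (\<Sum>\<^sub>\<infinity>z. M x z * app N c z)"
    by (rule app_transpose[OF assms(2) mbd_row(1)[OF assms(1)] assms(3), symmetric])
  finally show "app (mmul M N) c x = app M (app N c) x" unfolding app_def .
qed

lemma mbd_mmul:
  assumes "mbd K M" "mbd L N"
  shows "mbd (K * L) (mmul M N)"
proof (rule mbdI_app)
  show "0 \<le> K * L" using mbd_nonneg[OF assms(1)] mbd_nonneg[OF assms(2)] by simp
  fix c :: "'a \<Rightarrow> complex" assume c: "l2 c"
  have "l2n (app M (app N c)) \<le> K * l2n (app N c)"
    by (intro mbd_app[OF assms(1)] mbd_app[OF assms(2)] c)
  also have "\<dots> \<le> K * (L * l2n c)"
    by (intro mult_left_mono mbd_app[OF assms(2)] c mbd_nonneg[OF assms(1)])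
  finally show "l2 (app (mmul M N) c) \<and> l2n (app (mmul M N) c) \<le> K * L * l2n c"
    unfolding app_mmul[OF assms c]
    by (auto simp: mult.assoc intro!: mbd_app(1)[OF assms(1)] mbd_app(1)[OF assms(2)] c)
qed

lemma mmul_assoc:
  assumes "mbd K M" "mbd L N" "mbd J P"
  shows "mmul (mmul M N) P = mmul M (mmul N P)"
proof (intro ext)
  fix x y
  have "mmul (mmul M N) P x y = app (mmul M N) (\<lambda>z. P z y) x" unfolding mmul_def app_def ..
  also have "\<dots> = app M (app N (\<lambda>z. P z y)) x"
    by (simp add: app_mmul[OF assms(1,2) mbd_column(1)[OF assms(3)]])
  finally show "mmul (mmul M N) P x y = mmul M (mmul N P) x y" unfolding mmul_def app_def .
qed

section \<open>The normed algebra of bounded matrices\<close>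

lemma mbd_entry: "mbd K M \<Longrightarrow> cmod (M x y) \<le> K"
  using mbdD[of K M "{x}" "{y}" "\<lambda>_. 1" "\<lambda>_. 1"] by (simp add: L2_set_def)

text \<open>Every value above the infimum is a bound, and the inequality for finite sections
  survives the limit from \<open>I + e\<close> to \<open>I\<close>. So the infimum can serve as the
  operator norm.\<close>

lemma mbd_Inf:
  assumes "mbd K M"
  shows "mbd (Inf {K. mbd K M}) M"
proof -
  define I where "I = Inf {K. mbd K M}"
  have *: "mbd (I + e) M" if "e > 0" for e
  proof -
    have "{K. mbd K M} \<noteq> {}" using assms by blast
    then obtain K' where "mbd K' M" "K' < I + e"
      using cInf_lessD[of "{K. mbd K M}" "I + e"] \<open>e > 0\<close> unfolding I_def
      by (metis less_add_same_cancel1 mem_Collect_eq)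
    thus ?thesis using mbd_mono by (meson less_imp_le)
  qed
  show "mbd (Inf {K. mbd K M}) M"
    unfolding I_def[symmetric]
    unfolding mbd_def
  proof (intro conjI allI impI)
    show "0 \<le> I"
      unfolding I_def using assms mbd_nonneg by (intro cInf_greatest) auto
    fix F G :: "'a set" and c d :: "'a \<Rightarrow> complex"
    assume fin: "finite F" "finite G"
    let ?p = "L2_set (\<lambda>x. cmod (d x)) F * L2_set (\<lambda>y. cmod (c y)) G"
    have "cmod (\<Sum>x\<in>F. \<Sum>y\<in>G. d x * M x y * c y) \<le> (I + e) * ?p" if "e > 0" for e
      using mbdD[OF *[OF that] fin, of d c] by (simp add: mult.assoc)
    moreover have "((\<lambda>e. (I + e) * ?p) \<longlongrightarrow> (I + 0) * ?p) (at_right 0)"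
      by (intro tendsto_intros)
    ultimately have "cmod (\<Sum>x\<in>F. \<Sum>y\<in>G. d x * M x y * c y) \<le> (I + 0) * ?p"
      by (intro tendsto_lowerbound[of _ _ "at_right 0"])
         (auto simp: eventually_at_right_field intro!: exI[of _ 1])
    thus "cmod (\<Sum>x\<in>F. \<Sum>y\<in>G. d x * M x y * c y) \<le>
      I * L2_set (\<lambda>x. cmod (d x)) F * L2_set (\<lambda>y. cmod (c y)) G"
      by (simp add: mult.assoc)
  qed
qed

text \<open>A type of its own, so that powers, sums, norm and convergence come from the class of
  normed algebras. The index set is a whole type, hence nonempty, and the identity has norm
  1.\<close>

typedef 'x bmat = "{M :: 'x \<Rightarrow> 'x \<Rightarrow> complex. \<exists>K. mbd K M}"
  morphisms ent Abs_bmat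
  using mbd_zero by blast

setup_lifting type_definition_bmat

lemma bmat_eqI: "(\<And>x y. ent A x y = ent B x y) \<Longrightarrow> A = B"
  by (metis ent_inject ext)

instantiation bmat :: (type) real_normed_algebra_1
begin

lift_definition zero_bmat :: "'a bmat" is "\<lambda>x y. 0"
  using mbd_zero by blast

lift_definition one_bmat :: "'a bmat" is "\<lambda>x y. if x = y then 1 else 0"
  using mbd_diagonal[of 1 "\<lambda>_. 1"] by auto

lift_definition plus_bmat :: "'a bmat \<Rightarrow> 'a bmat \<Rightarrow> 'a bmat" is "\<lambda>M N x y. M x y + N x y"
  using mbd_add by blast

lift_definition uminus_bmat :: "'a bmat \<Rightarrow> 'a bmat" is "\<lambda>M x y. - M x y"
  using mbd_scale[of _ _ "-1"] by auto

lift_definition minus_bmat :: "'a bmat \<Rightarrow> 'a bmat \<Rightarrow> 'a bmat" is "\<lambda>M N x y. M x y - N x y"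
proof -
  fix M N :: "'a \<Rightarrow> 'a \<Rightarrow> complex"
  assume "\<exists>K. mbd K M" "\<exists>K. mbd K N"
  then obtain K L where "mbd K M" "mbd L N" by blast
  from mbd_add[OF this(1) mbd_scale[OF this(2), of "-1"]] show "\<exists>K. mbd K (\<lambda>x y. M x y - N x y)" by auto
qed

lift_definition times_bmat :: "'a bmat \<Rightarrow> 'a bmat \<Rightarrow> 'a bmat" is mmul
  using mbd_mmul by blast

lift_definition scaleR_bmat :: "real \<Rightarrow> 'a bmat \<Rightarrow> 'a bmat" is "\<lambda>a M x y. of_real a * M x y"
  using mbd_scale by blast

lift_definition norm_bmat :: "'a bmat \<Rightarrow> real" is "\<lambda>M. Inf {K. mbd K M}" .

definition dist_bmat :: "'a bmat \<Rightarrow> 'a bmat \<Rightarrow> real" where "dist_bmat A B = norm (A - B)"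

definition sgn_bmat :: "'a bmat \<Rightarrow> 'a bmat" where "sgn_bmat A = inverse (norm A) *\<^sub>R A"

definition uniformity_bmat :: "('a bmat \<times> 'a bmat) filter" where
  "uniformity_bmat = (INF e\<in>{0 <..}. principal {(x, y). dist x y < e})"

definition open_bmat :: "'a bmat set \<Rightarrow> bool" where
  "open_bmat U \<longleftrightarrow> (\<forall>x\<in>U. eventually (\<lambda>(x', y). x' = x \<longrightarrow> y \<in> U) uniformity)"

lemma mbd_norm: "mbd (norm A) (ent A)"
  by transfer (use mbd_Inf in blast)

lemma norm_le_mbd: "mbd K (ent A) \<Longrightarrow> norm A \<le> K"
  by transfer (auto intro!: cInf_lower bdd_belowI[of _ 0] mbd_nonneg)

lemma ent_le_norm: "cmod (ent A x y) \<le> norm A"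
  by (rule mbd_entry[OF mbd_norm])

instance
proof
  fix A B C :: "'a bmat" and a b :: real
  show "A + B + C = A + (B + C)" "A + B = B + A" "0 + A = A" "- A + A = 0" "A - B = A + - B"
    by (transfer, simp add: add_ac)+
  show "a *\<^sub>R (A + B) = a *\<^sub>R A + a *\<^sub>R B" "(a + b) *\<^sub>R A = a *\<^sub>R A + b *\<^sub>R A"
    "a *\<^sub>R b *\<^sub>R A = (a * b) *\<^sub>R A" "1 *\<^sub>R A = A"
    by (transfer, simp add: algebra_simps)+
  show "dist A B = norm (A - B)" "sgn A = inverse (norm A) *\<^sub>R A"
    by (simp_all add: dist_bmat_def sgn_bmat_def)
  show "(uniformity :: ('a bmat \<times> 'a bmat) filter) = (INF e\<in>{0 <..}. principal {(x, y). dist x y < e})"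
    by (rule uniformity_bmat_def)
  show "open U \<longleftrightarrow> (\<forall>x\<in>U. eventually (\<lambda>(x', y). x' = x \<longrightarrow> y \<in> U) uniformity)" for U :: "'a bmat set"
    by (rule open_bmat_def)
  have sm: "(\<lambda>z. ent A x z * ent B z y) summable_on UNIV" for A B :: "'a bmat" and x y
    by (intro l2_summable mbd_row(1)[OF mbd_norm] mbd_column(1)[OF mbd_norm])
  show "A * B * C = A * (B * C)"
    by transfer (use mmul_assoc in blast)
  show "(A + B) * C = A * C + B * C"
  proof (rule bmat_eqI)
    show "ent ((A + B) * C) x y = ent (A * C + B * C) x y" for x y
      using infsum_add[OF sm[of A x C y] sm[of B x C y]]
      by (simp add: times_bmat.rep_eq plus_bmat.rep_eq mmul_def algebra_simps)
  qed
  show "A * (B + C) = A * B + A * C"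
  proof (rule bmat_eqI)
    show "ent (A * (B + C)) x y = ent (A * B + A * C) x y" for x y
      using infsum_add[OF sm[of A x B y] sm[of A x C y]]
      by (simp add: times_bmat.rep_eq plus_bmat.rep_eq mmul_def algebra_simps)
  qed
  show "a *\<^sub>R A * B = a *\<^sub>R (A * B)"
    by (rule bmat_eqI) (simp add: times_bmat.rep_eq scaleR_bmat.rep_eq mmul_def mult.assoc infsum_cmult_right')
  show "A * a *\<^sub>R B = a *\<^sub>R (A * B)"
    by (rule bmat_eqI) (simp add: times_bmat.rep_eq scaleR_bmat.rep_eq mmul_def mult.left_commute infsum_cmult_right')
  show "1 * A = A"
  proof (rule bmat_eqI)
    fix x y
    have "((\<lambda>z. (if x = z then 1 else 0) * ent A z y) has_sum (\<Sum>z\<in>{x}. (if x = z then 1 else 0) * ent A z y)) UNIV"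
      by (rule has_sum_finite_neutralI[where B="{x}"]) auto
    thus "ent (1 * A) x y = ent A x y"
      by (simp add: times_bmat.rep_eq one_bmat.rep_eq mmul_def has_sum_iff)
  qed
  show "A * 1 = A"
  proof (rule bmat_eqI)
    fix x y
    have "((\<lambda>z. ent A x z * (if z = y then 1 else 0)) has_sum (\<Sum>z\<in>{y}. ent A x z * (if z = y then 1 else 0))) UNIV"
      by (rule has_sum_finite_neutralI[where B="{y}"]) auto
    thus "ent (A * 1) x y = ent A x y"
      by (simp add: times_bmat.rep_eq one_bmat.rep_eq mmul_def has_sum_iff)
  qed
  show "(0 :: 'a bmat) \<noteq> 1"
  proof
    assume "(0 :: 'a bmat) = 1"
    hence "ent (0 :: 'a bmat) undefined undefined = ent (1 :: 'a bmat) undefined undefined" by simp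
    thus False by (simp add: zero_bmat.rep_eq one_bmat.rep_eq)
  qed
  show "(norm A = 0) = (A = 0)"
  proof
    assume "norm A = 0"
    thus "A = 0" using ent_le_norm[of A] by (intro bmat_eqI) (simp add: zero_bmat.rep_eq)
  next
    assume "A = 0"
    thus "norm A = 0"
      using norm_le_mbd[of 0 "0 :: 'a bmat"] mbd_nonneg[OF mbd_norm[of "0 :: 'a bmat"]] mbd_zero
      by (simp add: zero_bmat.rep_eq)
  qed
  show "norm (A + B) \<le> norm A + norm B"
    by (rule norm_le_mbd) (simp add: plus_bmat.rep_eq mbd_add mbd_norm)
  show "norm (A * B) \<le> norm A * norm B"
    by (rule norm_le_mbd) (simp add: times_bmat.rep_eq mbd_mmul mbd_norm)
  have le: "norm (a *\<^sub>R A) \<le> \<bar>a\<bar> * norm A" for a and A :: "'a bmat"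
    using mbd_scale[OF mbd_norm[of A], of "of_real a"]
    by (intro norm_le_mbd) (simp add: scaleR_bmat.rep_eq)
  show "norm (a *\<^sub>R A) = \<bar>a\<bar> * norm A"
  proof (cases "a = 0")
    case True
    thus ?thesis using le[of 0 A] mbd_nonneg[OF mbd_norm[of "0 *\<^sub>R A"]] by simp
  next
    case False
    have "A = inverse a *\<^sub>R (a *\<^sub>R A)"
      using False by (intro bmat_eqI) (simp add: scaleR_bmat.rep_eq)
    hence "norm A \<le> \<bar>inverse a\<bar> * norm (a *\<^sub>R A)" using le[of "inverse a" "a *\<^sub>R A"] by simp
    hence "\<bar>a\<bar> * norm A \<le> norm (a *\<^sub>R A)" using False by (simp add: field_simps)
    thus ?thesis using le[of a A] by simp
  qed
  have "norm (1 :: 'a bmat) \<le> 1"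
    using mbd_diagonal[of 1 "\<lambda>_ :: 'a. 1"] by (intro norm_le_mbd) (simp add: one_bmat.rep_eq)
  moreover have "1 \<le> norm (1 :: 'a bmat)"
    using ent_le_norm[of "1 :: 'a bmat" undefined undefined] by (simp add: one_bmat.rep_eq)
  ultimately show "norm (1 :: 'a bmat) = 1" by simp
qed

end

lemmas ent_simps = zero_bmat.rep_eq one_bmat.rep_eq plus_bmat.rep_eq minus_bmat.rep_eq
  uminus_bmat.rep_eq scaleR_bmat.rep_eq

lemma ent_sum: "ent (\<Sum>i\<in>S. f i) x y = (\<Sum>i\<in>S. ent (f i) x y)"
  by (induction S rule: infinite_finite_induct) (auto simp: ent_simps)

lemma ent_times: "ent (A * B) x y = (\<Sum>\<^sub>\<infinity>z. ent A x z * ent B z y)"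
  by (simp add: times_bmat.rep_eq mmul_def)

lemma l2_ent: "l2 (ent A x)" "l2 (\<lambda>x. ent A x y)"
  by (rule mbd_row(1)[OF mbd_norm] mbd_column(1)[OF mbd_norm])+

lemma ent_tendsto:
  assumes "X \<longlonglongrightarrow> A"
  shows "(\<lambda>n. ent (X n) x y) \<longlonglongrightarrow> ent A x y"
proof -
  have "(\<lambda>n. norm (X n - A)) \<longlonglongrightarrow> 0"
    using assms by (simp add: tendsto_norm_zero_iff LIM_zero_iff)
  hence "(\<lambda>n. ent (X n) x y - ent A x y) \<longlonglongrightarrow> 0"
    by (rule Lim_null_comparison[rotated]) (use ent_le_norm[of "_ - A" x y] in \<open>simp add: ent_simps\<close>)
  thus ?thesis by (simp add: LIM_zero_iff)
qed

text \<open>Norms bound entries, so entrywise limits exist. \<open>mbd_limit\<close> is then used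
  twice: for boundedness of the limit and, applied to \<open>X m - X n\<close> with n growing, for
  convergence in norm.\<close>

instance bmat :: (type) banach
proof
  fix X :: "nat \<Rightarrow> 'a bmat"
  assume X: "Cauchy X"
  have "Cauchy (\<lambda>n. ent (X n) x y)" for x y
  proof (rule CauchyI)
    fix e :: real assume "e > 0"
    then obtain M where M: "\<And>m n. m \<ge> M \<Longrightarrow> n \<ge> M \<Longrightarrow> norm (X m - X n) < e" using CauchyD[OF X] by blast
    have "cmod (ent (X m) x y - ent (X n) x y) < e" if "m \<ge> M" "n \<ge> M" for m n
      using ent_le_norm[of "X m - X n" x y] M[OF that] by (simp add: ent_simps)
    thus "\<exists>M. \<forall>m\<ge>M. \<forall>n\<ge>M. cmod (ent (X m) x y - ent (X n) x y) < e" by blast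
  qed
  then obtain L where L: "\<And>x y. (\<lambda>n. ent (X n) x y) \<longlonglongrightarrow> L x y"
    unfolding Cauchy_convergent_iff convergent_def by metis
  obtain B where B: "\<And>n. norm (X n) \<le> B"
    using Cauchy_Bseq[OF X] by (auto simp: Bseq_def)
  have "mbd B L"
    by (rule mbd_limit[OF L, of 0]) (rule mbd_mono[OF mbd_norm B])
  then obtain A where A: "L = ent A" using Abs_bmat_inverse by (metis (mono_tags) mem_Collect_eq)
  have "X \<longlonglongrightarrow> A"
  proof (rule LIMSEQ_I)
    fix e :: real assume "e > 0"
    hence "e/2 > 0" by simp
    then obtain M where M: "\<And>m n. m \<ge> M \<Longrightarrow> n \<ge> M \<Longrightarrow> norm (X m - X n) < e/2" using CauchyD[OF X] by blast
    have "norm (X m - A) < e" if "m \<ge> M" for m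
    proof -
      have "mbd (e/2) (ent (X m - A))"
      proof (rule mbd_limit[of "\<lambda>n. ent (X m - X n)" _ M])
        show "(\<lambda>n. ent (X m - X n) x y) \<longlonglongrightarrow> ent (X m - A) x y" for x y
          using L[of x y] unfolding A ent_simps by (intro tendsto_intros)
        show "n \<ge> M \<Longrightarrow> mbd (e/2) (ent (X m - X n))" for n
          using M[OF that, of n] by (intro mbd_mono[OF mbd_norm]) auto
      qed
      thus ?thesis using norm_le_mbd \<open>e > 0\<close> by fastforce
    qed
    thus "\<exists>M. \<forall>m\<ge>M. norm (X m - A) < e" by blast
  qed
  thus "convergent X" unfolding convergent_def by blast
qed

section \<open>Complex scalars, adjoints, diagonal matrices and blocks\<close>

lift_definition cscale :: "complex \<Rightarrow> 'x bmat \<Rightarrow> 'x bmat" is "\<lambda>a M x y. a * M x y"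
  using mbd_scale by blast

lemma norm_cscale: "norm (cscale a A) = cmod a * norm A"
proof (cases "a = 0")
  case True
  have "cscale 0 A = 0" by (rule bmat_eqI) (simp add: cscale.rep_eq ent_simps)
  thus ?thesis using True by simp
next
  case False
  have le: "norm (cscale a A) \<le> cmod a * norm A" for a and A :: "'a bmat"
    using mbd_scale[OF mbd_norm[of A], of a] by (intro norm_le_mbd) (simp add: cscale.rep_eq)
  have "A = cscale (inverse a) (cscale a A)"
    using False by (intro bmat_eqI) (simp add: cscale.rep_eq)
  hence "norm A \<le> cmod (inverse a) * norm (cscale a A)" using le[of "inverse a" "cscale a A"] by simp
  hence "cmod a * norm A \<le> norm (cscale a A)" using False by (simp add: norm_inverse field_simps norm_divide)
  thus ?thesis using le[of a A] by simp
qed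

lemma cscale_mult: "cscale a A * B = cscale a (A * B)" "A * cscale a B = cscale a (A * B)"
  by (rule bmat_eqI, simp add: ent_times cscale.rep_eq mult.assoc mult.left_commute infsum_cmult_right')+

lift_definition adj :: "'x bmat \<Rightarrow> 'x bmat" is "\<lambda>M x y. cnj (M y x)"
  by (erule exE, drule mbd_cnj, drule mbd_transpose, erule exI)

lemma adj_mult: "adj (A * B) = adj B * adj A"
  by (rule bmat_eqI) (simp add: adj.rep_eq ent_times mult.commute flip: infsum_cnj)

lemma norm_adj [simp]: "norm (adj A) = norm A"
proof -
  have "norm (adj A) \<le> norm A" for A :: "'a bmat"
    by (rule norm_le_mbd) (simp add: adj.rep_eq mbd_cnj[OF mbd_transpose] mbd_norm)
  moreover have "adj (adj A) = A" by (rule bmat_eqI) (simp add: adj.rep_eq)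
  ultimately show ?thesis by (metis antisym)
qed

text \<open>Only functions with values in \<open>[-1, 1]\<close> are used; the truncation makes \<open>Dg\<close> total.\<close>

lift_definition Dg :: "('x \<Rightarrow> real) \<Rightarrow> 'x bmat" is
  "\<lambda>f x y. if x = y then (if \<bar>f x\<bar> \<le> 1 then of_real (f x) else 0) else 0"
  by (intro exI[of _ 1] mbd_diagonal) auto

lemma ent_Dg_mult:
  assumes "\<And>x. \<bar>f x\<bar> \<le> 1"
  shows "ent (Dg f * A) x y = of_real (f x) * ent A x y" "ent (A * Dg f) x y = ent A x y * of_real (f y)"
proof -
  have "((\<lambda>z. ent (Dg f) x z * ent A z y) has_sum (\<Sum>z\<in>{x}. ent (Dg f) x z * ent A z y)) UNIV"
    by (rule has_sum_finite_neutralI[where B="{x}"]) (auto simp: Dg.rep_eq)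
  thus "ent (Dg f * A) x y = of_real (f x) * ent A x y"
    using assms by (simp add: ent_times has_sum_iff Dg.rep_eq)
  have "((\<lambda>z. ent A x z * ent (Dg f) z y) has_sum (\<Sum>z\<in>{y}. ent A x z * ent (Dg f) z y)) UNIV"
    by (rule has_sum_finite_neutralI[where B="{y}"]) (auto simp: Dg.rep_eq)
  thus "ent (A * Dg f) x y = ent A x y * of_real (f y)"
    using assms by (simp add: ent_times has_sum_iff Dg.rep_eq)
qed

lemma norm_Dg: "norm (Dg f) \<le> 1"
  by (rule norm_le_mbd) (auto simp: Dg.rep_eq intro!: mbd_diagonal)

lemma norm_Dg_mult: "norm (Dg f * A) \<le> norm A" "norm (A * Dg f) \<le> norm A"
  using norm_mult_ineq[of "Dg f" A] norm_mult_ineq[of A "Dg f"]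
    mult_right_mono[OF norm_Dg[of f], of "norm A"] mult_left_mono[OF norm_Dg[of f], of "norm A"] by simp_all

text \<open>The coordinate projection onto the fibre of \<pi> over \<open>p\<close>. With
  \<open>fst\<close> or \<open>snd\<close> for \<pi> it singles out the two kinds of slices of a
  tensor; with a map to the corners of large cells it localizes at a coarse scale.\<close>

definition Pr :: "('x \<Rightarrow> 'p) \<Rightarrow> 'p \<Rightarrow> 'x bmat" where
  "Pr \<pi> p = Dg (\<lambda>x. of_bool (\<pi> x = p))"

lemma ent_Pr_mult:
  "ent (Pr \<pi> p * A) x y = (if \<pi> x = p then ent A x y else 0)"
  "ent (A * Pr \<pi> p) x y = (if \<pi> y = p then ent A x y else 0)"
  unfolding Pr_def by (simp_all add: ent_Dg_mult)

lemma norm_Pr_mult: "norm (Pr \<pi> p * A) \<le> norm A" "norm (A * Pr \<pi> p) \<le> norm A"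
  unfolding Pr_def by (rule norm_Dg_mult)+

lemma adj_Dg [simp]: "adj (Dg f) = Dg f"
  by (rule bmat_eqI) (simp add: adj.rep_eq Dg.rep_eq)

text \<open>Blocks keep the full index type, with zeros outside, so that all of them live in one
  normed algebra.\<close>

definition blk :: "('x \<Rightarrow> 'p) \<Rightarrow> 'x bmat \<Rightarrow> 'p \<Rightarrow> 'p \<Rightarrow> 'x bmat" where
  "blk \<pi> A i j = Pr \<pi> i * A * Pr \<pi> j"

lemma ent_blk: "ent (blk \<pi> A i j) x y = (if \<pi> x = i \<and> \<pi> y = j then ent A x y else 0)"
  unfolding blk_def by (simp add: ent_Pr_mult)

lemma norm_blk_le: "norm (blk \<pi> A i j) \<le> norm A"
  unfolding blk_def using norm_Pr_mult order_trans by metis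

lemma blk_diff: "blk \<pi> (A - B) i j = blk \<pi> A i j - blk \<pi> B i j"
  and blk_add: "blk \<pi> (A + B) i j = blk \<pi> A i j + blk \<pi> B i j"
  and blk_cscale: "blk \<pi> (cscale a A) i j = cscale a (blk \<pi> A i j)"
  and blk_adj: "blk \<pi> (adj A) i j = adj (blk \<pi> A j i)"
  by (rule bmat_eqI, simp add: ent_blk ent_simps cscale.rep_eq adj.rep_eq)+

lemma L2_set_fibres:
  assumes "finite F"
  shows "L2_set (\<lambda>p. L2_set f {x\<in>F. \<pi> x = p}) (\<pi> ` F) = L2_set f F"
  unfolding L2_set_def using assms
  by (simp add: sum_nonneg sum.image_gen[OF assms, of "\<lambda>x. (f x)\<^sup>2" \<pi>])

lemma summable_on_finite_sum:
  fixes f :: "'i \<Rightarrow> 'x \<Rightarrow> complex"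
  assumes "\<And>i. i \<in> F \<Longrightarrow> f i summable_on A"
  shows "(\<lambda>x. \<Sum>i\<in>F. f i x) summable_on A"
  using assms by (induction F rule: infinite_finite_induct) (auto intro!: summable_on_add)

text \<open>The identity is inserted between \<open>A\<close> and \<open>B\<close> as the sum of the
  projections of a partition. That sum need not converge in norm, so the bilinear form is estimated:
  for fixed \<open>d\<close> and \<open>c\<close> the terms factorize at the middle index into
  \<open>a\<close> and \<open>b\<close>, and Cauchy-Schwarz is applied on each fibre.\<close>

lemma norm_mult_partition:
  fixes A B :: "'a bmat"
  assumes "\<And>P. finite P \<Longrightarrow> (\<Sum>p\<in>P. norm (A * Pr \<pi> p) * norm (Pr \<pi> p * B)) \<le> K"
  shows "norm (A * B) \<le> K"
proof (rule norm_le_mbd, unfold mbd_def, intro conjI allI impI)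
  show "0 \<le> K" using assms[of "{}"] by simp
  fix F G :: "'a set" and c d :: "'a \<Rightarrow> complex"
  assume fin: "finite F" "finite G"
  let ?d = "L2_set (\<lambda>x. cmod (d x)) F" and ?c = "L2_set (\<lambda>x. cmod (c x)) G"
  define a where "a z = (\<Sum>x\<in>F. ent A x z * d x)" for z
  define b where "b z = (\<Sum>y\<in>G. ent B z y * c y)" for z
  have smA: "(\<lambda>z. d x * ent A x z * ent B z y * c y) summable_on UNIV" for x y
  proof -
    have "(\<lambda>z. d x * (ent A x z * ent B z y) * c y) summable_on UNIV"
      by (intro summable_on_cmult_left summable_on_cmult_right l2_summable l2_ent)
    thus ?thesis by (simp add: mult_ac)
  qed
  have e: "(\<Sum>x\<in>F. \<Sum>y\<in>G. d x * ent A x z * ent B z y * c y) = a z * b z" for z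
    unfolding a_def b_def sum_product by (simp add: mult_ac)
  have "(\<Sum>x\<in>F. \<Sum>y\<in>G. d x * ent (A * B) x y * c y)
    = (\<Sum>x\<in>F. \<Sum>y\<in>G. \<Sum>\<^sub>\<infinity>z. d x * ent A x z * ent B z y * c y)"
    unfolding ent_times
    by (simp add: mult.assoc flip: infsum_cmult_right' infsum_cmult_left')
  also have "\<dots> = (\<Sum>\<^sub>\<infinity>z. \<Sum>x\<in>F. \<Sum>y\<in>G. d x * ent A x z * ent B z y * c y)"
    using fin smA by (simp add: infsum_of_finite_sum summable_on_finite_sum)
  also have "\<dots> = (\<Sum>\<^sub>\<infinity>z. a z * b z)" by (simp add: e)
  finally have eq: "(\<Sum>x\<in>F. \<Sum>y\<in>G. d x * ent (A * B) x y * c y) = (\<Sum>\<^sub>\<infinity>z. a z * b z)" .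
  have sm: "(\<lambda>z. a z * b z) summable_on UNIV"
    using fin smA unfolding e[symmetric] by (intro summable_on_finite_sum) auto
  have le: "cmod (\<Sum>z\<in>H. a z * b z) \<le> K * ?d * ?c" if H: "finite H" for H
  proof -
    let ?Hp = "\<lambda>p. {z\<in>H. \<pi> z = p}"
    have "(\<Sum>z\<in>H. a z * b z) = (\<Sum>p\<in>\<pi> ` H. \<Sum>z\<in>?Hp p. a z * b z)"
      by (rule sum.image_gen[OF H])
    also have "cmod \<dots> \<le> (\<Sum>p\<in>\<pi> ` H. (norm (A * Pr \<pi> p) * norm (Pr \<pi> p * B)) * (?d * ?c))"
    proof (rule sum_norm_le)
      fix p
      have "cmod (\<Sum>z\<in>?Hp p. a z * b z) \<le> (\<Sum>z\<in>?Hp p. \<bar>cmod (a z)\<bar> * \<bar>cmod (b z)\<bar>)"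
        by (rule sum_norm_le) (simp add: norm_mult)
      also have "\<dots> \<le> L2_set (\<lambda>z. cmod (a z)) (?Hp p) * L2_set (\<lambda>z. cmod (b z)) (?Hp p)"
        by (rule L2_set_mult_ineq)
      also have "\<dots> \<le> (norm (A * Pr \<pi> p) * ?d) * (norm (Pr \<pi> p * B) * ?c)"
      proof (intro mult_mono)
      show "L2_set (\<lambda>z. cmod (a z)) (?Hp p) \<le> norm (A * Pr \<pi> p) * ?d"
      proof -
        have "L2_set (\<lambda>z. cmod (\<Sum>x\<in>F. ent (A * Pr \<pi> p) x z * d x)) (?Hp p) \<le> norm (A * Pr \<pi> p) * ?d"
          using H fin by (intro mbd_finite_app[OF mbd_transpose[OF mbd_norm]]) auto
        also have "L2_set (\<lambda>z. cmod (\<Sum>x\<in>F. ent (A * Pr \<pi> p) x z * d x)) (?Hp p)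
          = L2_set (\<lambda>z. cmod (a z)) (?Hp p)"
          by (rule L2_set_cong) (auto simp: ent_Pr_mult a_def)
        finally show ?thesis .
      qed
      show "L2_set (\<lambda>z. cmod (b z)) (?Hp p) \<le> norm (Pr \<pi> p * B) * ?c"
      proof -
        have "L2_set (\<lambda>z. cmod (\<Sum>y\<in>G. ent (Pr \<pi> p * B) z y * c y)) (?Hp p) \<le> norm (Pr \<pi> p * B) * ?c"
          using H fin by (intro mbd_finite_app mbd_norm) auto
        also have "L2_set (\<lambda>z. cmod (\<Sum>y\<in>G. ent (Pr \<pi> p * B) z y * c y)) (?Hp p)
          = L2_set (\<lambda>z. cmod (b z)) (?Hp p)"
          by (rule L2_set_cong) (auto simp: ent_Pr_mult b_def)
        finally show ?thesis .
      qed
      qed (auto simp: L2_set_nonneg)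
      finally show "cmod (\<Sum>z\<in>?Hp p. a z * b z) \<le> (norm (A * Pr \<pi> p) * norm (Pr \<pi> p * B)) * (?d * ?c)"
        by (simp only: mult_ac)
    qed
    also have "\<dots> = (\<Sum>p\<in>\<pi> ` H. norm (A * Pr \<pi> p) * norm (Pr \<pi> p * B)) * (?d * ?c)"
      by (simp add: sum_distrib_right)
    also have "\<dots> \<le> K * (?d * ?c)"
      using H by (intro mult_right_mono assms) (auto simp: L2_set_nonneg)
    finally show ?thesis by (simp add: mult.assoc)
  qed
  have "((\<lambda>H. cmod (\<Sum>z\<in>H. a z * b z)) \<longlongrightarrow> cmod (\<Sum>\<^sub>\<infinity>z. a z * b z)) (finite_subsets_at_top UNIV)"
    by (intro tendsto_norm infsum_tendsto sm)
  hence "cmod (\<Sum>\<^sub>\<infinity>z. a z * b z) \<le> K * ?d * ?c"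
    by (rule tendsto_upperbound[OF _ eventually_finite_subsets_at_top_weakI]) (simp_all add: le)
  thus "cmod (\<Sum>x\<in>F. \<Sum>y\<in>G. d x * ent (A * B) x y * c y) \<le> K * ?d * ?c" unfolding eq .
qed

text \<open>Schur's test for block matrices: \<open>z i j\<close> is split into two square roots and
  Cauchy-Schwarz is applied over the pairs of blocks; row sums go with \<open>D\<close>, column sums
  with \<open>C\<close>. Here \<open>M\<close> is an arbitrary array, because boundedness of a
  tensor has to be derived from its slices.\<close>

lemma mbd_Schur_test:
  fixes z :: "'p \<Rightarrow> 'p \<Rightarrow> real"
  assumes z: "\<And>i j. mbd (z i j) (\<lambda>x y. if \<pi> x = i \<and> \<pi> y = j then M x y else 0)"
    and row: "\<And>i P. finite P \<Longrightarrow> (\<Sum>j\<in>P. z i j) \<le> K"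
    and col: "\<And>j P. finite P \<Longrightarrow> (\<Sum>i\<in>P. z i j) \<le> K"
  shows "mbd K M"
  unfolding mbd_def
proof (intro conjI allI impI)
  show K0: "0 \<le> K" using row[of "{}"] by simp
  have z0: "0 \<le> z i j" for i j by (rule mbd_nonneg[OF z])
  fix F G :: "'a set" and c d :: "'a \<Rightarrow> complex"
  assume fin: "finite F" "finite G"
  let ?F = "\<lambda>i. {x\<in>F. \<pi> x = i}" and ?G = "\<lambda>i. {x\<in>G. \<pi> x = i}"
  define D where "D i = L2_set (\<lambda>x. cmod (d x)) (?F i)" for i
  define C where "C i = L2_set (\<lambda>x. cmod (c x)) (?G i)" for i
  have D0: "0 \<le> D i" and C0: "0 \<le> C i" for i by (simp_all add: D_def C_def L2_set_nonneg)
  let ?P = "\<pi> ` F" and ?Q = "\<pi> ` G"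
  have fP: "finite ?P" "finite ?Q" using fin by auto
  have "(\<Sum>x\<in>F. \<Sum>y\<in>G. d x * M x y * c y) = (\<Sum>i\<in>?P. \<Sum>x\<in>?F i. \<Sum>j\<in>?Q. \<Sum>y\<in>?G j. d x * M x y * c y)"
    by (subst sum.image_gen[OF fin(1), of _ \<pi>]) (intro sum.cong refl sum.image_gen[OF fin(2)])
  also have "\<dots> = (\<Sum>i\<in>?P. \<Sum>j\<in>?Q. \<Sum>x\<in>?F i. \<Sum>y\<in>?G j. d x * M x y * c y)"
    by (intro sum.cong refl sum.swap)
  also have "cmod \<dots> \<le> (\<Sum>i\<in>?P. \<Sum>j\<in>?Q. z i j * D i * C j)"
  proof (intro sum_norm_le)
    fix i j
    have "cmod (\<Sum>x\<in>?F i. \<Sum>y\<in>?G j. d x * (if \<pi> x = i \<and> \<pi> y = j then M x y else 0) * c y) \<le> z i j * D i * C j"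
      unfolding D_def C_def using fin by (intro mbdD[OF z]) auto
    thus "cmod (\<Sum>x\<in>?F i. \<Sum>y\<in>?G j. d x * M x y * c y) \<le> z i j * D i * C j" by simp
  qed
  also have "\<dots> = (\<Sum>(i,j)\<in>?P \<times> ?Q. \<bar>sqrt (z i j) * D i\<bar> * \<bar>sqrt (z i j) * C j\<bar>)"
    using z0 D0 C0 by (simp add: sum.cartesian_product abs_mult mult_ac)
  also have "\<dots> \<le> L2_set (\<lambda>(i,j). sqrt (z i j) * D i) (?P \<times> ?Q) * L2_set (\<lambda>(i,j). sqrt (z i j) * C j) (?P \<times> ?Q)"
    using L2_set_mult_ineq[of "\<lambda>(i,j). sqrt (z i j) * D i" "\<lambda>(i,j). sqrt (z i j) * C j" "?P \<times> ?Q"]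
    by (simp add: case_prod_unfold)
  also have "\<dots> \<le> (sqrt K * L2_set (\<lambda>x. cmod (d x)) F) * (sqrt K * L2_set (\<lambda>x. cmod (c x)) G)"
  proof (intro mult_mono)
    have "(\<Sum>(i,j)\<in>?P \<times> ?Q. (sqrt (z i j) * D i)\<^sup>2) = (\<Sum>i\<in>?P. (\<Sum>j\<in>?Q. z i j) * (D i)\<^sup>2)"
      using z0 by (simp add: sum.cartesian_product[symmetric] power_mult_distrib sum_distrib_right)
    also have "\<dots> \<le> (\<Sum>i\<in>?P. K * (D i)\<^sup>2)" by (intro sum_mono mult_right_mono row fP) auto
    also have "\<dots> = K * (L2_set D ?P)\<^sup>2" by (simp add: L2_set_def sum_nonneg sum_distrib_left)
    finally have "sqrt (\<Sum>(i,j)\<in>?P \<times> ?Q. (sqrt (z i j) * D i)\<^sup>2) \<le> sqrt (K * (L2_set D ?P)\<^sup>2)"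
      by (rule real_sqrt_le_mono)
    moreover have "L2_set D ?P = L2_set (\<lambda>x. cmod (d x)) F"
      unfolding D_def by (rule L2_set_fibres[OF fin(1)])
    ultimately show "L2_set (\<lambda>(i,j). sqrt (z i j) * D i) (?P \<times> ?Q) \<le> sqrt K * L2_set (\<lambda>x. cmod (d x)) F"
      by (simp add: L2_set_def[of _ "?P \<times> ?Q"] case_prod_unfold real_sqrt_mult L2_set_nonneg)
    have "(\<Sum>(i,j)\<in>?P \<times> ?Q. (sqrt (z i j) * C j)\<^sup>2) = (\<Sum>i\<in>?P. \<Sum>j\<in>?Q. z i j * (C j)\<^sup>2)"
      using z0 by (simp add: sum.cartesian_product[symmetric] power_mult_distrib)
    also have "\<dots> = (\<Sum>j\<in>?Q. (\<Sum>i\<in>?P. z i j) * (C j)\<^sup>2)"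
      by (subst sum.swap) (simp add: sum_distrib_right)
    also have "\<dots> \<le> (\<Sum>j\<in>?Q. K * (C j)\<^sup>2)" by (intro sum_mono mult_right_mono col fP) auto
    also have "\<dots> = K * (L2_set C ?Q)\<^sup>2" by (simp add: L2_set_def sum_nonneg sum_distrib_left)
    finally have "sqrt (\<Sum>(i,j)\<in>?P \<times> ?Q. (sqrt (z i j) * C j)\<^sup>2) \<le> sqrt (K * (L2_set C ?Q)\<^sup>2)"
      by (rule real_sqrt_le_mono)
    moreover have "L2_set C ?Q = L2_set (\<lambda>x. cmod (c x)) G"
      unfolding C_def by (rule L2_set_fibres[OF fin(2)])
    ultimately show "L2_set (\<lambda>(i,j). sqrt (z i j) * C j) (?P \<times> ?Q) \<le> sqrt K * L2_set (\<lambda>x. cmod (c x)) G"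
      by (simp add: L2_set_def[of _ "?P \<times> ?Q"] case_prod_unfold real_sqrt_mult L2_set_nonneg)
  qed (auto simp: K0 L2_set_nonneg)
  also have "\<dots> = K * L2_set (\<lambda>x. cmod (d x)) F * L2_set (\<lambda>x. cmod (c x)) G"
    using K0 by (simp add: mult_ac)
  finally show "cmod (\<Sum>x\<in>F. \<Sum>y\<in>G. d x * M x y * c y)
    \<le> K * L2_set (\<lambda>x. cmod (d x)) F * L2_set (\<lambda>y. cmod (c y)) G" .
qed

section \<open>Norms on matrices with entries in \<open>[0, \<infinity>]\<close>\<close>

lemma sum_le_nn_integral_count_space:
  fixes f :: "'a \<Rightarrow> ennreal"
  assumes "finite F" "F \<subseteq> A"
  shows "sum f F \<le> (\<integral>\<^sup>+x. f x \<partial>count_space A)"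
proof -
  have "sum f F = (\<integral>\<^sup>+x. f x \<partial>count_space F)"
    using assms by (simp add: nn_integral_count_space_finite)
  also have "\<dots> = (\<integral>\<^sup>+x. f x * indicator F x \<partial>count_space A)"
    using assms
    by (simp add: nn_integral_count_space_indicator mult.assoc flip: indicator_inter_arith)
       (simp add: Int_absorb2)
  also have "\<dots> \<le> (\<integral>\<^sup>+x. f x \<partial>count_space A)"
    by (intro nn_integral_mono) (auto simp: indicator_def)
  finally show ?thesis .
qed

lemma sum_le_of_nn_integral_le:
  fixes f :: "'a \<Rightarrow> real"
  assumes "finite P" "\<And>x. x \<notin> A \<Longrightarrow> f x = 0" "\<And>x. 0 \<le> f x" "0 \<le> K"
    "(\<integral>\<^sup>+x. ennreal (f x) \<partial>count_space A) \<le> ennreal K"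
  shows "sum f P \<le> K"
proof -
  have "sum f P = sum f (P \<inter> A)"
    using assms by (intro sum.mono_neutral_right) auto
  moreover have "ennreal (sum f (P \<inter> A)) \<le> ennreal K"
    using sum_le_nn_integral_count_space[of "P \<inter> A" A "\<lambda>x. ennreal (f x)"] assms
    by (simp add: sum_ennreal order_trans)
  ultimately show ?thesis using assms by simp
qed

lemma nn_integral_count_space_le:
  fixes f :: "'a \<Rightarrow> ennreal"
  assumes le: "\<And>F. finite F \<Longrightarrow> F \<subseteq> A \<Longrightarrow> sum f F \<le> c"
  shows "(\<integral>\<^sup>+x. f x \<partial>count_space A) \<le> c"
proof (cases "c = \<infinity>")
  case False
  then obtain r where r: "c = ennreal r" "0 \<le> r" by (cases c) auto
  have fin: "f x < \<infinity>" if "x \<in> A" for x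
    using le[of "{x}"] that False by (simp add: less_top order_le_less_trans)
  define g where "g x = enn2real (f x)" for x
  have fg: "f x = ennreal (g x)" if "x \<in> A" for x using fin[OF that] by (simp add: g_def)
  have g0: "0 \<le> g x" for x by (simp add: g_def)
  have sg: "sum g F \<le> r" if "finite F" "F \<subseteq> A" for F
  proof -
    have "ennreal (sum g F) = sum f F"
      using that fg g0 by (simp add: subset_iff flip: sum_ennreal)
    thus ?thesis using le[OF that] r by (metis ennreal_le_iff)
  qed
  have ab: "Infinite_Set_Sum.abs_summable_on g A"
    by (rule abs_summable_finite_sumsI[of _ _ r]) (use sg g0 in auto)
  have "(\<integral>\<^sup>+x. f x \<partial>count_space A) = (\<integral>\<^sup>+x. g x \<partial>count_space A)"
    by (intro nn_integral_cong) (auto simp: fg)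
  also have "\<dots> = ennreal (infsum g A)"
    using ab g0 by (simp add: nn_integral_conv_infsetsum infsetsum_infsum)
  also have "infsum g A \<le> r"
  proof (rule infsum_le_finite_sums[OF _ sg])
    show "g summable_on A"
      by (rule nonneg_bdd_above_summable_on) (auto intro!: bdd_aboveI2[where M=r] sg g0)
  qed
  finally show ?thesis using r by (simp add: ennreal_leI)
qed simp

text \<open>Turns the sums of the definitions into integrals over counting measure, so that exchange
  of sums, Fatou and dominated convergence apply without summability conditions on the
  terms.\<close>

lemma infsum_eq_nn_integral:
  fixes f :: "'a \<Rightarrow> ennreal"
  shows "infsum f A = (\<integral>\<^sup>+x. f x \<partial>count_space A)"
proof (rule antisym)
  have e: "infsum f A = (SUP F\<in>{F. finite F \<and> F \<subseteq> A}. sum f F)"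
    by (rule nonneg_infsum_complete) simp
  show "infsum f A \<le> (\<integral>\<^sup>+x. f x \<partial>count_space A)"
    unfolding e by (intro SUP_least sum_le_nn_integral_count_space) auto
  show "(\<integral>\<^sup>+x. f x \<partial>count_space A) \<le> infsum f A"
    unfolding e by (intro nn_integral_count_space_le SUP_upper) auto
qed

section \<open>Matrices of block norms\<close>

definition supp :: "('x \<Rightarrow> 'p) \<Rightarrow> 'p set \<Rightarrow> 'x bmat \<Rightarrow> bool" where
  "supp \<pi> I A \<longleftrightarrow> (\<forall>x y. ent A x y \<noteq> 0 \<longrightarrow> \<pi> x \<in> I \<and> \<pi> y \<in> I)"

lemma suppI: "(\<And>x y. \<not> (\<pi> x \<in> I \<and> \<pi> y \<in> I) \<Longrightarrow> ent A x y = 0) \<Longrightarrow> supp \<pi> I A"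
  unfolding supp_def by blast

lemma suppD: "supp \<pi> I A \<Longrightarrow> \<not> (\<pi> x \<in> I \<and> \<pi> y \<in> I) \<Longrightarrow> ent A x y = 0"
  unfolding supp_def by blast

lemma supp_Pr:
  assumes "supp \<pi> I A" "i \<notin> I"
  shows "Pr \<pi> i * A = 0" "A * Pr \<pi> i = 0"
  using assms by (auto intro!: bmat_eqI simp: ent_Pr_mult ent_simps suppD)

lemma supp_mult: "supp \<pi> I A \<Longrightarrow> supp \<pi> I B \<Longrightarrow> supp \<pi> I (A * B)"
  unfolding supp_def ent_times by (metis (mono_tags, lifting) infsum_0 mult_zero_left mult_zero_right)

lemma supp_diff: "supp \<pi> I A \<Longrightarrow> supp \<pi> I B \<Longrightarrow> supp \<pi> I (A - B)"
  and supp_add: "supp \<pi> I A \<Longrightarrow> supp \<pi> I B \<Longrightarrow> supp \<pi> I (A + B)"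
  and supp_cscale: "supp \<pi> I A \<Longrightarrow> supp \<pi> I (cscale a A)"
  and supp_scaleR: "supp \<pi> I A \<Longrightarrow> supp \<pi> I (r *\<^sub>R A)"
  by (rule suppI, simp add: ent_simps cscale.rep_eq suppD)+

lemma supp_adj: "supp \<pi> I A \<Longrightarrow> supp \<pi> I (adj A)"
  by (rule suppI) (auto simp: adj.rep_eq intro: suppD)

lemma supp_sum: "(\<And>k. k \<in> S \<Longrightarrow> supp \<pi> I (A k)) \<Longrightarrow> supp \<pi> I (\<Sum>k\<in>S. A k)"
  unfolding supp_def ent_sum by (blast elim: sum.not_neutral_contains_not_neutral)

definition bn :: "('x \<Rightarrow> 'p) \<Rightarrow> 'x bmat \<Rightarrow> 'p \<Rightarrow> 'p \<Rightarrow> ennreal" where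
  "bn \<pi> A i j = ennreal (norm (blk \<pi> A i j))"

lemma norm_mult_le_nn_integral:
  "ennreal (norm (A * B)) \<le> (\<integral>\<^sup>+p. ennreal (norm (A * Pr \<pi> p) * norm (Pr \<pi> p * B)) \<partial>count_space UNIV)"
    (is "_ \<le> ?S")
proof (cases "?S = \<infinity>")
  case False
  then obtain K where K: "?S = ennreal K" "0 \<le> K" by (cases ?S) auto
  have "norm (A * B) \<le> K"
  proof (rule norm_mult_partition)
    fix P :: "'b set" assume "finite P"
    hence "(\<Sum>p\<in>P. ennreal (norm (A * Pr \<pi> p) * norm (Pr \<pi> p * B))) \<le> ennreal K"
      unfolding K(1)[symmetric] by (rule sum_le_nn_integral_count_space) simp
    thus "(\<Sum>p\<in>P. norm (A * Pr \<pi> p) * norm (Pr \<pi> p * B)) \<le> K"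
      using K(2) by (simp add: sum_ennreal)
  qed
  thus ?thesis unfolding K(1) by (rule ennreal_leI)
qed simp

text \<open>The fibres of \<pi> are inserted between the factors. A fibre outside \<open>I\<close>
  contributes 0 as soon as one factor vanishes there, which restricts the sum to
  \<open>I\<close>.\<close>

lemma bn_mult_le:
  assumes "supp \<pi> I A \<or> supp \<pi> I B"
  shows "bn \<pi> (A * B) i j \<le> (\<integral>\<^sup>+k. bn \<pi> A i k * bn \<pi> B k j \<partial>count_space I)"
proof -
  have "bn \<pi> (A * B) i j = ennreal (norm ((Pr \<pi> i * A) * (B * Pr \<pi> j)))"
    by (simp add: bn_def blk_def mult.assoc)
  also have "\<dots> \<le> (\<integral>\<^sup>+p. ennreal (norm (Pr \<pi> i * A * Pr \<pi> p) * norm (Pr \<pi> p * (B * Pr \<pi> j))) \<partial>count_space UNIV)"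
    by (rule norm_mult_le_nn_integral)
  also have "\<dots> = (\<integral>\<^sup>+p. (bn \<pi> A i p * bn \<pi> B p j) * indicator I p \<partial>count_space UNIV)"
  proof (intro nn_integral_cong)
    fix p
    have "norm (Pr \<pi> i * A * Pr \<pi> p) * norm (Pr \<pi> p * (B * Pr \<pi> j)) = 0" if "p \<notin> I"
      using assms supp_Pr[of \<pi> I _ p] that by (metis mult.assoc mult_zero_left mult_zero_right norm_zero)
    thus "ennreal (norm (Pr \<pi> i * A * Pr \<pi> p) * norm (Pr \<pi> p * (B * Pr \<pi> j)))
      = (bn \<pi> A i p * bn \<pi> B p j) * indicator I p"
      by (auto simp: bn_def blk_def ennreal_mult mult.assoc indicator_def)
  qed
  also have "\<dots> = (\<integral>\<^sup>+k. bn \<pi> A i k * bn \<pi> B k j \<partial>count_space I)"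
    by (rule nn_integral_count_space_indicator[symmetric]) simp
  finally show ?thesis .
qed

lemma bn_add_le: "bn \<pi> (A + B) i j \<le> bn \<pi> A i j + bn \<pi> B i j"
  unfolding bn_def blk_add by (simp add: ennreal_leI norm_triangle_ineq flip: ennreal_plus)

lemma bn_diff_le: "bn \<pi> (A - B) i j \<le> bn \<pi> A i j + bn \<pi> B i j"
  unfolding bn_def blk_diff by (simp add: ennreal_leI norm_triangle_ineq4 flip: ennreal_plus)

lemma bn_cscale: "bn \<pi> (cscale a A) i j = ennreal (cmod a) * bn \<pi> A i j"
  unfolding bn_def blk_cscale norm_cscale by (simp add: ennreal_mult)

lemma bn_adj: "bn \<pi> (adj A) i j = bn \<pi> A j i"
  unfolding bn_def blk_adj by simp

lemma bn_le_norm: "bn \<pi> A i j \<le> ennreal (norm A)"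
  unfolding bn_def by (intro ennreal_leI norm_blk_le)

lemma bn_tendsto:
  assumes "X \<longlonglongrightarrow> A"
  shows "(\<lambda>n. bn \<pi> (X n) i j) \<longlonglongrightarrow> bn \<pi> A i j"
  unfolding bn_def blk_def by (intro tendsto_ennrealI tendsto_intros assms)

lemma scaleR_eq_cscale: "r *\<^sub>R A = cscale (of_real r) A"
  by (rule bmat_eqI) (simp add: ent_simps cscale.rep_eq)

text \<open>What the three concrete norms share. Values in the extended half-line keep the axioms
  free of finiteness conditions. \<open>Fatou\<close> is lower semicontinuity under entrywise limits
  and serves both completeness and limits of series; \<open>schur\<close> leads to bounds on the
  operator norm; \<open>unit\<close> puts the diagonal projection of the index set into the
  algebra.\<close>

locale matrix_norm =
  fixes N :: "('p \<Rightarrow> 'p \<Rightarrow> ennreal) \<Rightarrow> ennreal" and I :: "'p set" and C :: real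
  assumes C_pos: "0 < C"
    and mono: "(\<And>i j. i \<in> I \<Longrightarrow> j \<in> I \<Longrightarrow> m i j \<le> m' i j) \<Longrightarrow> N m \<le> N m'"
    and scale: "N (\<lambda>i j. ennreal c * m i j) = ennreal c * N m"
    and add: "N (\<lambda>i j. m i j + m' i j) \<le> N m + N m'"
    and Fatou: "(\<And>i j. i \<in> I \<Longrightarrow> j \<in> I \<Longrightarrow> (\<lambda>n. M n i j) \<longlonglongrightarrow> m i j) \<Longrightarrow>
      (\<And>n::nat. N (M n) \<le> b) \<Longrightarrow> N m \<le> b"
    and schur: "\<exists>K>0. \<forall>m. (\<forall>i\<in>I. (\<integral>\<^sup>+j. m i j \<partial>count_space I) \<le> ennreal K * N m)
        \<and> (\<forall>j\<in>I. (\<integral>\<^sup>+i. m i j \<partial>count_space I) \<le> ennreal K * N m)"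
    and prod: "N (\<lambda>i j. \<integral>\<^sup>+k. m i k * m' k j \<partial>count_space I) \<le> ennreal C * N m * N m'"
    and transpose: "N (\<lambda>i j. m j i) = N m"
    and unit: "N (\<lambda>i j. of_bool (i = j)) < \<infinity>"
begin

lemma bn_mult:
  assumes "supp \<pi> I A \<or> supp \<pi> I B"
  shows "N (bn \<pi> (A * B)) \<le> ennreal C * N (bn \<pi> A) * N (bn \<pi> B)"
  by (rule order_trans[OF mono prod]) (rule bn_mult_le[OF assms])

lemma bn_mult_finite:
  assumes "supp \<pi> I A \<or> supp \<pi> I B" "N (bn \<pi> A) < \<infinity>" "N (bn \<pi> B) < \<infinity>"
  shows "N (bn \<pi> (A * B)) < \<infinity>"
  using bn_mult[OF assms(1)] assms(2,3)
  by (simp add: ennreal_mult_less_top less_top order_le_less_trans)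

lemma bn_add: "N (bn \<pi> (A + B)) \<le> N (bn \<pi> A) + N (bn \<pi> B)"
  by (rule order_trans[OF mono add]) (rule bn_add_le)

lemma bn_diff: "N (bn \<pi> (A - B)) \<le> N (bn \<pi> A) + N (bn \<pi> B)"
  by (rule order_trans[OF mono add]) (rule bn_diff_le)

lemma bn_scale: "N (bn \<pi> (cscale a A)) = ennreal (cmod a) * N (bn \<pi> A)"
  unfolding bn_cscale[abs_def] by (rule scale)

lemma bn_star: "N (bn \<pi> (adj A)) = N (bn \<pi> A)"
  unfolding bn_adj[abs_def] by (rule transpose)

lemma bn_zero: "N (bn \<pi> 0) = 0"
  using bn_scale[of \<pi> 0 0] by (simp add: flip: scaleR_eq_cscale)
     (metis cscale.rep_eq bmat_eqI mult_zero_left zero_bmat.rep_eq)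

lemma bn_sum: "N (bn \<pi> (\<Sum>k\<in>S. A k)) \<le> (\<Sum>k\<in>S. N (bn \<pi> (A k)))"
  by (induction S rule: infinite_finite_induct)
     (auto simp: bn_zero intro: order_trans[OF bn_add] add_left_mono)

lemma bn_Fatou:
  assumes "X \<longlonglongrightarrow> A" "\<And>n. N (bn \<pi> (X n)) \<le> b"
  shows "N (bn \<pi> A) \<le> b"
  by (rule Fatou[OF bn_tendsto[OF assms(1)] assms(2)])

text \<open>Substitute for the inequality between the spectral radius with respect to
  \<open>N\<close> and the operator norm. One small power is asked for instead of a limit of roots,
  since a regrouped Neumann series needs no more.\<close>

definition spectral :: "('x \<Rightarrow> 'p) \<Rightarrow> bool" where
  "spectral \<pi> \<longleftrightarrow> (\<forall>R. norm R < 1 \<longrightarrow> supp \<pi> I R \<longrightarrow> N (bn \<pi> R) < \<infinity> \<longrightarrow>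
    (\<forall>e>0. \<exists>n\<ge>1. N (bn \<pi> (R ^ n)) < e))"

end

section \<open>Inverses by Neumann series\<close>

lemma l2n_diff_scaled:
  assumes "l2 u" "l2 w"
  shows "(l2n (\<lambda>x. u x - of_real c * w x))\<^sup>2
    = (l2n u)\<^sup>2 - 2 * c * Re (\<Sum>\<^sub>\<infinity>x. cnj (u x) * w x) + c\<^sup>2 * (l2n w)\<^sup>2"
proof -
  have e: "(l2n v)\<^sup>2 = (\<Sum>\<^sub>\<infinity>x. (cmod (v x))\<^sup>2)" for v :: "'a \<Rightarrow> complex"
    unfolding ell2_norm_def by (simp add: infsum_nonneg)
  have s1: "(\<lambda>x. (cmod (u x))\<^sup>2) summable_on UNIV" "(\<lambda>x. (cmod (w x))\<^sup>2) summable_on UNIV"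
    using assms by (auto simp: l2_def)
  have s2: "(\<lambda>x. cnj (u x) * w x) summable_on UNIV"
    by (intro l2_summable) (use assms l2_cnj in auto)
  have s3: "(\<lambda>x. - (2 * c) * Re (cnj (u x) * w x)) summable_on UNIV" "(\<lambda>x. c\<^sup>2 * (cmod (w x))\<^sup>2) summable_on UNIV"
    by (intro summable_on_cmult_right summable_on_Re s1 s2)+
  have p: "(cmod (u x - of_real c * w x))\<^sup>2
    = ((cmod (u x))\<^sup>2 + - (2 * c) * Re (cnj (u x) * w x)) + c\<^sup>2 * (cmod (w x))\<^sup>2" for x
    unfolding cmod_power2 by (simp add: power2_eq_square algebra_simps)
  have "(\<Sum>\<^sub>\<infinity>x. (cmod (u x - of_real c * w x))\<^sup>2)
    = (\<Sum>\<^sub>\<infinity>x. (cmod (u x))\<^sup>2) + (\<Sum>\<^sub>\<infinity>x. - (2 * c) * Re (cnj (u x) * w x)) + (\<Sum>\<^sub>\<infinity>x. c\<^sup>2 * (cmod (w x))\<^sup>2)"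
    unfolding p infsum_add[OF summable_on_add[OF s1(1) s3(1)] s3(2)] infsum_add[OF s1(1) s3(1)] ..
  also have "(\<Sum>\<^sub>\<infinity>x. - (2 * c) * Re (cnj (u x) * w x)) = - (2 * c) * Re (\<Sum>\<^sub>\<infinity>x. cnj (u x) * w x)"
    unfolding infsum_cmult_right' infsum_Re[OF s2] ..
  finally show ?thesis unfolding e by (simp add: infsum_cmult_right')
qed

lemma app_adj_inner:
  assumes "l2 u"
  shows "Re (\<Sum>\<^sub>\<infinity>x. cnj (u x) * app (ent (adj T)) (app (ent T) u) x) = (l2n (app (ent T) u))\<^sup>2"
proof -
  let ?w = "app (ent T) u"
  have w: "l2 ?w" by (rule mbd_app(1)[OF mbd_norm assms])
  have "(\<Sum>\<^sub>\<infinity>x. cnj (u x) * app (ent (adj T)) ?w x)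
    = (\<Sum>\<^sub>\<infinity>y. app (\<lambda>x y. ent (adj T) y x) (\<lambda>x. cnj (u x)) y * ?w y)"
    by (rule app_transpose[OF mbd_norm]) (use assms l2_cnj w in auto)
  also have "app (\<lambda>x y. ent (adj T) y x) (\<lambda>x. cnj (u x)) = (\<lambda>y. cnj (?w y))"
    unfolding app_def by (simp add: adj.rep_eq flip: infsum_cnj)
  also have "(\<Sum>\<^sub>\<infinity>y. cnj (?w y) * ?w y) = (\<Sum>\<^sub>\<infinity>y. of_real ((cmod (?w y))\<^sup>2))"
    by (simp only: complex_norm_square mult.commute)
  also have "Re \<dots> = (\<Sum>\<^sub>\<infinity>y. Re (of_real ((cmod (?w y))\<^sup>2)))"
    using w by (intro infsum_Re[symmetric]) (simp only: l2_def summable_on_of_real)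
  finally show ?thesis unfolding ell2_norm_def by (simp add: infsum_nonneg)
qed

text \<open>If \<open>S\<close> inverts \<open>T\<close> on the range of \<open>p\<close>, then \<open>c T\<^sup>* T\<close> is so close to \<open>p\<close> that a Neumann
  series for its inverse converges: \<open>\<parallel>u - c T\<^sup>* T u\<parallel>\<^sup>2 \<le> \<parallel>u\<parallel>\<^sup>2 - c \<parallel>T u\<parallel>\<^sup>2\<close> and \<open>\<parallel>u\<parallel> \<le> \<parallel>S\<parallel> \<parallel>T u\<parallel>\<close>.\<close>

lemma norm_proj_minus_less_1:
  fixes T S :: "'x bmat"
  assumes p: "p = Dg (\<lambda>x. of_bool (x \<in> X))" and ST: "S * T = p" and Tp: "T * p = T"
    and T0: "T \<noteq> 0" and S0: "S \<noteq> 0"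
  shows "norm (p - (1 / (norm T)\<^sup>2) *\<^sub>R (adj T * T)) < 1"
proof -
  define c where "c = 1 / (norm T)\<^sup>2"
  have c: "0 < c" "c * (norm T)\<^sup>2 = 1" using T0 by (auto simp: c_def)
  \<comment> \<open>The square of the contraction factor; the maximum with 0 keeps its square root
    nonnegative.\<close>
  define \<kappa> where "\<kappa> = max 0 (1 - c / (norm S)\<^sup>2)"
  have \<kappa>: "0 \<le> \<kappa>" "\<kappa> < 1" using c S0 by (auto simp: \<kappa>_def)
  let ?R = "p - c *\<^sub>R (adj T * T)"
  have "mbd (sqrt \<kappa>) (ent ?R)"
  proof (rule mbdI_app)
    show "0 \<le> sqrt \<kappa>" using \<kappa> by simp
    fix v :: "'x \<Rightarrow> complex" assume v: "l2 v"
    define u where "u x = (if x \<in> X then v x else 0)" for x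
    have u: "l2 u" "l2n u \<le> l2n v" unfolding u_def using l2_if[OF v] by auto
    have app_comp: "app (ent (A * B)) w = app (ent A) (app (ent B) w)" if "l2 w" for A B :: "'x bmat" and w
      using app_mmul[OF mbd_norm mbd_norm that] by (simp add: times_bmat.rep_eq)
    have pv: "app (ent p) v = u"
    proof
      fix x
      have "((\<lambda>y. ent p x y * v y) has_sum (\<Sum>y\<in>{x}. ent p x y * v y)) UNIV"
        by (rule has_sum_finite_neutralI[where B="{x}"]) (auto simp: p Dg.rep_eq)
      thus "app (ent p) v x = u x"
        by (simp add: app_def has_sum_iff p Dg.rep_eq u_def)
    qed
    define t where "t = app (ent T) u"
    have t: "l2 t" unfolding t_def by (rule mbd_app(1)[OF mbd_norm u(1)])
    have tv: "t = app (ent T) v" unfolding t_def pv[symmetric] app_comp[OF v, symmetric] Tp ..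
    have "app (ent S) t = u" unfolding tv app_comp[OF v, symmetric] ST by (rule pv)
    hence ut: "l2n u \<le> norm S * l2n t" using mbd_app(2)[OF mbd_norm t, of S] by simp
    have Rv: "app (ent ?R) v = (\<lambda>x. u x - of_real c * app (ent (adj T)) t x)"
    proof
      fix x
      have s: "(\<lambda>y. ent p x y * v y) summable_on UNIV" "(\<lambda>y. of_real c * (ent (adj T * T) x y * v y)) summable_on UNIV"
        by (intro summable_on_cmult_right l2_summable l2_ent v)+
      have "app (ent ?R) v x = (\<Sum>\<^sub>\<infinity>y. ent p x y * v y - of_real c * (ent (adj T * T) x y * v y))"
        unfolding app_def by (simp add: ent_simps algebra_simps)
      also have "\<dots> = app (ent p) v x - of_real c * app (ent (adj T * T)) v x"
        using infsum_add[OF s(1) iffD2[OF summable_on_uminus s(2)]]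
        by (simp add: app_def infsum_uminus infsum_cmult_right')
      finally show "app (ent ?R) v x = u x - of_real c * app (ent (adj T)) t x"
        by (simp add: pv app_comp[OF v] tv)
    qed
    let ?w = "app (ent (adj T)) t"
    have w: "l2 ?w" "l2n ?w \<le> norm T * l2n t" using mbd_app[OF mbd_norm t, of "adj T"] by simp_all
    have "(l2n (app (ent ?R) v))\<^sup>2 = (l2n u)\<^sup>2 - 2 * c * (l2n t)\<^sup>2 + c\<^sup>2 * (l2n ?w)\<^sup>2"
      unfolding Rv l2n_diff_scaled[OF u(1) w(1)] using app_adj_inner[OF u(1), of T] unfolding t_def by simp
    also have "\<dots> \<le> (l2n u)\<^sup>2 - 2 * c * (l2n t)\<^sup>2 + c\<^sup>2 * (norm T * l2n t)\<^sup>2"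
      by (intro add_left_mono mult_left_mono power_mono w l2n_nonneg) simp
    \<comment> \<open>The choice of \<open>c\<close> makes this bound on the quadratic term half of
      the cross term.\<close>
    also have "c\<^sup>2 * (norm T * l2n t)\<^sup>2 = (c * (norm T)\<^sup>2) * c * (l2n t)\<^sup>2"
      by (simp add: power2_eq_square)
    also have "(l2n u)\<^sup>2 - 2 * c * (l2n t)\<^sup>2 + (c * (norm T)\<^sup>2) * c * (l2n t)\<^sup>2 = (l2n u)\<^sup>2 - c * (l2n t)\<^sup>2"
      unfolding c(2) by simp
    also have "\<dots> \<le> (l2n u)\<^sup>2 - c * ((l2n u)\<^sup>2 / (norm S)\<^sup>2)"
    proof -
      have "(l2n u)\<^sup>2 \<le> (norm S * l2n t)\<^sup>2" by (intro power_mono ut l2n_nonneg)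
      hence "(l2n u)\<^sup>2 / (norm S)\<^sup>2 \<le> (l2n t)\<^sup>2" using S0 by (simp add: field_simps power_mult_distrib)
      from mult_left_mono[OF this, of c] show ?thesis using c(1) by simp
    qed
    also have "\<dots> = (1 - c / (norm S)\<^sup>2) * (l2n u)\<^sup>2" by (simp add: algebra_simps)
    also have "\<dots> \<le> \<kappa> * (l2n v)\<^sup>2"
      by (intro mult_mono power_mono u l2n_nonneg) (auto simp: \<kappa>_def)
    finally have "(l2n (app (ent ?R) v))\<^sup>2 \<le> \<kappa> * (l2n v)\<^sup>2" .
    hence "l2n (app (ent ?R) v) \<le> sqrt (\<kappa> * (l2n v)\<^sup>2)" by (rule real_le_rsqrt)
    also have "\<dots> = sqrt \<kappa> * l2n v" by (simp add: real_sqrt_mult l2n_nonneg)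
    finally show "l2 (app (ent ?R) v) \<and> l2n (app (ent ?R) v) \<le> sqrt \<kappa> * l2n v"
      using mbd_app(1)[OF mbd_norm v] by blast
  qed
  hence "norm ?R \<le> sqrt \<kappa>" by (rule norm_le_mbd)
  also have "\<dots> < 1" using \<kappa> by simp
  finally show ?thesis unfolding c_def .
qed

text \<open>\<open>S * adj S\<close> inverts \<open>adj T * T\<close> relative to \<open>p\<close>
  and hence satisfies the fixed point equation \<open>S' = c p + R S'\<close>. Iterating it gives a
  Neumann series, and \<open>S\<close> is recovered as \<open>S' * adj T\<close>; finiteness of
  \<open>N\<close> survives adjoints, products and limits of bounded partial sums.\<close>

lemma (in matrix_norm) inverse_finite:
  fixes T S :: "'x bmat"
  assumes spec: "spectral \<pi>"
    and p: "p = Dg (\<lambda>x. of_bool (x \<in> X))" and X: "\<And>x. x \<in> X \<Longrightarrow> \<pi> x \<in> I"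
    and TS: "T * S = p" and ST: "S * T = p"
    and Tp: "T * p = T" and Sp: "S * p = S" and pS: "p * S = S"
    and supp: "supp \<pi> I T" "supp \<pi> I S"
    and fin: "N (bn \<pi> T) < \<infinity>"
  shows "N (bn \<pi> S) < \<infinity>"
proof (cases "T = 0 \<or> S = 0")
  case True
  hence "p = 0" using TS by auto
  hence "S = 0" using Sp by simp
  thus ?thesis by (simp add: bn_zero)
next
  case False
  define c where "c = 1 / (norm T)\<^sup>2"
  define R where "R = p - c *\<^sub>R (adj T * T)"
  have nR: "norm R < 1" unfolding R_def c_def
    by (rule norm_proj_minus_less_1[OF p ST Tp]) (use False in auto)
  have ap: "adj p = p" unfolding p by simp
  define S' where "S' = S * adj S"
  have pR: "c *\<^sub>R (adj T * T * S') = c *\<^sub>R p"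
  proof -
    have "adj T * T * S' = adj T * (T * S) * adj S" by (simp add: S'_def mult.assoc)
    also have "\<dots> = adj (S * p * T)" unfolding TS by (simp only: adj_mult ap mult.assoc)
    also have "\<dots> = p" unfolding Sp ST ap ..
    finally show ?thesis by simp
  qed
  have "R * S' = S' - c *\<^sub>R p"
    unfolding R_def left_diff_distrib using pR pS by (simp add: S'_def flip: mult.assoc)
  hence rec: "S' = c *\<^sub>R p + R * S'" by simp
  have suppp: "supp \<pi> I p" unfolding p supp_def using X by (auto simp: Dg.rep_eq)
  have suppR: "supp \<pi> I R" unfolding R_def
    by (intro supp_diff supp_scaleR supp_mult supp_adj suppp supp)
  have finp: "N (bn \<pi> p) < \<infinity>"
  proof (rule order_le_less_trans[OF mono unit])
    fix i j
    have "blk \<pi> p i j = 0" if "i \<noteq> j"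
      using that by (intro bmat_eqI) (auto simp: ent_blk ent_simps p Dg.rep_eq)
    moreover have "bn \<pi> p i j \<le> ennreal 1"
      by (rule order_trans[OF bn_le_norm]) (simp add: p norm_Dg ennreal_leI del: ennreal_1)
    ultimately show "bn \<pi> p i j \<le> of_bool (i = j)" by (auto simp: bn_def)
  qed
  have finR: "N (bn \<pi> R) < \<infinity>"
  proof -
    have "N (bn \<pi> (c *\<^sub>R (adj T * T))) < \<infinity>"
      unfolding scaleR_eq_cscale bn_scale
      using bn_mult_finite[of \<pi> "adj T" T] supp fin by (simp add: bn_star ennreal_mult_less_top)
    thus ?thesis unfolding R_def using bn_diff[of \<pi> p "c *\<^sub>R (adj T * T)"] finp
      by (simp add: order_le_less_trans less_top)
  qed
  \<comment> \<open>The factor \<open>C\<close> in the threshold absorbs the constant of the product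
    inequality, the factor 2 leaves the ratio 1/2 for the geometric series.\<close>
  obtain n where n: "n \<ge> 1" "N (bn \<pi> (R ^ n)) < ennreal (1 / (2 * C))"
    using spec nR suppR finR C_pos unfolding spectral_def
    by (metis ennreal_less_zero_iff zero_less_divide_1_iff zero_less_mult_iff zero_less_numeral)
  define Q where "Q = R ^ n"
  \<comment> \<open>Only \<open>R ^ n\<close> is known to be small in \<open>N\<close>, not
    \<open>R\<close>. So n terms at a time are collected in \<open>Y\<close>, and the series runs
    over powers of \<open>Q\<close>.\<close>
  define Y where "Y = (\<Sum>m<n. R ^ m * (c *\<^sub>R p))"
  have S'n: "S' = (\<Sum>m<k. R ^ m * (c *\<^sub>R p)) + R ^ k * S'" for k
  proof (induction k)
    case (Suc k)
    have "R ^ k * S' = R ^ k * (c *\<^sub>R p) + R ^ Suc k * S'"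
      by (subst rec) (simp only: distrib_left power_Suc2 mult.assoc)
    thus ?case using Suc by (simp add: add.assoc)
  qed simp
  have YQ: "S' = Y + Q * S'" unfolding Y_def Q_def by (rule S'n)
  have suppcp: "supp \<pi> I (c *\<^sub>R p)" by (intro supp_scaleR suppp)
  \<comment> \<open>\<open>R ^ 0\<close> is the identity of the whole type and need not be supported
    over \<open>I\<close>; the powers are therefore carried with the factor
    \<open>c p\<close>.\<close>
  have supp_pow: "supp \<pi> I (R ^ m * (c *\<^sub>R p))" for m
  proof (induction m)
    case (Suc m)
    show ?case unfolding power_Suc mult.assoc by (rule supp_mult[OF suppR Suc])
  qed (simp add: suppcp)
  have fin_pow: "N (bn \<pi> (R ^ m * (c *\<^sub>R p))) < \<infinity>" for m
  proof (induction m)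
    case 0
    thus ?case using finp unfolding scaleR_eq_cscale by (simp add: bn_scale ennreal_mult_less_top)
  next
    case (Suc m)
    show ?case unfolding power_Suc mult.assoc
      by (rule bn_mult_finite[OF _ finR Suc]) (use suppR in auto)
  qed
  have finY: "N (bn \<pi> Y) < \<infinity>"
    unfolding Y_def by (rule order_le_less_trans[OF bn_sum]) (use fin_pow in \<open>auto simp: less_top\<close>)
  have suppY: "supp \<pi> I Y" unfolding Y_def
    by (intro supp_sum supp_pow)
  have suppQY: "supp \<pi> I (Q ^ a * Y)" for a
  proof -
    have "supp \<pi> I (R ^ m * Y)" for m
    proof (induction m)
      case (Suc m)
      show ?case unfolding power_Suc mult.assoc by (rule supp_mult[OF suppR Suc])
    qed (simp add: suppY)
    thus ?thesis unfolding Q_def power_mult[symmetric] .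
  qed
  have CQ: "ennreal C * N (bn \<pi> Q) \<le> ennreal (1/2)"
  proof -
    have "ennreal C * N (bn \<pi> Q) \<le> ennreal C * ennreal (1 / (2 * C))"
      using n(2) unfolding Q_def by (intro mult_left_mono) auto
    also have "\<dots> = ennreal (1/2)" using C_pos by (simp add: ennreal_mult[symmetric])
    finally show ?thesis .
  qed
  have geo: "N (bn \<pi> (Q ^ a * Y)) \<le> ennreal ((1/2) ^ a) * N (bn \<pi> Y)" for a
  proof (induction a)
    case (Suc a)
    have "N (bn \<pi> (Q * (Q ^ a * Y))) \<le> ennreal C * N (bn \<pi> Q) * N (bn \<pi> (Q ^ a * Y))"
      by (rule bn_mult) (use suppQY in auto)
    also have "\<dots> \<le> ennreal (1/2) * (ennreal ((1/2) ^ a) * N (bn \<pi> Y))"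
      by (intro mult_mono CQ Suc) auto
    also have "\<dots> = (ennreal (1/2) * ennreal ((1/2) ^ a)) * N (bn \<pi> Y)" by (simp only: mult.assoc)
    also have "ennreal (1/2) * ennreal ((1/2) ^ a) = ennreal ((1/2) ^ Suc a)"
      by (subst ennreal_mult[symmetric]) auto
    finally show ?case by (simp add: mult.assoc)
  qed simp
  have sums: "N (bn \<pi> (\<Sum>a<m. Q ^ a * Y)) \<le> ennreal 2 * N (bn \<pi> Y)" for m
  proof -
    have "N (bn \<pi> (\<Sum>a<m. Q ^ a * Y)) \<le> (\<Sum>a<m. ennreal ((1/2) ^ a) * N (bn \<pi> Y))"
      by (rule order_trans[OF bn_sum]) (intro sum_mono geo)
    also have "\<dots> = ennreal (\<Sum>a<m. (1/2) ^ a) * N (bn \<pi> Y)"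
      by (simp add: sum_distrib_right sum_ennreal[symmetric] del: sum_ennreal)
    also have "\<dots> \<le> ennreal 2 * N (bn \<pi> Y)"
      by (intro mult_right_mono ennreal_leI) (simp_all add: sum_gp_strict)
    finally show ?thesis .
  qed
  \<comment> \<open>Convergence takes place in the operator norm, where \<open>norm Q < 1\<close>;
    the bound on \<open>N\<close> is uniform over the partial sums and passes to the limit by
    \<open>bn_Fatou\<close>.\<close>
  have "(\<lambda>m. \<Sum>a<m. Q ^ a * Y) \<longlonglongrightarrow> S'"
  proof -
    have QS: "(\<Sum>a<m. Q ^ a * Y) = S' - Q ^ m * S'" for m
    proof (induction m)
      case (Suc m)
      have "Q ^ m * S' = Q ^ m * Y + Q ^ m * (Q * S')"
        by (subst YQ) (rule distrib_left)
      thus ?case using Suc by (simp add: power_Suc2 mult.assoc del: power_Suc)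
    qed simp
    have nQ: "norm Q < 1"
    proof -
      have "norm Q \<le> norm R ^ n" unfolding Q_def by (rule norm_power_ineq)
      also have "\<dots> < 1" using nR n(1) by (simp add: power_less_one_iff)
      finally show ?thesis .
    qed
    have "(\<lambda>m. S' - Q ^ m * S') \<longlonglongrightarrow> S' - 0 * S'"
      by (intro tendsto_intros LIMSEQ_power_zero nQ)
    thus ?thesis unfolding QS by simp
  qed
  hence "N (bn \<pi> S') \<le> ennreal 2 * N (bn \<pi> Y)" by (rule bn_Fatou[OF _ sums])
  hence finS': "N (bn \<pi> S') < \<infinity>" using finY by (simp add: ennreal_mult_less_top order_le_less_trans less_top)
  have "S' * adj T = S * adj (T * S)" by (simp add: S'_def adj_mult mult.assoc)
  hence "S = S' * adj T" unfolding TS ap Sp by simp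
  thus ?thesis using bn_mult_finite[of \<pi> S' "adj T"] finS' fin supp by (simp add: bn_star supp_adj)
qed

section \<open>Summation over relatively separated sets\<close>

lemma sum_int_powr_bounded:
  assumes "1 < t"
  shows "\<exists>B. \<forall>S :: int set. finite S \<longrightarrow> (\<Sum>k\<in>S. (1 + \<bar>real_of_int k\<bar>) powr -t) \<le> B"
proof -
  let ?f = "\<lambda>n. (1 + real n) powr -t"
  have "summable (\<lambda>n. real n powr -t)"
    using assms by (subst summable_real_powr_iff) simp
  hence sm: "summable ?f" by (subst (asm) summable_Suc_iff[symmetric]) (simp add: add.commute)
  have "(\<Sum>k\<in>S. (1 + \<bar>real_of_int k\<bar>) powr -t) \<le> 2 * suminf ?f" if S: "finite S" for S :: "int set"
  proof -
    have le: "(\<Sum>n\<in>X. ?f n) \<le> suminf ?f" if "finite X" for X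
      by (rule sum_le_suminf[OF sm that]) simp
    have e1: "(\<Sum>k\<in>{k\<in>S. 0 \<le> k}. (1 + \<bar>real_of_int k\<bar>) powr -t) = (\<Sum>n\<in>nat ` {k\<in>S. 0 \<le> k}. ?f n)"
      by (subst sum.reindex) (auto simp: inj_on_def intro!: sum.cong)
    have e2: "(\<Sum>k\<in>{k\<in>S. \<not> 0 \<le> k}. (1 + \<bar>real_of_int k\<bar>) powr -t)
      = (\<Sum>n\<in>(\<lambda>k. nat (- k)) ` {k\<in>S. \<not> 0 \<le> k}. ?f n)"
      by (subst sum.reindex) (auto simp: inj_on_def intro!: sum.cong)
    have "(\<Sum>k\<in>S. (1 + \<bar>real_of_int k\<bar>) powr -t)
      = (\<Sum>k\<in>{k\<in>S. 0 \<le> k}. (1 + \<bar>real_of_int k\<bar>) powr -t)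
        + (\<Sum>k\<in>{k\<in>S. \<not> 0 \<le> k}. (1 + \<bar>real_of_int k\<bar>) powr -t)"
      using S by (subst sum.union_disjoint[symmetric]) (auto intro!: sum.cong)
    also have "\<dots> \<le> suminf ?f + suminf ?f"
      unfolding e1 e2 using S by (intro add_mono le) auto
    finally show ?thesis by simp
  qed
  thus ?thesis by blast
qed

definition cell :: "real ^ 'd \<Rightarrow> 'd \<Rightarrow> int" where
  "cell x = (\<lambda>a. \<lfloor>x $ a\<rfloor>)"

text \<open>The half-open unit cube with corner \<open>u + k\<close> lies in a translate of the
  closed unit cube, for which relative separation bounds the number of points uniformly.\<close>

lemma card_cell:
  fixes I :: "(real ^ 'd) set"
  assumes "relatively_separated I"
  shows "\<exists>N. \<forall>u k. finite {j\<in>I. cell (j - u) = k} \<and> card {j\<in>I. cell (j - u) = k} \<le> N"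
proof -
  obtain N where N: "\<And>x. finite (I \<inter> (+) x ` cbox 0 1)" "\<And>x. card (I \<inter> (+) x ` cbox 0 1) \<le> N"
    using assms unfolding relatively_separated_def by blast
  have "{j\<in>I. cell (j - u) = k} \<subseteq> I \<inter> (+) (u + (\<chi> a. of_int (k a))) ` cbox 0 1" for u k
  proof safe
    fix j assume "j \<in> I" "k = cell (j - u)"
    have "j - (u + (\<chi> a. of_int (cell (j - u) a))) \<in> cbox 0 1"
      by (simp add: mem_box_cart cell_def) (metis (no_types) diff_diff_eq diff_ge_0_iff_ge floor_correct frac_def frac_ge_0 frac_lt_1 less_imp_le of_int_floor_le)
    thus "j \<in> (+) (u + (\<chi> a. of_int (cell (j - u) a))) ` cbox 0 1"
      by (intro image_eqI[where x="j - (u + (\<chi> a. of_int (cell (j - u) a)))"]) auto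
  qed
  hence "finite {j\<in>I. cell (j - u) = k} \<and> card {j\<in>I. cell (j - u) = k} \<le> N" for u k
    using N by (meson card_mono finite_subset order_trans)
  thus ?thesis by blast
qed

text \<open>The decay is split evenly over the coordinates, each factor having exponent s/d. After
  grouping the points by integer cells, the sum is dominated by a product of one-dimensional series,
  which converge because s/d > 1.\<close>

lemma relatively_separated_sum:
  fixes I :: "(real ^ 'd) set"
  assumes "relatively_separated I" and s: "real CARD('d) < s"
  shows "\<exists>K>0. \<forall>u F. finite F \<longrightarrow> F \<subseteq> I \<longrightarrow> (\<Sum>j\<in>F. (1 + norm (j - u)) powr -s) \<le> K"
proof -
  define t where "t = s / real CARD('d)"
  have t: "1 < t" using s by (simp add: t_def)
  obtain N where N: "\<And>u k. finite {j\<in>I. cell (j - u) = k}" "\<And>u k. card {j\<in>I. cell (j - u) = k} \<le> N"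
    using card_cell[OF assms(1)] by blast
  obtain B where B: "\<And>S :: int set. finite S \<Longrightarrow> (\<Sum>k\<in>S. (1 + \<bar>real_of_int k\<bar>) powr -t) \<le> B"
    using sum_int_powr_bounded[OF t] by blast
  have B0: "0 \<le> B" using B[of "{}"] by simp
  \<comment> \<open>Majorant of one factor on a whole cell: passing from a coordinate to its floor
    costs 1 + |floor| \<le> 2 (1 + norm), hence the constant \<open>2 powr t\<close>.\<close>
  let ?b = "\<lambda>k. 2 powr t * (1 + \<bar>real_of_int k\<bar>) powr -t"
  define K where "K = real N * (2 powr t * B) ^ CARD('d)"
  have K0: "0 \<le> K" using B0 by (simp add: K_def)
  have "(\<Sum>j\<in>F. (1 + norm (j - u)) powr -s) \<le> K" if F: "finite F" "F \<subseteq> I" for u F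
  proof -
    let ?f = "\<lambda>j. cell (j - u)"
    \<comment> \<open>All integers that occur as cell coordinates; the cells met by \<open>F\<close>
      lie in the finite box over \<open>S\<close>, and over a box a sum of products is a product of
      sums.\<close>
    define S where "S = (\<Union>k\<in>?f ` F. range k)"
    have S: "finite S" using F by (simp add: S_def)
    have bnd: "(1 + norm (j - u)) powr -s \<le> (\<Prod>a\<in>UNIV. ?b (?f j a))" for j
    proof -
      have "(1 + norm (j - u)) powr -s = (\<Prod>a\<in>(UNIV :: 'd set). (1 + norm (j - u)) powr -t)"
        using norm_ge_zero[of "j - u"]
        by (subst prod_constant, subst powr_power, linarith) (simp add: t_def)
      also have "\<dots> \<le> (\<Prod>a\<in>UNIV. ?b (?f j a))"
      proof (intro prod_mono conjI)
        fix a
        let ?v = "(j - u) $ a"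
        have v: "\<bar>?v\<bar> \<le> norm (j - u)" by (rule component_le_norm_cart)
        have "1 + \<bar>real_of_int \<lfloor>?v\<rfloor>\<bar> \<le> 2 * (1 + norm (j - u))"
        proof -
          have "1 + \<bar>y\<bar> \<le> 2 * (1 + n)" if "\<bar>x\<bar> \<le> n" "y \<le> x" "x < y + 1" for x y n :: real
            using that by (cases "0 \<le> x"; cases "0 \<le> y") simp_all
          from this[OF v of_int_floor_le real_of_int_floor_add_one_gt] show ?thesis .
        qed
        hence "(2 * (1 + norm (j - u))) powr -t \<le> (1 + \<bar>real_of_int \<lfloor>?v\<rfloor>\<bar>) powr -t"
          using t by (intro powr_mono2') auto
        moreover have "(2 * (1 + norm (j - u))) powr -t = 2 powr -t * (1 + norm (j - u)) powr -t"
          by (rule powr_mult)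
        ultimately have "2 powr t * (2 powr -t * (1 + norm (j - u)) powr -t) \<le> ?b (?f j a)"
          unfolding cell_def by (intro mult_left_mono) auto
        thus "(1 + norm (j - u)) powr -t \<le> ?b (?f j a)"
          by (simp add: powr_minus flip: mult.assoc)
      qed simp
      finally show ?thesis .
    qed
    have "(\<Sum>j\<in>F. (1 + norm (j - u)) powr -s) \<le> (\<Sum>j\<in>F. \<Prod>a\<in>UNIV. ?b (?f j a))"
      by (intro sum_mono bnd)
    also have "\<dots> = (\<Sum>k\<in>?f ` F. \<Sum>j\<in>{j\<in>F. ?f j = k}. \<Prod>a\<in>UNIV. ?b (?f j a))"
      by (rule sum.image_gen[OF F(1)])
    also have "\<dots> = (\<Sum>k\<in>?f ` F. real (card {j\<in>F. ?f j = k}) * (\<Prod>a\<in>UNIV. ?b (k a)))"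
      by (intro sum.cong refl) (simp add: sum_constant)
    also have "\<dots> \<le> (\<Sum>k\<in>?f ` F. real N * (\<Prod>a\<in>UNIV. ?b (k a)))"
    proof (intro sum_mono mult_right_mono prod_nonneg)
      fix k
      have "card {j\<in>F. ?f j = k} \<le> card {j\<in>I. ?f j = k}"
        using F(2) by (intro card_mono N) auto
      thus "real (card {j\<in>F. ?f j = k}) \<le> real N" using N(2)[of u k] by simp
    qed auto
    also have "\<dots> = real N * (\<Sum>k\<in>?f ` F. \<Prod>a\<in>UNIV. ?b (k a))" by (simp only: sum_distrib_left)
    also have "\<dots> \<le> real N * (\<Sum>k\<in>PiE (UNIV :: 'd set) (\<lambda>_. S). \<Prod>a\<in>UNIV. ?b (k a))"
      using S F by (intro mult_left_mono sum_mono2 finite_PiE prod_nonneg) (auto simp: S_def)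
    also have "(\<Sum>k\<in>PiE (UNIV :: 'd set) (\<lambda>_. S). \<Prod>a\<in>UNIV. ?b (k a)) = (\<Prod>a\<in>(UNIV :: 'd set). \<Sum>m\<in>S. ?b m)"
      using S by (intro prod_sum_PiE[symmetric]) auto
    also have "\<dots> = (2 powr t * (\<Sum>m\<in>S. (1 + \<bar>real_of_int m\<bar>) powr -t)) ^ CARD('d)"
      by (simp add: sum_distrib_left)
    also have "\<dots> \<le> (2 powr t * B) ^ CARD('d)"
      by (intro power_mono mult_left_mono B S mult_nonneg_nonneg sum_nonneg) auto
    finally show ?thesis by (simp add: K_def mult_left_mono)
  qed
  hence "\<forall>u F. finite F \<longrightarrow> F \<subseteq> I \<longrightarrow> (\<Sum>j\<in>F. (1 + norm (j - u)) powr -s) \<le> K + 1"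
    by (meson add_increasing2 zero_le_one)
  thus ?thesis using K0 by (intro exI[of _ "K + 1"]) auto
qed

lemma relatively_separated_nn_integral:
  fixes I :: "(real ^ 'd) set"
  assumes "relatively_separated I" and "real CARD('d) < s"
  shows "\<exists>K>0. \<forall>u. (\<integral>\<^sup>+j. ennreal ((1 + norm (u - j)) powr -s) \<partial>count_space I) \<le> ennreal K
    \<and> (\<integral>\<^sup>+j. ennreal ((1 + norm (j - u)) powr -s) \<partial>count_space I) \<le> ennreal K"
proof -
  obtain K where K: "K > 0" "\<And>u F. finite F \<Longrightarrow> F \<subseteq> I \<Longrightarrow> (\<Sum>j\<in>F. (1 + norm (j - u)) powr -s) \<le> K"
    using relatively_separated_sum[OF assms] by blast
  have "(\<integral>\<^sup>+j. ennreal ((1 + norm (j - u)) powr -s) \<partial>count_space I) \<le> ennreal K" for u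
    by (rule nn_integral_count_space_le) (simp add: K ennreal_leI sum_ennreal)
  thus ?thesis using K(1) by (auto simp: norm_minus_commute)
qed

text \<open>A summable function without zeros lives on a countable set. Countability is what permits
  exchanging sums over \<open>I\<close>.\<close>

lemma countable_relatively_separated:
  fixes I :: "(real ^ 'd) set"
  assumes "relatively_separated I"
  shows "countable I"
proof -
  obtain K where K: "K > 0" "\<And>u F. finite F \<Longrightarrow> F \<subseteq> I \<Longrightarrow> (\<Sum>j\<in>F. (1 + norm (j - u)) powr -(real CARD('d) + 1)) \<le> K"
    using relatively_separated_sum[OF assms, of "real CARD('d) + 1"] by auto
  have "(\<lambda>j. (1 + norm (j - 0)) powr -(real CARD('d) + 1)) summable_on I"
    by (rule nonneg_bdd_above_summable_on) (simp, intro bdd_aboveI2[where M=K] K, auto)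
  hence "countable {j\<in>I. (1 + norm (j - 0)) powr -(real CARD('d) + 1) \<noteq> 0}"
    by (rule summable_countable_real)
  moreover have "1 + norm j \<noteq> 0" for j :: "real ^ 'd" using norm_ge_zero[of j] by linarith
  ultimately show ?thesis by simp
qed

section \<open>Spectral radii by interpolation\<close>

text \<open>Brandenburg's trick. With \<open>L\<close> chosen optimally the hypothesis becomes
  \<open>z (2n) \<le> const * z n powr (1 + \<theta>)\<close> for \<open>z n = max 1 (y n / q ^ n)\<close> with some \<open>\<theta> < 1\<close>; so \<open>ln (z (2 ^ p))\<close>
  grows like \<open>(1 + \<theta>) ^ p\<close>, which is slower than the \<open>2 ^ p\<close> in the exponent of \<open>q\<close>.\<close>

lemma doubling_sequence_small:
  fixes y :: "nat \<Rightarrow> real"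
  assumes y0: "\<And>n. 0 \<le> y n" and q: "0 < q" "q < 1" and \<alpha>: "0 < \<alpha>" and \<gamma>: "0 < \<gamma>" and E: "0 < E"
    and y: "\<And>n L. 1 \<le> n \<Longrightarrow> 1 \<le> L \<Longrightarrow> y (2 * n) \<le> E * y n * (L powr \<alpha> * q ^ n + L powr -\<gamma> * y n)"
    and e: "0 < e"
  shows "\<exists>n\<ge>1. y n < e"
proof -
  define \<theta> where "\<theta> = \<alpha> / (\<alpha> + \<gamma>)"
  have \<theta>: "0 < \<theta>" "\<theta> < 1" "1 - \<gamma> / (\<alpha> + \<gamma>) = \<theta>"
    using \<alpha> \<gamma> by (auto simp: \<theta>_def field_simps)
  \<comment> \<open>The maximum with 1 makes the cut-off \<open>L\<close> chosen below admissible,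
    that is, at least 1.\<close>
  define z where "z p = max 1 (y (2 ^ p) / q ^ (2 ^ p))" for p
  define c where "c = ln (max 1 (2 * E))"
  have c0: "0 \<le> c" by (simp add: c_def)
  have z1: "1 \<le> z p" for p by (simp add: z_def)
  have yz: "y (2 ^ p) \<le> z p * q ^ (2 ^ p)" for p
    using q by (simp add: z_def max_mult_distrib_right le_max_iff_disj)
  have step: "ln (z (Suc p)) \<le> c + (1 + \<theta>) * ln (z p)" for p
  proof -
    let ?Q = "q ^ (2 ^ p)" and ?z = "z p"
    \<comment> \<open>This \<open>L\<close> balances the two terms: L^\<alpha> and z L^-\<gamma>
      both equal z^\<theta>.\<close>
    define L where "L = ?z powr (1 / (\<alpha> + \<gamma>))"
    have zp: "0 < ?z" using z1[of p] by linarith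
    have L1: "1 \<le> L" unfolding L_def using z1 \<alpha> \<gamma> by (intro ge_one_powr_ge_zero) auto
    have La: "L powr \<alpha> = ?z powr \<theta>" by (simp add: L_def powr_powr \<theta>_def)
    have Lg: "L powr -\<gamma> * y (2 ^ p) \<le> ?z powr \<theta> * ?Q"
    proof -
      have "L powr -\<gamma> * y (2 ^ p) \<le> L powr -\<gamma> * (?z * ?Q)" by (intro mult_left_mono yz) simp
      also have "L powr -\<gamma> * (?z * ?Q) = ?z powr (- (\<gamma> / (\<alpha> + \<gamma>))) * (?z * ?Q)" by (simp add: L_def powr_powr)
      also have "?z powr (- (\<gamma> / (\<alpha> + \<gamma>))) * (?z * ?Q) = ?z powr (- (\<gamma> / (\<alpha> + \<gamma>)) + 1) * ?Q"
        using zp by (subst powr_add) simp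
      also have "- (\<gamma> / (\<alpha> + \<gamma>)) + 1 = \<theta>" using \<theta>(3) by simp
      finally show ?thesis .
    qed
    have "y (2 ^ Suc p) \<le> E * y (2 ^ p) * (L powr \<alpha> * ?Q + L powr -\<gamma> * y (2 ^ p))"
      using y[of "2 ^ p" L] L1 by simp
    also have "\<dots> \<le> E * (?z * ?Q) * (?z powr \<theta> * ?Q + ?z powr \<theta> * ?Q)"
      using E y0 zp q by (intro mult_mono yz add_mono Lg) (auto simp: La)
    also have "\<dots> = 2 * E * ?z powr (1 + \<theta>) * q ^ (2 ^ Suc p)"
      using zp by (simp add: powr_add power_mult[of q "2 ^ p" 2, symmetric] mult.commute power2_eq_square[of "q ^ 2 ^ p", symmetric])
    finally have "y (2 ^ Suc p) / q ^ (2 ^ Suc p) \<le> 2 * E * ?z powr (1 + \<theta>)"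
      using q by (simp add: pos_divide_le_eq)
    also have "\<dots> \<le> max 1 (2 * E) * ?z powr (1 + \<theta>)" by (intro mult_right_mono) auto
    finally have "y (2 ^ Suc p) / q ^ (2 ^ Suc p) \<le> max 1 (2 * E) * ?z powr (1 + \<theta>)" .
    moreover have "1 \<le> max 1 (2 * E) * ?z powr (1 + \<theta>)"
      using z1 \<theta> by (intro mult_ge1_I ge_one_powr_ge_zero) auto
    ultimately have "z (Suc p) \<le> max 1 (2 * E) * ?z powr (1 + \<theta>)" unfolding z_def by simp
    hence "ln (z (Suc p)) \<le> ln (max 1 (2 * E) * ?z powr (1 + \<theta>))"
      using z1[of "Suc p"] by (intro ln_mono) auto
    also have "\<dots> = c + (1 + \<theta>) * ln ?z"
      using zp by (simp add: ln_mult c_def ln_powr)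
    finally show ?thesis .
  qed
  \<comment> \<open>The shift by c/\<theta> turns the affine recursion for ln z into a geometric one
    with ratio 1 + \<theta>.\<close>
  define A where "A = ln (z 0) + c / \<theta>"
  have bound: "ln (z p) + c / \<theta> \<le> (1 + \<theta>) ^ p * A" for p
  proof (induction p)
    case (Suc p)
    have "ln (z (Suc p)) + c / \<theta> \<le> (1 + \<theta>) * (ln (z p) + c / \<theta>)"
    proof -
      have "(1 + \<theta>) * (ln (z p) + c / \<theta>) = c + (1 + \<theta>) * ln (z p) + c / \<theta>"
        using \<theta>(1) by (simp add: field_simps)
      thus ?thesis using step[of p] by simp
    qed
    also have "\<dots> \<le> (1 + \<theta>) * ((1 + \<theta>) ^ p * A)" using Suc \<theta> by (intro mult_left_mono) auto
    finally show ?case by (simp add: mult.assoc)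
  qed (simp add: A_def)
  define lq where "lq = - ln q"
  have lq: "0 < lq" using q by (simp add: lq_def ln_less_zero)
  have "(\<lambda>p. A * ((1 + \<theta>) / 2) ^ p) \<longlonglongrightarrow> A * 0"
    using \<theta> by (intro tendsto_intros LIMSEQ_power_zero) auto
  hence "eventually (\<lambda>p. A * ((1 + \<theta>) / 2) ^ p < lq / 2) sequentially"
    by (rule order_tendstoD) (use lq in simp)
  moreover have "eventually (\<lambda>p. 2 ^ p > - ln e / (lq / 2)) sequentially"
  proof -
    obtain n where "- ln e / (lq / 2) < 2 ^ n" using real_arch_pow[of 2 "- ln e / (lq / 2)"] by auto
    hence "- ln e / (lq / 2) < 2 ^ p" if "p \<ge> n" for p
      using that power_increasing[of n p "2 :: real"] by linarith
    thus ?thesis unfolding eventually_sequentially by blast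
  qed
  \<comment> \<open>The growth (1 + \<theta>)^p A uses at most half of the exponent 2^p lq; the
    other half pushes the value below \<open>e\<close>.\<close>
  ultimately obtain p where p: "A * ((1 + \<theta>) / 2) ^ p < lq / 2" "2 ^ p > - ln e / (lq / 2)"
    using eventually_happens[OF eventually_conj] by fastforce
  have "ln (z p) - 2 ^ p * lq < ln e"
  proof -
    have "ln (z p) \<le> (1 + \<theta>) ^ p * A" using bound[of p] c0 \<theta>(1) by (smt (verit) divide_nonneg_pos)
    also have "\<dots> = 2 ^ p * (A * ((1 + \<theta>) / 2) ^ p)" by (simp add: power_divide)
    also have "\<dots> \<le> 2 ^ p * (lq / 2)" using p(1) by (intro mult_left_mono) auto
    finally have "ln (z p) - 2 ^ p * lq \<le> - (2 ^ p * (lq / 2))" by simp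
    moreover have "- ln e < 2 ^ p * (lq / 2)" using p(2) lq by (simp add: field_simps)
    ultimately show ?thesis by simp
  qed
  moreover have "z p * q ^ (2 ^ p) = exp (ln (z p) - 2 ^ p * lq)"
  proof -
    have "q ^ (2 ^ p) = exp (ln q) ^ (2 ^ p)" using q by simp
    also have "\<dots> = exp (real (2 ^ p) * ln q)" by (rule exp_of_nat_mult[symmetric])
    finally show ?thesis using z1[of p] by (simp add: lq_def exp_add)
  qed
  ultimately have "y (2 ^ p) < e" using yz[of p] e
    by (smt (verit) exp_less_cancel_iff exp_ln)
  thus ?thesis by (intro exI[of _ "2 ^ p"]) simp
qed

text \<open>Makes y n = N (R^n) satisfy the doubling inequality: \<open>P\<close> bounds N (R^(2n))
  with only one weighted factor, and \<open>Q\<close> bounds the unweighted quantity \<sigma> by a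
  cut-off at distance \<open>L\<close>, with b = q^n bounding every block of R^n through its
  operator norm.\<close>

lemma (in matrix_norm) spectral_interpolation:
  assumes D: "0 < D" and \<alpha>: "0 < \<alpha>" and \<gamma>: "0 < \<gamma>"
    and P: "\<And>m. N (\<lambda>i j. \<integral>\<^sup>+k. m i k * m k j \<partial>count_space I) \<le> ennreal D * N m * \<sigma> m"
    and Q: "\<And>m b L. 1 \<le> L \<Longrightarrow> 0 \<le> b \<Longrightarrow> (\<And>i j. i \<in> I \<Longrightarrow> j \<in> I \<Longrightarrow> m i j \<le> ennreal b) \<Longrightarrow>
      \<sigma> m \<le> ennreal D * (ennreal (L powr \<alpha> * b) + ennreal (L powr -\<gamma>) * N m)"
  shows "spectral \<pi>"
  unfolding spectral_def
proof (intro allI impI)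
  fix R and e :: ennreal
  assume R: "norm R < 1" "supp \<pi> I R" "N (bn \<pi> R) < \<infinity>" and e: "0 < e"
  \<comment> \<open>The value 1/2 keeps \<open>q\<close> positive even for R = 0, so that powers of
    \<open>q\<close> can be divided by.\<close>
  define q where "q = max (norm R) (1/2)"
  have q: "0 < q" "q < 1" "norm R \<le> q" using R(1) by (auto simp: q_def)
  have fin: "N (bn \<pi> (R ^ Suc n)) < \<infinity>" for n
  proof (induction n)
    case (Suc n)
    show ?case unfolding power_Suc[of R "Suc n"] by (rule bn_mult_finite[OF _ R(3) Suc]) (use R(2) in auto)
  qed (use R(3) in simp)
  have sup: "supp \<pi> I (R ^ Suc n)" for n
  proof (induction n)
    case (Suc n)
    show ?case unfolding power_Suc[of R "Suc n"] by (rule supp_mult[OF R(2) Suc])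
  qed (simp add: R)
  define y where "y n = enn2real (N (bn \<pi> (R ^ n)))" for n
  have yN: "N (bn \<pi> (R ^ n)) = ennreal (y n)" "supp \<pi> I (R ^ n)" if "1 \<le> n" for n
    using fin[of "n - 1"] sup[of "n - 1"] that by (simp_all add: y_def del: power_Suc)
  have y0: "0 \<le> y n" for n by (simp add: y_def)
  have key: "y (2 * n) \<le> (D * D) * y n * (L powr \<alpha> * q ^ n + L powr -\<gamma> * y n)" if n: "1 \<le> n" and L: "1 \<le> L" for n L
  proof -
    let ?m = "bn \<pi> (R ^ n)"
    have "ennreal (y (2 * n)) = N (bn \<pi> (R ^ n * R ^ n))"
      using yN[of "2 * n"] n by (simp add: mult_2 power_add)
    also have "\<dots> \<le> N (\<lambda>i j. \<integral>\<^sup>+k. ?m i k * ?m k j \<partial>count_space I)"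
      by (intro mono bn_mult_le) (use yN(2)[OF n] in auto)
    also have "\<dots> \<le> ennreal D * N ?m * \<sigma> ?m" by (rule P)
    also have "\<dots> \<le> ennreal D * N ?m * (ennreal D * (ennreal (L powr \<alpha> * q ^ n) + ennreal (L powr -\<gamma>) * N ?m))"
    proof (intro mult_left_mono Q L)
      fix i j
      have "norm (R ^ n) \<le> q ^ n"
        using norm_power_ineq[of R n] power_mono[OF q(3), of n] by simp
      thus "?m i j \<le> ennreal (q ^ n)" using bn_le_norm[of \<pi> "R ^ n" i j] by (meson ennreal_leI order_trans)
    qed (use q in auto)
    also have "\<dots> = ennreal ((D * D) * y n * (L powr \<alpha> * q ^ n + L powr -\<gamma> * y n))"
      using D y0 q unfolding yN(1)[OF n]
      by (simp add: ennreal_mult[symmetric] ennreal_plus[symmetric] mult_ac del: ennreal_plus)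
    finally show ?thesis
      using D y0 q by (subst (asm) ennreal_le_iff) (auto intro!: mult_nonneg_nonneg add_nonneg_nonneg)
  qed
  obtain e' where e': "0 < e'" "ennreal e' \<le> e"
  proof (cases e)
    case (real r)
    thus ?thesis using that[of r] e by auto
  next
    case top
    thus ?thesis using that[of 1] by simp
  qed
  obtain n where n: "1 \<le> n" "y n < e'"
    using doubling_sequence_small[OF y0 q(1,2) \<alpha> \<gamma> _ key e'(1)] D by auto
  have "N (bn \<pi> (R ^ n)) < e"
    unfolding yN(1)[OF n(1)] using n(2) e' y0 by (meson ennreal_lessI less_le_trans)
  thus "\<exists>n\<ge>1. N (bn \<pi> (R ^ n)) < e" using n(1) by blast
qed

section \<open>The Jaffard and Schur norms\<close>

definition pw :: "real \<Rightarrow> real ^ 'd \<Rightarrow> ennreal" where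
  "pw s x = ennreal (poly_weight s x)"

lemma pw_commute: "pw s (x - y) = pw s (y - x)"
  by (simp add: pw_def poly_weight_def norm_minus_commute)

lemma pw_zero: "pw s 0 = 1"
  by (simp add: pw_def poly_weight_def)

lemma pw_finite: "pw s x < top"
  by (simp add: pw_def)

lemma pw_ge_1: "0 \<le> s \<Longrightarrow> 1 \<le> pw s x"
  unfolding pw_def poly_weight_def
  by (metis add.commute add_increasing2 ennreal_1 ennreal_leI ge_one_powr_ge_zero le_add_same_cancel1 norm_ge_zero order_refl)

lemma pw_mult:
  assumes "0 \<le> s"
  shows "pw s (x + y) \<le> pw s x * pw s y"
proof -
  have "1 + norm (x + y) \<le> (1 + norm x) * (1 + norm y)"
  proof -
    have "norm (x + y) \<le> norm x + norm y" "0 \<le> norm x * norm y"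
      by (rule norm_triangle_ineq) simp
    thus ?thesis unfolding distrib_left distrib_right by linarith
  qed
  hence "(1 + norm (x + y)) powr s \<le> ((1 + norm x) * (1 + norm y)) powr s"
    using assms by (intro powr_mono2) auto
  thus ?thesis unfolding pw_def poly_weight_def
    by (simp add: powr_mult ennreal_leI flip: ennreal_mult)
qed

text \<open>The sum of two terms is at most twice the larger one. Unlike submultiplicativity, this
  puts the weight on one factor of a product at a time, which is the gain behind Brandenburg's
  trick.\<close>

lemma pw_add:
  assumes "0 \<le> s"
  shows "pw s (x + y) \<le> ennreal (2 powr s) * pw s x + ennreal (2 powr s) * pw s y"
proof -
  let ?M = "max (1 + norm x) (1 + norm y)"
  have "(1 + norm (x + y)) powr s \<le> (2 * ?M) powr s"
  proof (intro powr_mono2)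
    show "1 + norm (x + y) \<le> 2 * ?M" using norm_triangle_ineq[of x y] by (cases "norm x \<le> norm y") (simp_all add: max_def)
  qed (use assms in auto)
  also have "\<dots> = 2 powr s * ?M powr s" by (rule powr_mult)
  also have "?M powr s \<le> (1 + norm x) powr s + (1 + norm y) powr s" by (simp add: max_def)
  finally have "(1 + norm (x + y)) powr s \<le> 2 powr s * (1 + norm x) powr s + 2 powr s * (1 + norm y) powr s"
    by (simp add: distrib_left mult_left_mono)
  thus ?thesis unfolding pw_def poly_weight_def
    by (simp add: ennreal_leI flip: ennreal_mult ennreal_plus)
qed

lemma nn_integral_count_space_Fatou:
  fixes f :: "nat \<Rightarrow> 'a \<Rightarrow> ennreal"
  assumes lim: "\<And>x. x \<in> A \<Longrightarrow> (\<lambda>n. f n x) \<longlonglongrightarrow> g x"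
    and le: "\<And>n. (\<integral>\<^sup>+x. f n x \<partial>count_space A) \<le> b"
  shows "(\<integral>\<^sup>+x. g x \<partial>count_space A) \<le> b"
proof -
  have "(\<integral>\<^sup>+x. g x \<partial>count_space A) = (\<integral>\<^sup>+x. liminf (\<lambda>n. f n x) \<partial>count_space A)"
    by (intro nn_integral_cong) (metis lim lim_imp_Liminf sequentially_bot space_count_space)
  also have "\<dots> \<le> liminf (\<lambda>n. \<integral>\<^sup>+x. f n x \<partial>count_space A)"
    by (rule nn_integral_liminf) simp
  also have "\<dots> \<le> liminf (\<lambda>n. b)" by (intro Liminf_mono always_eventually allI le)
  finally show ?thesis by (simp add: Liminf_const)
qed

text \<open>The product of matrices over \<open>I\<close>, not a convolution of sequences.\<close>

definition conv :: "'a set \<Rightarrow> ('a \<Rightarrow> 'a \<Rightarrow> ennreal) \<Rightarrow> ('a \<Rightarrow> 'a \<Rightarrow> ennreal) \<Rightarrow> 'a \<Rightarrow> 'a \<Rightarrow> ennreal" where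
  "conv I m m' i j = (\<integral>\<^sup>+k. m i k * m' k j \<partial>count_space I)"

definition jN :: "('a::ab_group_add \<Rightarrow> ennreal) \<Rightarrow> 'a set \<Rightarrow> ('a \<Rightarrow> 'a \<Rightarrow> ennreal) \<Rightarrow> ennreal" where
  "jN w I m = (SUP (i, j) \<in> I \<times> I. m i j * w (i - j))"

definition rowN :: "('a::ab_group_add \<Rightarrow> ennreal) \<Rightarrow> 'a set \<Rightarrow> ('a \<Rightarrow> 'a \<Rightarrow> ennreal) \<Rightarrow> ennreal" where
  "rowN w I m = (SUP i\<in>I. \<integral>\<^sup>+j. m i j * w (i - j) \<partial>count_space I)"

text \<open>The column part is the row norm of the transpose, where the weight is taken at the
  negated difference; for even weights this is the usual column norm.\<close>

definition sN :: "('a::ab_group_add \<Rightarrow> ennreal) \<Rightarrow> 'a set \<Rightarrow> ('a \<Rightarrow> 'a \<Rightarrow> ennreal) \<Rightarrow> ennreal" where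
  "sN w I m = max (rowN w I m) (rowN w I (\<lambda>i j. m j i))"

lemma jN_le_iff: "jN w I m \<le> c \<longleftrightarrow> (\<forall>i\<in>I. \<forall>j\<in>I. m i j * w (i - j) \<le> c)"
  unfolding jN_def by (auto simp: SUP_le_iff)

lemma jN_upper: "i \<in> I \<Longrightarrow> j \<in> I \<Longrightarrow> m i j * w (i - j) \<le> jN w I m"
  using jN_le_iff[of w I m "jN w I m"] by blast

lemma rowN_le_iff: "rowN w I m \<le> c \<longleftrightarrow> (\<forall>i\<in>I. (\<integral>\<^sup>+j. m i j * w (i - j) \<partial>count_space I) \<le> c)"
  unfolding rowN_def by (auto simp: SUP_le_iff)

lemma rowN_upper: "i \<in> I \<Longrightarrow> (\<integral>\<^sup>+j. m i j * w (i - j) \<partial>count_space I) \<le> rowN w I m"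
  unfolding rowN_def by (rule SUP_upper)

lemma rowN_le_sN: "rowN w I m \<le> sN w I m" "rowN w I (\<lambda>i j. m j i) \<le> sN w I m"
  by (simp_all add: sN_def)

lemma rowN_mono:
  assumes "\<And>i j. i \<in> I \<Longrightarrow> j \<in> I \<Longrightarrow> m i j \<le> m' i j"
  shows "rowN w I m \<le> rowN w I m'"
  unfolding rowN_le_iff
proof
  fix i assume i: "i \<in> I"
  have "(\<integral>\<^sup>+j. m i j * w (i - j) \<partial>count_space I) \<le> (\<integral>\<^sup>+j. m' i j * w (i - j) \<partial>count_space I)"
    by (intro nn_integral_mono mult_right_mono assms i) auto
  also have "\<dots> \<le> rowN w I m'" by (rule rowN_upper[OF i])
  finally show "(\<integral>\<^sup>+j. m i j * w (i - j) \<partial>count_space I) \<le> rowN w I m'" .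
qed

lemma rowN_scale: "rowN w I (\<lambda>i j. c * m i j) = c * rowN w I m"
  by (simp add: rowN_def SUP_mult_left_ennreal mult.assoc nn_integral_cmult)

lemma rowN_scale_weight: "rowN (\<lambda>x. c * w x) I m = c * rowN w I m"
  by (simp add: rowN_def SUP_mult_left_ennreal mult.left_commute[of _ c] nn_integral_cmult)

lemma max_mult_left_ennreal: "max (c * a) (c * b) = (c::ennreal) * max a b"
  by (metis (no_types, opaque_lifting) max.absorb1 max.absorb2 linear mult_left_mono zero_le)

lemma sN_scale_weight: "sN (\<lambda>x. c * w x) I m = c * sN w I m"
  by (simp add: sN_def rowN_scale_weight max_mult_left_ennreal)

lemma rowN_add: "rowN w I (\<lambda>i j. m i j + m' i j) \<le> rowN w I m + rowN w I m'"
  unfolding rowN_le_iff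
proof
  fix i assume "i \<in> I"
  thus "(\<integral>\<^sup>+j. (m i j + m' i j) * w (i - j) \<partial>count_space I) \<le> rowN w I m + rowN w I m'"
    using rowN_upper[of i I m w] rowN_upper[of i I m' w]
    by (simp add: distrib_right nn_integral_add add_mono)
qed

lemma rowN_Fatou:
  assumes lim: "\<And>i j. i \<in> I \<Longrightarrow> j \<in> I \<Longrightarrow> (\<lambda>n. M n i j) \<longlonglongrightarrow> m i j"
    and fin: "\<And>x. w x < top" and le: "\<And>n::nat. rowN w I (M n) \<le> b"
  shows "rowN w I m \<le> b"
  unfolding rowN_le_iff
proof
  fix i assume i: "i \<in> I"
  show "(\<integral>\<^sup>+j. m i j * w (i - j) \<partial>count_space I) \<le> b"
  proof (rule nn_integral_count_space_Fatou[where f="\<lambda>n j. M n i j * w (i - j)"])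
    show "j \<in> I \<Longrightarrow> (\<lambda>n. M n i j * w (i - j)) \<longlonglongrightarrow> m i j * w (i - j)" for j
      using ennreal_tendsto_cmult[OF fin lim[OF i], of j "i - j"] by (simp add: mult.commute)
    show "(\<integral>\<^sup>+j. M n i j * w (i - j) \<partial>count_space I) \<le> b" for n
      using rowN_upper[OF i] le order_trans by blast
  qed
qed

text \<open>The sums are exchanged and the inner one is bounded by a row norm. The hypothesis with
  two products covers both uses: submultiplicativity, with one product 0, and \<open>pw_add\<close>,
  with the constant weight 1 on the complementary factors.\<close>

lemma rowN_conv:
  assumes I: "countable I"
    and w: "\<And>x y. w (x + y) \<le> u x * v y + u' x * v' y"
  shows "rowN w I (conv I m m') \<le> rowN u I m * rowN v I m' + rowN u' I m * rowN v' I m'"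
  unfolding rowN_le_iff
proof
  fix i assume i: "i \<in> I"
  have part: "(\<integral>\<^sup>+j. \<integral>\<^sup>+k. (m i k * u (i - k)) * (m' k j * v (k - j)) \<partial>count_space I \<partial>count_space I)
    \<le> rowN u I m * rowN v I m'" for u v :: "'a \<Rightarrow> ennreal"
  proof -
    have "(\<integral>\<^sup>+j. \<integral>\<^sup>+k. (m i k * u (i - k)) * (m' k j * v (k - j)) \<partial>count_space I \<partial>count_space I)
      = (\<integral>\<^sup>+k. \<integral>\<^sup>+j. (m i k * u (i - k)) * (m' k j * v (k - j)) \<partial>count_space I \<partial>count_space I)"
      using I by (rule nn_integral_count_space_nn_integral) simp
    also have "\<dots> = (\<integral>\<^sup>+k. (m i k * u (i - k)) * (\<integral>\<^sup>+j. m' k j * v (k - j) \<partial>count_space I) \<partial>count_space I)"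
      by (simp add: nn_integral_cmult)
    also have "\<dots> \<le> (\<integral>\<^sup>+k. (m i k * u (i - k)) * rowN v I m' \<partial>count_space I)"
      by (intro nn_integral_mono mult_left_mono rowN_upper) auto
    also have "\<dots> = (\<integral>\<^sup>+k. m i k * u (i - k) \<partial>count_space I) * rowN v I m'"
      by (simp add: nn_integral_multc)
    also have "\<dots> \<le> rowN u I m * rowN v I m'" by (intro mult_right_mono rowN_upper i) simp
    finally show ?thesis .
  qed
  have "(\<integral>\<^sup>+j. conv I m m' i j * w (i - j) \<partial>count_space I)
    = (\<integral>\<^sup>+j. \<integral>\<^sup>+k. m i k * m' k j * w (i - j) \<partial>count_space I \<partial>count_space I)"
    by (simp add: conv_def nn_integral_multc)
  also have "\<dots> \<le> (\<integral>\<^sup>+j. \<integral>\<^sup>+k. (m i k * u (i - k)) * (m' k j * v (k - j))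
      + (m i k * u' (i - k)) * (m' k j * v' (k - j)) \<partial>count_space I \<partial>count_space I)"
  proof (intro nn_integral_mono)
    fix j k
    have "m i k * m' k j * w (i - j) \<le> m i k * m' k j * (u (i - k) * v (k - j) + u' (i - k) * v' (k - j))"
      using w[of "i - k" "k - j"] by (intro mult_left_mono) auto
    thus "m i k * m' k j * w (i - j) \<le> (m i k * u (i - k)) * (m' k j * v (k - j))
      + (m i k * u' (i - k)) * (m' k j * v' (k - j))" by (simp add: distrib_left mult_ac)
  qed
  also have "\<dots> = (\<integral>\<^sup>+j. \<integral>\<^sup>+k. (m i k * u (i - k)) * (m' k j * v (k - j)) \<partial>count_space I \<partial>count_space I)
    + (\<integral>\<^sup>+j. \<integral>\<^sup>+k. (m i k * u' (i - k)) * (m' k j * v' (k - j)) \<partial>count_space I \<partial>count_space I)"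
    by (simp add: nn_integral_add)
  also have "\<dots> \<le> rowN u I m * rowN v I m' + rowN u' I m * rowN v' I m'"
    by (intro add_mono part)
  finally show "(\<integral>\<^sup>+j. conv I m m' i j * w (i - j) \<partial>count_space I)
    \<le> rowN u I m * rowN v I m' + rowN u' I m * rowN v' I m'" .
qed

lemma sN_conv:
  assumes I: "countable I"
    and w: "\<And>x y. w (x + y) \<le> u x * v y + u' x * v' y"
  shows "sN w I (conv I m m') \<le> sN u I m * sN v I m' + sN u' I m * sN v' I m'"
  unfolding sN_def[of w]
proof (rule max.boundedI)
  have "rowN w I (conv I m m') \<le> rowN u I m * rowN v I m' + rowN u' I m * rowN v' I m'"
    by (rule rowN_conv[OF I]) (rule w)
  also have "\<dots> \<le> sN u I m * sN v I m' + sN u' I m * sN v' I m'"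
    by (intro add_mono mult_mono rowN_le_sN) auto
  finally show "rowN w I (conv I m m') \<le> sN u I m * sN v I m' + sN u' I m * sN v' I m'" .
  have w': "w (x + y) \<le> v x * u y + v' x * u' y" for x y
    using w[of y x] by (simp add: add.commute mult.commute)
  have "(\<lambda>i j. conv I m m' j i) = conv I (\<lambda>i j. m' j i) (\<lambda>i j. m j i)"
    by (simp add: conv_def mult.commute fun_eq_iff)
  hence "rowN w I (\<lambda>i j. conv I m m' j i)
    \<le> rowN v I (\<lambda>i j. m' j i) * rowN u I (\<lambda>i j. m j i) + rowN v' I (\<lambda>i j. m' j i) * rowN u' I (\<lambda>i j. m j i)"
    using rowN_conv[OF I, of w v u v' u'] w' by simp
  also have "\<dots> \<le> sN v I m' * sN u I m + sN v' I m' * sN u' I m"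
    by (intro add_mono mult_mono rowN_le_sN) auto
  finally show "rowN w I (\<lambda>i j. conv I m m' j i) \<le> sN u I m * sN v I m' + sN u' I m * sN v' I m'"
    by (simp add: mult.commute)
qed

lemma sN_conv1:
  assumes "countable I" "\<And>x y. w (x + y) \<le> w x * w y"
  shows "sN w I (conv I m m') \<le> sN w I m * sN w I m'"
proof -
  have "sN w I (conv I m m') \<le> sN w I m * sN w I m' + sN (\<lambda>_. 0) I m * sN w I m'"
    by (rule sN_conv[OF assms(1)]) (simp add: assms(2))
  also have "sN (\<lambda>_. 0) I m = 0"
    using sN_scale_weight[of 0 w I m] by simp
  finally show ?thesis by simp
qed

section \<open>The Schur norm\<close>

lemma matrix_norm_schur:
  assumes I: "countable I" and \<delta>: "0 \<le> \<delta>"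
  shows "matrix_norm (sN (pw \<delta>) I) I 1"
proof
  let ?w = "pw \<delta> :: real ^ 'a \<Rightarrow> ennreal"
  show "(0::real) < 1" by simp
  fix m m' :: "real ^ 'a \<Rightarrow> real ^ 'a \<Rightarrow> ennreal" and M :: "nat \<Rightarrow> real ^ 'a \<Rightarrow> real ^ 'a \<Rightarrow> ennreal" and b c
  show "(\<And>i j. i \<in> I \<Longrightarrow> j \<in> I \<Longrightarrow> m i j \<le> m' i j) \<Longrightarrow> sN ?w I m \<le> sN ?w I m'"
    unfolding sN_def by (intro max.mono rowN_mono) auto
  show "sN ?w I (\<lambda>i j. ennreal c * m i j) = ennreal c * sN ?w I m"
    unfolding sN_def rowN_scale by (rule max_mult_left_ennreal)
  show "sN ?w I (\<lambda>i j. m i j + m' i j) \<le> sN ?w I m + sN ?w I m'"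
    unfolding sN_def[of _ _ "\<lambda>i j. m i j + m' i j"]
    by (intro max.boundedI order_trans[OF rowN_add] add_mono rowN_le_sN)
  show "sN ?w I m \<le> b" if "\<And>i j. i \<in> I \<Longrightarrow> j \<in> I \<Longrightarrow> (\<lambda>n. M n i j) \<longlonglongrightarrow> m i j" "\<And>n. sN ?w I (M n) \<le> b"
  proof -
    have r: "rowN ?w I (M n) \<le> b" "rowN ?w I (\<lambda>i j. M n j i) \<le> b" for n
      using that(2)[of n] by (auto simp: sN_def)
    have "rowN ?w I m \<le> b"
      by (rule rowN_Fatou[where M=M, OF that(1) pw_finite r(1)])
    moreover have "rowN ?w I (\<lambda>i j. m j i) \<le> b"
      by (rule rowN_Fatou[where M="\<lambda>n i j. M n j i", OF that(1) pw_finite r(2)])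
    ultimately show ?thesis unfolding sN_def by simp
  qed
  have w1: "m i j \<le> m i j * ?w x" for m :: "real ^ 'a \<Rightarrow> real ^ 'a \<Rightarrow> ennreal" and i j x
    using mult_left_mono[OF pw_ge_1[OF \<delta>], of "m i j" x] by simp
  have row: "(\<integral>\<^sup>+j. m i j \<partial>count_space I) \<le> rowN ?w I m" if "i \<in> I" for i m
    by (rule order_trans[OF nn_integral_mono rowN_upper[OF that]]) (rule w1)
  have "(\<integral>\<^sup>+j. m i j \<partial>count_space I) \<le> ennreal 1 * sN ?w I m" "(\<integral>\<^sup>+i. m i j \<partial>count_space I) \<le> ennreal 1 * sN ?w I m"
    if "i \<in> I" "j \<in> I" for i j m
    using row[OF that(1), of m] row[OF that(2), of "\<lambda>i j. m j i"] by (auto simp: sN_def le_max_iff_disj)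
  thus "\<exists>K>0. \<forall>m. (\<forall>i\<in>I. (\<integral>\<^sup>+j. m i j \<partial>count_space I) \<le> ennreal K * sN ?w I m)
        \<and> (\<forall>j\<in>I. (\<integral>\<^sup>+i. m i j \<partial>count_space I) \<le> ennreal K * sN ?w I m)"
    by (intro exI[of _ 1]) (auto simp del: ennreal_1)
  show "sN ?w I (\<lambda>i j. \<integral>\<^sup>+k. m i k * m' k j \<partial>count_space I) \<le> ennreal 1 * sN ?w I m * sN ?w I m'"
    using sN_conv1[OF I pw_mult[OF \<delta>], of m m'] by (simp add: conv_def[abs_def])
  show "sN ?w I (\<lambda>i j. m j i) = sN ?w I m"
    by (simp add: sN_def max.commute)
  have "rowN ?w I (\<lambda>i j. of_bool (i = j)) \<le> 1"
    unfolding rowN_le_iff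
  proof
    fix i assume "i \<in> I"
    have "(\<integral>\<^sup>+j. of_bool (i = j) * ?w (i - j) \<partial>count_space I) \<le> (\<integral>\<^sup>+j. indicator {i} j \<partial>count_space I)"
      by (intro nn_integral_mono) (auto simp: pw_zero indicator_def)
    also have "\<dots> \<le> 1" using \<open>i \<in> I\<close> by simp
    finally show "(\<integral>\<^sup>+j. of_bool (i = j) * ?w (i - j) \<partial>count_space I) \<le> 1" .
  qed
  hence "sN ?w I (\<lambda>i j. of_bool (i = j)) \<le> 1" unfolding sN_def by (simp add: eq_commute[of _ "_::real^'a"])
  thus "sN ?w I (\<lambda>i j. of_bool (i = j)) < \<infinity>" by (simp add: order_le_less_trans)
qed

text \<open>Within distance 1 + |i - j| \<le> L an entry is at most b \<le> b L^s (1 + |i - j|)^-s,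
  which is summable; beyond L the weight gives m \<le> L^-\<delta> m w. This is the interpolation
  with exponents s and \<delta>.\<close>

lemma schur_spectral:
  fixes I :: "(real ^ 'd) set"
  assumes I: "relatively_separated I" and \<delta>: "0 < \<delta>"
  shows "matrix_norm.spectral (sN (pw \<delta>) I) I \<pi>"
proof -
  note c = countable_relatively_separated[OF I]
  interpret matrix_norm "sN (pw \<delta>) I" I 1 by (rule matrix_norm_schur) (use c \<delta> in auto)
  \<comment> \<open>Any exponent above the dimension serves; it is used for summability over
    \<open>I\<close>.\<close>
  define s where "s = real CARD('d) + 1"
  have s: "real CARD('d) < s" "0 < s" by (auto simp: s_def)
  obtain K where K: "K > 0" "\<And>u. (\<integral>\<^sup>+j. ennreal ((1 + norm (u - j)) powr -s) \<partial>count_space I) \<le> ennreal K"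
    using relatively_separated_nn_integral[OF I s(1)] by blast
  let ?D = "max (max K 1) (2 * 2 powr \<delta>)"
  let ?w = "pw \<delta> :: real ^ 'd \<Rightarrow> ennreal"
  show ?thesis
  proof (rule spectral_interpolation[where D="?D" and \<alpha>=s and \<gamma>=\<delta> and \<sigma>="sN (\<lambda>_. 1) I"])
    show "0 < ?D" using K(1) by simp
    show "0 < s" "0 < \<delta>" by fact+
    fix m :: "real ^ 'd \<Rightarrow> real ^ 'd \<Rightarrow> ennreal"
    have "sN ?w I (conv I m m) \<le> sN (\<lambda>x. ennreal (2 powr \<delta>) * ?w x) I m * sN (\<lambda>_. 1) I m
        + sN (\<lambda>_. 1) I m * sN (\<lambda>x. ennreal (2 powr \<delta>) * ?w x) I m"
      by (rule sN_conv[OF c]) (use pw_add[of \<delta>] \<delta> in simp)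
    also have "\<dots> = ennreal (2 * 2 powr \<delta>) * sN ?w I m * sN (\<lambda>_. 1) I m"
    proof -
      have "ennreal (2 * 2 powr \<delta>) = ennreal (2 powr \<delta>) + ennreal (2 powr \<delta>)" by (simp flip: ennreal_plus)
      thus ?thesis unfolding sN_scale_weight by (simp only: distrib_left distrib_right mult_ac)
    qed
    also have "\<dots> \<le> ennreal ?D * sN ?w I m * sN (\<lambda>_. 1) I m"
      by (intro mult_right_mono ennreal_leI) auto
    finally show "sN ?w I (\<lambda>i j. \<integral>\<^sup>+k. m i k * m k j \<partial>count_space I) \<le> ennreal ?D * sN ?w I m * sN (\<lambda>_. 1) I m"
      unfolding conv_def[abs_def] .
    fix b L :: real
    assume L: "1 \<le> L" and b: "0 \<le> b" and mb: "\<And>i j. i \<in> I \<Longrightarrow> j \<in> I \<Longrightarrow> m i j \<le> ennreal b"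
    have row: "rowN (\<lambda>_. 1) I m \<le> ennreal ?D * (ennreal (L powr s * b) + ennreal (L powr -\<delta>) * rowN ?w I m)"
      if mb: "\<And>i j. i \<in> I \<Longrightarrow> j \<in> I \<Longrightarrow> m i j \<le> ennreal b" for m
      unfolding rowN_le_iff
    proof
      fix i assume i: "i \<in> I"
      have pt: "m i j * 1 \<le> ennreal (L powr s * b) * ennreal ((1 + norm (i - j)) powr -s)
          + ennreal (L powr -\<delta>) * (m i j * ?w (i - j))" if "j \<in> I" for j
      proof (cases "1 + norm (i - j) \<le> L")
        case True
        have "m i j \<le> ennreal b" by (rule mb[OF i that])
        also have "b \<le> L powr s * b * (1 + norm (i - j)) powr -s"
        proof -
          have "1 = (1 + norm (i - j)) powr s * (1 + norm (i - j)) powr -s"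
            using norm_ge_zero[of "i - j"] by (simp add: add_pos_nonneg powr_add[symmetric] del: norm_ge_zero) 
          also have "\<dots> \<le> L powr s * (1 + norm (i - j)) powr -s"
            using True s by (intro mult_right_mono powr_mono2) auto
          finally show ?thesis using mult_left_mono[OF _ b] by (fastforce simp: mult_ac)
        qed
        finally have "m i j \<le> ennreal (L powr s * b) * ennreal ((1 + norm (i - j)) powr -s)"
          using b by (simp add: ennreal_leI flip: ennreal_mult)
        thus ?thesis by (simp add: add_increasing2)
      next
        case False
        have "1 = L powr -\<delta> * L powr \<delta>" using L by (simp add: powr_add[symmetric])
        also have "\<dots> \<le> L powr -\<delta> * (1 + norm (i - j)) powr \<delta>"
          using False L \<delta> by (intro mult_left_mono powr_mono2) auto
        finally have "1 \<le> ennreal (L powr -\<delta>) * ?w (i - j)"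
          unfolding pw_def poly_weight_def using ennreal_leI by (fastforce simp flip: ennreal_mult)
        hence "m i j * 1 \<le> m i j * (ennreal (L powr -\<delta>) * ?w (i - j))" by (rule mult_left_mono) simp
        thus ?thesis by (simp add: add_increasing mult_ac)
      qed
      have "(\<integral>\<^sup>+j. m i j * 1 \<partial>count_space I)
        \<le> (\<integral>\<^sup>+j. ennreal (L powr s * b) * ennreal ((1 + norm (i - j)) powr -s)
          + ennreal (L powr -\<delta>) * (m i j * ?w (i - j)) \<partial>count_space I)"
        by (intro nn_integral_mono) (use pt in simp)
      also have "\<dots> = ennreal (L powr s * b) * (\<integral>\<^sup>+j. ennreal ((1 + norm (i - j)) powr -s) \<partial>count_space I)
          + ennreal (L powr -\<delta>) * (\<integral>\<^sup>+j. m i j * ?w (i - j) \<partial>count_space I)"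
        by (simp add: nn_integral_add nn_integral_cmult)
      also have "\<dots> \<le> ennreal (L powr s * b) * ennreal ?D + ennreal (L powr -\<delta>) * (ennreal ?D * rowN ?w I m)"
      proof (intro add_mono mult_left_mono)
        show "(\<integral>\<^sup>+j. ennreal ((1 + norm (i - j)) powr -s) \<partial>count_space I) \<le> ennreal ?D"
          by (rule order_trans[OF K(2)]) (simp add: ennreal_leI)
        have "(\<integral>\<^sup>+j. m i j * ?w (i - j) \<partial>count_space I) \<le> ennreal 1 * rowN ?w I m"
          using rowN_upper[OF i] by simp
        also have "\<dots> \<le> ennreal ?D * rowN ?w I m" by (intro mult_right_mono ennreal_leI) auto
        finally show "(\<integral>\<^sup>+j. m i j * ?w (i - j) \<partial>count_space I) \<le> ennreal ?D * rowN ?w I m" .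
      qed auto
      also have "\<dots> = ennreal ?D * (ennreal (L powr s * b) + ennreal (L powr -\<delta>) * rowN ?w I m)"
        by (simp only: distrib_left mult_ac)
      finally show "(\<integral>\<^sup>+j. m i j * 1 \<partial>count_space I) \<le> ennreal ?D * (ennreal (L powr s * b) + ennreal (L powr -\<delta>) * rowN ?w I m)" .
    qed
    show "sN (\<lambda>_. 1) I m \<le> ennreal ?D * (ennreal (L powr s * b) + ennreal (L powr -\<delta>) * sN ?w I m)"
      unfolding sN_def[of "\<lambda>_. 1"]
      by (intro max.boundedI order_trans[OF row] mult_left_mono add_left_mono rowN_le_sN mb) auto
  qed
qed

section \<open>The Jaffard norm\<close>

lemma jN_row:
  assumes I: "i \<in> I" and s: "0 \<le> s"
    and K: "\<And>u. (\<integral>\<^sup>+j. ennreal ((1 + norm (u - j)) powr -s) \<partial>count_space I) \<le> ennreal K"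
  shows "rowN (\<lambda>_. 1) I m \<le> ennreal K * jN (pw s) I m"
  unfolding rowN_le_iff
proof
  fix i assume i: "i \<in> I"
  have "(\<integral>\<^sup>+j. m i j * 1 \<partial>count_space I) \<le> (\<integral>\<^sup>+j. jN (pw s) I m * ennreal ((1 + norm (i - j)) powr -s) \<partial>count_space I)"
  proof (intro nn_integral_mono)
    fix j assume "j \<in> space (count_space I)"
    hence j: "j \<in> I" by simp
    have "pw s (i - j) * ennreal ((1 + norm (i - j)) powr -s) = 1"
      unfolding pw_def poly_weight_def
      by (simp add: powr_add[symmetric] add_nonneg_eq_0_iff flip: ennreal_mult)
    hence "m i j * 1 = (m i j * pw s (i - j)) * ennreal ((1 + norm (i - j)) powr -s)"
      by (simp add: mult.assoc)
    also have "\<dots> \<le> jN (pw s) I m * ennreal ((1 + norm (i - j)) powr -s)"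
      by (intro mult_right_mono jN_upper i j) simp
    finally show "m i j * 1 \<le> jN (pw s) I m * ennreal ((1 + norm (i - j)) powr -s)" .
  qed
  also have "\<dots> = jN (pw s) I m * (\<integral>\<^sup>+j. ennreal ((1 + norm (i - j)) powr -s) \<partial>count_space I)"
    by (simp add: nn_integral_cmult)
  also have "\<dots> \<le> jN (pw s) I m * ennreal K" by (intro mult_left_mono K) simp
  finally show "(\<integral>\<^sup>+j. m i j * 1 \<partial>count_space I) \<le> ennreal K * jN (pw s) I m" by (simp add: mult.commute)
qed

lemma jN_transpose: "jN (pw s) I (\<lambda>i j. m j i) = jN (pw s) I m"
  by (rule antisym; unfold jN_le_iff; intro ballI; subst pw_commute; rule jN_upper; assumption)

text \<open>An entry is at most the Jaffard norm times (1 + |i - j|)^-s, and \<open>K\<close> bounds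
  the sums of these majorants over rows and over columns.\<close>

lemma jN_sN:
  assumes s: "0 \<le> s"
    and K: "\<And>u. (\<integral>\<^sup>+j. ennreal ((1 + norm (u - j)) powr -s) \<partial>count_space I) \<le> ennreal K"
  shows "sN (\<lambda>_. 1) I m \<le> ennreal K * jN (pw s) I m"
proof (cases "I = {}")
  case True
  thus ?thesis by (simp add: sN_def rowN_def bot_ennreal)
next
  case False
  then obtain i where "i \<in> I" by blast
  from jN_row[OF this s K, of m] jN_row[OF this s K, of "\<lambda>i j. m j i"]
  show ?thesis unfolding sN_def jN_transpose[of s I m] by (rule max.boundedI)
qed

text \<open>\<open>pw_add\<close> places the weight on one factor, where the Jaffard norm takes it
  out of the sum; the other factor is summed without weight at the cost of its Schur norm.\<close>

lemma jN_conv: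
  assumes s: "0 \<le> s"
  shows "jN (pw s) I (conv I m m')
    \<le> ennreal (2 powr s) * (jN (pw s) I m * sN (\<lambda>_. 1) I m' + sN (\<lambda>_. 1) I m * jN (pw s) I m')"
  unfolding jN_le_iff
proof (intro ballI)
  let ?w = "pw s :: real ^ 'a \<Rightarrow> ennreal" and ?c = "ennreal (2 powr s)"
  fix i j assume ij: "i \<in> I" "j \<in> I"
  have "conv I m m' i j * ?w (i - j) = (\<integral>\<^sup>+k. m i k * m' k j * ?w (i - j) \<partial>count_space I)"
    by (simp add: conv_def nn_integral_multc)
  also have "\<dots> \<le> (\<integral>\<^sup>+k. ?c * (jN ?w I m * (m' k j * 1)) + ?c * (jN ?w I m' * (m i k * 1)) \<partial>count_space I)"
  proof (intro nn_integral_mono)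
    fix k assume "k \<in> space (count_space I)"
    hence k: "k \<in> I" by simp
    have "m i k * m' k j * ?w (i - j) \<le> m i k * m' k j * (?c * ?w (i - k) + ?c * ?w (k - j))"
      using pw_add[OF s, of "i - k" "k - j"] by (intro mult_left_mono) auto
    also have "\<dots> = ?c * ((m i k * ?w (i - k)) * (m' k j * 1)) + ?c * ((m' k j * ?w (k - j)) * (m i k * 1))"
      by (simp add: distrib_left mult_ac)
    also have "\<dots> \<le> ?c * (jN ?w I m * (m' k j * 1)) + ?c * (jN ?w I m' * (m i k * 1))"
      by (intro add_mono mult_left_mono mult_right_mono jN_upper ij k) auto
    finally show "m i k * m' k j * ?w (i - j) \<le> ?c * (jN ?w I m * (m' k j * 1)) + ?c * (jN ?w I m' * (m i k * 1))" .
  qed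
  also have "\<dots> = ?c * (jN ?w I m * (\<integral>\<^sup>+k. m' k j * 1 \<partial>count_space I)) + ?c * (jN ?w I m' * (\<integral>\<^sup>+k. m i k * 1 \<partial>count_space I))"
    by (simp add: nn_integral_add nn_integral_cmult)
  also have "\<dots> \<le> ?c * (jN ?w I m * sN (\<lambda>_. 1) I m') + ?c * (jN ?w I m' * sN (\<lambda>_. 1) I m)"
  proof (intro add_mono mult_left_mono)
    show "(\<integral>\<^sup>+k. m' k j * 1 \<partial>count_space I) \<le> sN (\<lambda>_. 1) I m'"
      using rowN_upper[OF ij(2), of "\<lambda>i j. m' j i" "\<lambda>_. 1"] rowN_le_sN(2) order_trans by blast
    show "(\<integral>\<^sup>+k. m i k * 1 \<partial>count_space I) \<le> sN (\<lambda>_. 1) I m"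
      using rowN_upper[OF ij(1), of m "\<lambda>_. 1"] rowN_le_sN(1) order_trans by blast
  qed auto
  also have "\<dots> = ?c * (jN ?w I m * sN (\<lambda>_. 1) I m' + sN (\<lambda>_. 1) I m * jN ?w I m')"
    by (simp add: distrib_left mult_ac)
  finally show "conv I m m' i j * ?w (i - j) \<le> ?c * (jN ?w I m * sN (\<lambda>_. 1) I m' + sN (\<lambda>_. 1) I m * jN ?w I m')" .
qed

lemma matrix_norm_jaffard:
  fixes I :: "(real ^ 'd) set"
  assumes I: "relatively_separated I" and s: "real CARD('d) < s"
  shows "\<exists>C>0. matrix_norm (jN (pw s) I) I C"
proof -
  have s0: "0 \<le> s" using s by linarith
  obtain K where K: "K > 0" "\<And>u. (\<integral>\<^sup>+j. ennreal ((1 + norm (u - j)) powr -s) \<partial>count_space I) \<le> ennreal K"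
    using relatively_separated_nn_integral[OF I s] by blast
  let ?w = "pw s :: real ^ 'd \<Rightarrow> ennreal"
  \<comment> \<open>\<open>2 powr s\<close> comes from \<open>pw_add\<close>; 2 K counts the two
    terms of \<open>jN_conv\<close>, in each of which an unweighted Schur norm is at most K times
    the Jaffard norm.\<close>
  let ?C = "2 powr s * (2 * K)"
  have "matrix_norm (jN ?w I) I ?C"
  proof
    show "0 < ?C" using K by simp
    fix m m' :: "real ^ 'd \<Rightarrow> real ^ 'd \<Rightarrow> ennreal" and M :: "nat \<Rightarrow> real ^ 'd \<Rightarrow> real ^ 'd \<Rightarrow> ennreal" and b c
    show "jN ?w I m \<le> jN ?w I m'" if "\<And>i j. i \<in> I \<Longrightarrow> j \<in> I \<Longrightarrow> m i j \<le> m' i j"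
      unfolding jN_le_iff
    proof (intro ballI)
      fix i j assume ij: "i \<in> I" "j \<in> I"
      have "m i j * ?w (i - j) \<le> m' i j * ?w (i - j)" by (intro mult_right_mono that ij) simp
      also have "\<dots> \<le> jN ?w I m'" by (rule jN_upper[OF ij])
      finally show "m i j * ?w (i - j) \<le> jN ?w I m'" .
    qed
    show "jN ?w I (\<lambda>i j. ennreal c * m i j) = ennreal c * jN ?w I m"
      by (simp add: jN_def SUP_mult_left_ennreal mult.assoc case_prod_unfold)
    show "jN ?w I (\<lambda>i j. m i j + m' i j) \<le> jN ?w I m + jN ?w I m'"
      unfolding jN_le_iff distrib_right by (intro ballI add_mono jN_upper)
    show "jN ?w I m \<le> b" if lim: "\<And>i j. i \<in> I \<Longrightarrow> j \<in> I \<Longrightarrow> (\<lambda>n. M n i j) \<longlonglongrightarrow> m i j"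
      and le: "\<And>n. jN ?w I (M n) \<le> b"
      unfolding jN_le_iff
    proof (intro ballI)
      fix i j assume ij: "i \<in> I" "j \<in> I"
      have "(\<lambda>n. M n i j * ?w (i - j)) \<longlonglongrightarrow> m i j * ?w (i - j)"
        using ennreal_tendsto_cmult[OF pw_finite lim[OF ij], of s "i - j"] by (simp add: mult.commute)
      thus "m i j * ?w (i - j) \<le> b"
        by (rule LIMSEQ_le_const2) (use le jN_upper[OF ij] order_trans in blast)
    qed
    have row: "(\<integral>\<^sup>+j. m i j \<partial>count_space I) \<le> ennreal K * jN ?w I m" if "i \<in> I" for i m
      using rowN_upper[OF that, of m "\<lambda>_. 1"] rowN_le_sN(1)[of "\<lambda>_. 1" I m] jN_sN[OF s0 K(2), of m] by simp
    have "(\<integral>\<^sup>+i. m i j \<partial>count_space I) \<le> ennreal K * jN ?w I m" if "j \<in> I" for j m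
      using row[OF that, of "\<lambda>i j. m j i"] unfolding jN_transpose[of s I m] .
    with row show "\<exists>K>0. \<forall>m. (\<forall>i\<in>I. (\<integral>\<^sup>+j. m i j \<partial>count_space I) \<le> ennreal K * jN ?w I m)
        \<and> (\<forall>j\<in>I. (\<integral>\<^sup>+i. m i j \<partial>count_space I) \<le> ennreal K * jN ?w I m)"
      using K(1) by blast
    have "jN ?w I (conv I m m') \<le> ennreal (2 powr s) * (jN ?w I m * sN (\<lambda>_. 1) I m' + sN (\<lambda>_. 1) I m * jN ?w I m')"
      by (rule jN_conv[OF s0])
    also have "\<dots> \<le> ennreal (2 powr s) * (jN ?w I m * (ennreal K * jN ?w I m') + (ennreal K * jN ?w I m) * jN ?w I m')"
      by (intro mult_left_mono add_mono mult_right_mono jN_sN[OF s0 K(2)]) auto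
    also have "\<dots> = ennreal ?C * jN ?w I m * jN ?w I m'"
    proof -
      have "ennreal ?C = ennreal (2 powr s) * ennreal K + ennreal (2 powr s) * ennreal K"
        using K(1) by (simp flip: ennreal_plus ennreal_mult)
      thus ?thesis by (simp only: distrib_left distrib_right mult_ac)
    qed
    finally show "jN ?w I (\<lambda>i j. \<integral>\<^sup>+k. m i k * m' k j \<partial>count_space I) \<le> ennreal ?C * jN ?w I m * jN ?w I m'"
      unfolding conv_def[abs_def] .
    show "jN ?w I (\<lambda>i j. m j i) = jN ?w I m" by (rule jN_transpose)
    have "jN ?w I (\<lambda>i j. of_bool (i = j)) \<le> 1"
      unfolding jN_le_iff by (auto simp: pw_zero)
    thus "jN ?w I (\<lambda>i j. of_bool (i = j)) < \<infinity>" by (simp add: order_le_less_trans)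
  qed
  moreover have "0 < ?C" using K by simp
  ultimately show ?thesis by blast
qed

lemma jaffard_spectral:
  fixes I :: "(real ^ 'd) set"
  assumes I: "relatively_separated I" and s: "real CARD('d) < s"
  shows "matrix_norm.spectral (jN (pw s) I) I \<pi>"
proof -
  have s0: "0 \<le> s" using s by linarith
  obtain C where "matrix_norm (jN (pw s) I) I C" using matrix_norm_jaffard[OF I s] by blast
  then interpret matrix_norm "jN (pw s) I" I C .
  \<comment> \<open>An exponent strictly between the dimension and s: t keeps the majorant summable,
    and the surplus s - t is the power of \<open>L\<close> gained at distances beyond
    \<open>L\<close>.\<close>
  define t where "t = (real CARD('d) + s) / 2"
  have t: "real CARD('d) < t" "t < s" "0 < t" using s by (auto simp: t_def)
  obtain K where K: "K > 0" "\<And>u. (\<integral>\<^sup>+j. ennreal ((1 + norm (u - j)) powr -t) \<partial>count_space I) \<le> ennreal K"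
    using relatively_separated_nn_integral[OF I t(1)] by blast
  let ?D = "max K (2 * 2 powr s)"
  let ?w = "pw s :: real ^ 'd \<Rightarrow> ennreal"
  show ?thesis
  proof (rule spectral_interpolation[where D="?D" and \<alpha>=t and \<gamma>="s - t" and \<sigma>="sN (\<lambda>_. 1) I"])
    show "0 < ?D" using K(1) by simp
    show "0 < t" "0 < s - t" using t by auto
    fix m :: "real ^ 'd \<Rightarrow> real ^ 'd \<Rightarrow> ennreal"
    have "jN ?w I (conv I m m) \<le> ennreal (2 powr s) * (jN ?w I m * sN (\<lambda>_. 1) I m + sN (\<lambda>_. 1) I m * jN ?w I m)"
      by (rule jN_conv[OF s0])
    also have "\<dots> = ennreal (2 * 2 powr s) * jN ?w I m * sN (\<lambda>_. 1) I m"
    proof -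
      have "ennreal (2 * 2 powr s) = ennreal (2 powr s) + ennreal (2 powr s)" by (simp flip: ennreal_plus)
      thus ?thesis by (simp only: distrib_left distrib_right mult_ac)
    qed
    also have "\<dots> \<le> ennreal ?D * jN ?w I m * sN (\<lambda>_. 1) I m"
      by (intro mult_right_mono ennreal_leI) auto
    finally show "jN ?w I (\<lambda>i j. \<integral>\<^sup>+k. m i k * m k j \<partial>count_space I) \<le> ennreal ?D * jN ?w I m * sN (\<lambda>_. 1) I m"
      unfolding conv_def[abs_def] .
    fix b L :: real
    assume L: "1 \<le> L" and b: "0 \<le> b" and mb: "\<And>i j. i \<in> I \<Longrightarrow> j \<in> I \<Longrightarrow> m i j \<le> ennreal b"
    have row: "rowN (\<lambda>_. 1) I m \<le> ennreal ?D * (ennreal (L powr t * b) + ennreal (L powr - (s - t)) * jN ?w I m)"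
      if mb: "\<And>i j. i \<in> I \<Longrightarrow> j \<in> I \<Longrightarrow> m i j \<le> ennreal b" for m
      unfolding rowN_le_iff
    proof
      fix i assume i: "i \<in> I"
      let ?e = "ennreal (L powr t * b) + ennreal (L powr - (s - t)) * jN ?w I m"
      have pt: "m i j * 1 \<le> ?e * ennreal ((1 + norm (i - j)) powr -t)" if j: "j \<in> I" for j
      proof (cases "1 + norm (i - j) \<le> L")
        case True
        have "m i j \<le> ennreal b" by (rule mb[OF i j])
        also have "b \<le> L powr t * b * (1 + norm (i - j)) powr -t"
        proof -
          have "1 = (1 + norm (i - j)) powr t * (1 + norm (i - j)) powr -t"
            by (simp add: powr_add[symmetric] add_nonneg_eq_0_iff)
          also have "\<dots> \<le> L powr t * (1 + norm (i - j)) powr -t"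
            using True t by (intro mult_right_mono powr_mono2) auto
          finally show ?thesis using mult_left_mono[OF _ b] by (fastforce simp: mult_ac)
        qed
        finally have "m i j \<le> ennreal (L powr t * b) * ennreal ((1 + norm (i - j)) powr -t)"
          using b by (simp add: ennreal_leI flip: ennreal_mult)
        thus ?thesis by (simp add: add_increasing2 distrib_right)
      next
        case False
        let ?v = "1 + norm (i - j)"
        have v0: "0 < ?v" using norm_ge_zero[of "i - j"] by linarith
        have "1 = ?v powr s * (?v powr - (s - t) * ?v powr -t)"
          using v0 by (simp add: powr_add[symmetric])
        also have "\<dots> \<le> ?v powr s * (L powr - (s - t) * ?v powr -t)"
          using False L t by (intro mult_left_mono mult_right_mono powr_mono2') auto
        finally have "1 \<le> ?w (i - j) * (ennreal (L powr - (s - t)) * ennreal (?v powr -t))"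
          unfolding pw_def poly_weight_def using ennreal_leI by (fastforce simp flip: ennreal_mult)
        hence "m i j * 1 \<le> m i j * (?w (i - j) * (ennreal (L powr - (s - t)) * ennreal (?v powr -t)))"
          by (rule mult_left_mono) simp
        also have "\<dots> = (m i j * ?w (i - j)) * (ennreal (L powr - (s - t)) * ennreal (?v powr -t))"
          by (simp only: mult.assoc)
        also have "\<dots> \<le> jN ?w I m * (ennreal (L powr - (s - t)) * ennreal (?v powr -t))"
          by (intro mult_right_mono jN_upper i j) simp
        also have "\<dots> = (ennreal (L powr - (s - t)) * jN ?w I m) * ennreal (?v powr -t)"
          by (simp only: mult_ac)
        also have "\<dots> \<le> ?e * ennreal (?v powr -t)"
          by (intro mult_right_mono) auto
        finally show ?thesis .
      qed
      have "(\<integral>\<^sup>+j. m i j * 1 \<partial>count_space I) \<le> (\<integral>\<^sup>+j. ?e * ennreal ((1 + norm (i - j)) powr -t) \<partial>count_space I)"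
        by (intro nn_integral_mono) (use pt in simp)
      also have "\<dots> = ?e * (\<integral>\<^sup>+j. ennreal ((1 + norm (i - j)) powr -t) \<partial>count_space I)"
        by (simp add: nn_integral_cmult)
      also have "\<dots> \<le> ?e * ennreal ?D"
        by (intro mult_left_mono order_trans[OF K(2)] ennreal_leI) auto
      finally show "(\<integral>\<^sup>+j. m i j * 1 \<partial>count_space I) \<le> ennreal ?D * ?e" by (simp only: mult.commute)
    qed
    show "sN (\<lambda>_. 1) I m \<le> ennreal ?D * (ennreal (L powr t * b) + ennreal (L powr - (s - t)) * jN ?w I m)"
      unfolding sN_def
    proof (rule max.boundedI)
      show "rowN (\<lambda>_. 1) I (\<lambda>i j. m j i) \<le> ennreal ?D * (ennreal (L powr t * b) + ennreal (L powr - (s - t)) * jN ?w I m)"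
        using row[of "\<lambda>i j. m j i"] mb unfolding jN_transpose[of s I m] by blast
    qed (rule row[OF mb])
  qed
qed

lemma jaffard_norm_eq: "jaffard_norm s I M = jN (pw s) I (\<lambda>i j. ennreal (cmod (M i j)))"
  unfolding jaffard_norm_def jN_def pw_def by (simp add: ennreal_mult poly_weight_def)

lemma schur_norm_eq: "schur_norm \<delta> I M = sN (pw \<delta>) I (\<lambda>i j. ennreal (cmod (M i j)))"
  unfolding schur_norm_def sN_def rowN_def infsum_eq_nn_integral
  by (simp add: ennreal_mult poly_weight_def pw_def norm_minus_commute)

section \<open>The Sjostrand norm\<close>

lemma int_lattice_0: "0 \<in> int_lattice"
  and int_lattice_add: "x \<in> int_lattice \<Longrightarrow> y \<in> int_lattice \<Longrightarrow> x + y \<in> int_lattice"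
  and int_lattice_diff: "x \<in> int_lattice \<Longrightarrow> y \<in> int_lattice \<Longrightarrow> x - y \<in> int_lattice"
  and int_lattice_minus: "x \<in> int_lattice \<Longrightarrow> - x \<in> int_lattice"
  and int_lattice_scale: "x \<in> int_lattice \<Longrightarrow> real n *\<^sub>R x \<in> int_lattice"
  by (auto simp: int_lattice_def)

lemma inj_on_cell: "inj_on cell (int_lattice :: (real ^ 'd) set)"
proof (rule inj_onI)
  fix x y :: "real ^ 'd"
  assume "x \<in> int_lattice" "y \<in> int_lattice" "cell x = cell y"
  hence "x $ a = y $ a" for a
    unfolding int_lattice_def cell_def by (metis (no_types, lifting) Ints_cases floor_of_int mem_Collect_eq)
  thus "x = y" by (simp add: vec_eq_iff)
qed

text \<open>Lattice points are determined by their integer coordinates, each confined to an interval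
  of length 2 r. The bound does not depend on the centre \<open>u\<close>, which need not be a
  lattice point.\<close>

lemma int_lattice_ball:
  "\<exists>c. \<forall>u :: real ^ 'd. finite {x\<in>int_lattice. norm (u - x) \<le> r} \<and> card {x\<in>int_lattice. norm (u - x) \<le> r} \<le> c"
proof -
  let ?c = "nat \<lceil>2 * \<bar>r\<bar> + 2\<rceil> ^ CARD('d)"
  have "finite {x\<in>int_lattice. norm (u - x) \<le> r} \<and> card {x\<in>int_lattice. norm (u - x) \<le> r} \<le> ?c"
    for u :: "real ^ 'd"
  proof -
    let ?S = "{x\<in>int_lattice. norm (u - x) \<le> r}"
    let ?J = "\<lambda>a :: 'd. {\<lceil>u $ a - r\<rceil>..\<lfloor>u $ a + r\<rfloor>}"
    have "cell x a \<in> ?J a" if "x \<in> ?S" for x a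
    proof -
      have "\<bar>u $ a - x $ a\<bar> \<le> r"
        using that component_le_norm_cart[of "u - x" a] by simp
      moreover have "x $ a = of_int (cell x a)"
        using that unfolding int_lattice_def cell_def by (auto elim!: allE[of _ a] Ints_cases)
      ultimately show ?thesis by (simp add: ceiling_le_iff le_floor_iff abs_le_iff)
    qed
    hence sub: "cell ` ?S \<subseteq> PiE UNIV ?J" by (auto simp: PiE_UNIV_domain)
    have inj: "inj_on cell ?S" by (rule inj_on_subset[OF inj_on_cell]) auto
    have fin: "finite (PiE UNIV ?J)" by (intro finite_PiE) auto
    have "card ?S = card (cell ` ?S)" by (simp add: card_image[OF inj])
    also have "\<dots> \<le> card (PiE UNIV ?J)" by (rule card_mono[OF fin sub])
    also have "\<dots> = (\<Prod>a\<in>UNIV. card (?J a))" by (rule card_PiE) simp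
    also have "\<dots> \<le> (\<Prod>a\<in>(UNIV :: 'd set). nat \<lceil>2 * \<bar>r\<bar> + 2\<rceil>)"
    proof (intro prod_mono conjI)
      fix a
      have "\<lfloor>u $ a + r\<rfloor> + 1 - \<lceil>u $ a - r\<rceil> \<le> \<lceil>2 * \<bar>r\<bar> + 2\<rceil>" by linarith
      thus "card (?J a) \<le> nat \<lceil>2 * \<bar>r\<bar> + 2\<rceil>" by (simp add: nat_mono)
    qed simp
    finally have "card ?S \<le> ?c" by simp
    moreover have "finite ?S"
      by (rule finite_imageD[OF finite_subset[OF sub fin] inj])
    ultimately show ?thesis by blast
  qed
  thus ?thesis by blast
qed

lemma countable_int_lattice: "countable (int_lattice :: (real ^ 'd) set)"
proof -
  have "(int_lattice :: (real ^ 'd) set) = (\<Union>n :: nat. {x\<in>int_lattice. norm (0 - x) \<le> real n})"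
    using real_nat_ceiling_ge by auto
  also have "countable \<dots>"
  proof (rule countable_UN, simp, rule countable_finite)
    fix n :: nat
    show "finite {x \<in> int_lattice :: (real ^ 'd) set. norm (0 - x) \<le> real n}"
      using int_lattice_ball[of "real n", where 'd='d] by metis
  qed
  finally show ?thesis .
qed

lemma nn_integral_lattice_shift:
  fixes f :: "real ^ 'd \<Rightarrow> ennreal"
  assumes p: "p \<in> int_lattice"
  shows "(\<integral>\<^sup>+k. f (k - p) \<partial>count_space int_lattice) = (\<integral>\<^sup>+k. f k \<partial>count_space int_lattice)"
    and "(\<integral>\<^sup>+k. f (p - k) \<partial>count_space int_lattice) = (\<integral>\<^sup>+k. f k \<partial>count_space int_lattice)"
proof -
  have "bij_betw (\<lambda>k. k - p) int_lattice int_lattice"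
    by (rule bij_betw_byWitness[where f'="\<lambda>k. k + p"])
      (use p in \<open>auto intro: int_lattice_add int_lattice_diff\<close>)
  thus "(\<integral>\<^sup>+k. f (k - p) \<partial>count_space int_lattice) = (\<integral>\<^sup>+k. f k \<partial>count_space int_lattice)"
    by (rule nn_integral_bij_count_space)
  have "bij_betw (\<lambda>k. p - k) int_lattice int_lattice"
    by (rule bij_betw_byWitness[where f'="\<lambda>k. p - k"])
      (use p in \<open>auto intro: int_lattice_add int_lattice_diff\<close>)
  thus "(\<integral>\<^sup>+k. f (p - k) \<partial>count_space int_lattice) = (\<integral>\<^sup>+k. f k \<partial>count_space int_lattice)"
    by (rule nn_integral_bij_count_space)
qed

lemma nn_integral_lattice_uminus:
  fixes f :: "real ^ 'd \<Rightarrow> ennreal"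
  shows "(\<integral>\<^sup>+k. f (- k) \<partial>count_space int_lattice) = (\<integral>\<^sup>+k. f k \<partial>count_space int_lattice)"
  using nn_integral_lattice_shift(2)[OF int_lattice_0, of f] by simp

lemma nn_integral_lattice_ball:
  "\<exists>c. \<forall>u :: real ^ 'd. (\<integral>\<^sup>+x. of_bool (norm (u - x) \<le> r) \<partial>count_space int_lattice) \<le> ennreal c"
proof -
  obtain c where c: "\<And>u :: real ^ 'd. finite {x\<in>int_lattice. norm (u - x) \<le> r}"
    "\<And>u :: real ^ 'd. card {x\<in>int_lattice. norm (u - x) \<le> r} \<le> c" using int_lattice_ball by blast
  have "(\<integral>\<^sup>+x. of_bool (norm (u - x) \<le> r) \<partial>count_space int_lattice) \<le> ennreal (real c)" for u :: "real ^ 'd"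
  proof (rule nn_integral_count_space_le)
    fix F :: "(real ^ 'd) set" assume F: "finite F" "F \<subseteq> int_lattice"
    have "(\<Sum>x\<in>F. of_bool (norm (u - x) \<le> r) :: ennreal) = of_nat (card {x\<in>F. norm (u - x) \<le> r})"
      using F by (simp add: sum.If_cases of_bool_def Int_def)
    also have "\<dots> \<le> of_nat c"
      using F c[of u] by (intro of_nat_mono order_trans[OF card_mono c(2)]) auto
    finally show "(\<Sum>x\<in>F. of_bool (norm (u - x) \<le> r) :: ennreal) \<le> ennreal (real c)"
      by (simp add: ennreal_of_nat_eq_real_of_nat)
  qed
  thus ?thesis by blast
qed

text \<open>As a function of i - j this is the smallest translation-invariant majorant of
  \<open>m\<close> on the lattice. Thus \<open>cN\<close> is a weighted l1 norm of a sequence, and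
  matrix products are dominated by convolutions.\<close>

definition diagN :: "(real ^ 'd \<Rightarrow> real ^ 'd \<Rightarrow> ennreal) \<Rightarrow> real ^ 'd \<Rightarrow> ennreal" where
  "diagN m k = (SUP j\<in>int_lattice. m j (j - k))"

definition cN :: "(real ^ 'd \<Rightarrow> ennreal) \<Rightarrow> (real ^ 'd \<Rightarrow> real ^ 'd \<Rightarrow> ennreal) \<Rightarrow> ennreal" where
  "cN V m = (\<integral>\<^sup>+k. diagN m k * V k \<partial>count_space int_lattice)"

lemma diagN_upper: "i \<in> int_lattice \<Longrightarrow> j \<in> int_lattice \<Longrightarrow> m i j \<le> diagN m (i - j)"
  unfolding diagN_def by (rule SUP_upper2[of i]) auto

lemma diagN_least:
  assumes "\<And>i j. i \<in> int_lattice \<Longrightarrow> j \<in> int_lattice \<Longrightarrow> i - j = k \<Longrightarrow> m i j \<le> c" "k \<in> int_lattice"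
  shows "diagN m k \<le> c"
  unfolding diagN_def using assms by (intro SUP_least assms) (auto intro: int_lattice_diff)

lemma sjostrand_norm_eq:
  "sjostrand_norm \<nu> M = cN (\<lambda>x. ennreal (\<nu> x)) (\<lambda>i j. ennreal (cmod (M i j)))"
  if "\<And>x. 0 \<le> \<nu> x"
  unfolding sjostrand_norm_def cN_def diagN_def infsum_eq_nn_integral
  by (simp add: ennreal_mult that SUP_mult_right_ennreal)

lemma matrix_norm_sjostrand:
  fixes V :: "real ^ 'd \<Rightarrow> ennreal"
  assumes V1: "\<And>x. 1 \<le> V x" and Vfin: "\<And>x. V x < top" and Vsym: "\<And>x. V (- x) = V x"
    and Vmult: "\<And>x y. V (x + y) \<le> V x * V y"
  shows "matrix_norm (cN V) int_lattice 1"
proof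
  let ?Z = "int_lattice :: (real ^ 'd) set"
  show "(0::real) < 1" by simp
  fix m m' :: "real ^ 'd \<Rightarrow> real ^ 'd \<Rightarrow> ennreal" and M :: "nat \<Rightarrow> real ^ 'd \<Rightarrow> real ^ 'd \<Rightarrow> ennreal" and b c
  show "cN V m \<le> cN V m'" if "\<And>i j. i \<in> ?Z \<Longrightarrow> j \<in> ?Z \<Longrightarrow> m i j \<le> m' i j"
    unfolding cN_def
  proof (intro nn_integral_mono mult_right_mono)
    fix k assume "k \<in> space (count_space ?Z)"
    thus "diagN m k \<le> diagN m' k"
      by (intro diagN_least order_trans[OF that]) (auto intro: diagN_upper)
  qed simp
  show "cN V (\<lambda>i j. ennreal c * m i j) = ennreal c * cN V m"
    by (simp add: cN_def diagN_def nn_integral_cmult mult.assoc flip: SUP_mult_left_ennreal)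
  show "cN V (\<lambda>i j. m i j + m' i j) \<le> cN V m + cN V m'"
  proof -
    have "cN V (\<lambda>i j. m i j + m' i j) \<le> (\<integral>\<^sup>+k. (diagN m k + diagN m' k) * V k \<partial>count_space ?Z)"
      unfolding cN_def
      by (intro nn_integral_mono mult_right_mono diagN_least) (auto intro!: add_mono diagN_upper)
    also have "\<dots> = cN V m + cN V m'" by (simp add: cN_def distrib_right nn_integral_add)
    finally show ?thesis .
  qed
  show "cN V m \<le> b" if lim: "\<And>i j. i \<in> ?Z \<Longrightarrow> j \<in> ?Z \<Longrightarrow> (\<lambda>n. M n i j) \<longlonglongrightarrow> m i j"
    and le: "\<And>n. cN V (M n) \<le> b"
  proof -
    \<comment> \<open>A supremum of entrywise limits is at most the limit inferior of the suprema;
      Fatou for the outer sum does the rest.\<close>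
    have "cN V m \<le> (\<integral>\<^sup>+k. liminf (\<lambda>n. diagN (M n) k * V k) \<partial>count_space ?Z)"
      unfolding cN_def
    proof (intro nn_integral_mono)
      fix k assume "k \<in> space (count_space ?Z)"
      hence k: "k \<in> ?Z" by simp
      have "m j (j - k) * V k \<le> liminf (\<lambda>n. diagN (M n) k * V k)" if j: "j \<in> ?Z" for j
      proof -
        have "(\<lambda>n. M n j (j - k) * V k) \<longlonglongrightarrow> m j (j - k) * V k"
          using ennreal_tendsto_cmult[OF Vfin lim[OF j int_lattice_diff[OF j k]], of k] by (simp add: mult.commute)
        hence "m j (j - k) * V k = liminf (\<lambda>n. M n j (j - k) * V k)"
          by (metis lim_imp_Liminf sequentially_bot)
        also have "\<dots> \<le> liminf (\<lambda>n. diagN (M n) k * V k)"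
          using j by (intro Liminf_mono always_eventually allI mult_right_mono) (auto simp: diagN_def intro: SUP_upper)
        finally show ?thesis .
      qed
      thus "diagN m k * V k \<le> liminf (\<lambda>n. diagN (M n) k * V k)"
        unfolding diagN_def[of m] SUP_mult_right_ennreal by (rule SUP_least)
    qed
    also have "\<dots> \<le> liminf (\<lambda>n. \<integral>\<^sup>+k. diagN (M n) k * V k \<partial>count_space ?Z)"
      by (rule nn_integral_liminf) simp
    also have "\<dots> \<le> liminf (\<lambda>n :: nat. b)"
      using le unfolding cN_def by (intro Liminf_mono always_eventually allI)
    finally show ?thesis by (simp add: Liminf_const)
  qed
  have dV: "diagN m k \<le> diagN m k * V k" for m k
    using mult_left_mono[OF V1, of "diagN m k" k] by simp
  have tr: "cN V (\<lambda>i j. m j i) = cN V m" for m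
  proof -
    have "diagN (\<lambda>i j. m j i) k = diagN m (- k)" if k: "k \<in> ?Z" for k
    proof (rule antisym)
      show "diagN (\<lambda>i j. m j i) k \<le> diagN m (- k)"
      proof (rule diagN_least[OF _ k])
        fix i j assume ij: "i \<in> ?Z" "j \<in> ?Z" "i - j = k"
        have "- k = j - i" unfolding ij(3)[symmetric] by (rule minus_diff_eq)
        thus "m j i \<le> diagN m (- k)" using diagN_upper[OF ij(2,1), of m] by (simp only:)
      qed
      show "diagN m (- k) \<le> diagN (\<lambda>i j. m j i) k"
      proof (rule diagN_least[OF _ int_lattice_minus[OF k]])
        fix i j assume ij: "i \<in> ?Z" "j \<in> ?Z" "i - j = - k"
        have "k = - (i - j)" unfolding ij(3) by (rule minus_minus[symmetric])
        hence "k = j - i" unfolding minus_diff_eq .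
        thus "m i j \<le> diagN (\<lambda>i j. m j i) k"
          using diagN_upper[OF ij(2,1), of "\<lambda>i j. m j i"] by (simp only:)
      qed
    qed
    hence "cN V (\<lambda>i j. m j i) = (\<integral>\<^sup>+k. diagN m (- k) * V (- k) \<partial>count_space ?Z)"
      unfolding cN_def Vsym by (intro nn_integral_cong) simp
    also have "\<dots> = cN V m" unfolding cN_def by (rule nn_integral_lattice_uminus)
    finally show ?thesis .
  qed
  show "cN V (\<lambda>i j. m j i) = cN V m" by (rule tr)
  have row: "(\<integral>\<^sup>+j. m i j \<partial>count_space ?Z) \<le> ennreal 1 * cN V m" if i: "i \<in> ?Z" for i m
  proof -
    have "(\<integral>\<^sup>+j. m i j \<partial>count_space ?Z) \<le> (\<integral>\<^sup>+j. diagN m (i - j) * V (i - j) \<partial>count_space ?Z)"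
      by (intro nn_integral_mono order_trans[OF diagN_upper[OF i] dV]) simp
    also have "\<dots> = cN V m" unfolding cN_def by (rule nn_integral_lattice_shift(2)[OF i])
    finally show ?thesis by simp
  qed
  have "(\<integral>\<^sup>+i. m i j \<partial>count_space ?Z) \<le> ennreal 1 * cN V m" if "j \<in> ?Z" for j m
    using row[OF that, of "\<lambda>i j. m j i"] unfolding tr[of m] .
  thus "\<exists>K>0. \<forall>m. (\<forall>i\<in>?Z. (\<integral>\<^sup>+j. m i j \<partial>count_space ?Z) \<le> ennreal K * cN V m)
        \<and> (\<forall>j\<in>?Z. (\<integral>\<^sup>+i. m i j \<partial>count_space ?Z) \<le> ennreal K * cN V m)"
    using row by (intro exI[of _ 1]) (simp del: ennreal_1)
  show "cN V (\<lambda>i j. \<integral>\<^sup>+k. m i k * m' k j \<partial>count_space ?Z) \<le> ennreal 1 * cN V m * cN V m'"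
  proof -
    let ?A = "\<lambda>p. diagN m p * V p" and ?B = "\<lambda>p. diagN m' p * V p"
    \<comment> \<open>The side diagonals of a product are dominated by the convolution of those of
      the factors; after this step only sequences remain.\<close>
    have "diagN (\<lambda>i j. \<integral>\<^sup>+k. m i k * m' k j \<partial>count_space ?Z) k \<le> (\<integral>\<^sup>+p. diagN m p * diagN m' (k - p) \<partial>count_space ?Z)"
      if k: "k \<in> ?Z" for k
    proof (rule diagN_least[OF _ k])
      fix i j assume ij: "i \<in> ?Z" "j \<in> ?Z" "i - j = k"
      have "(\<integral>\<^sup>+l. m i l * m' l j \<partial>count_space ?Z) \<le> (\<integral>\<^sup>+l. diagN m (i - l) * diagN m' (k - (i - l)) \<partial>count_space ?Z)"
      proof (intro nn_integral_mono mult_mono)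
        fix l assume "l \<in> space (count_space ?Z)"
        hence l: "l \<in> ?Z" by simp
        show "m i l \<le> diagN m (i - l)" by (rule diagN_upper[OF ij(1) l])
        have e: "k - (i - l) = l - j" using ij(3) by (simp add: algebra_simps)
        show "m' l j \<le> diagN m' (k - (i - l))" unfolding e by (rule diagN_upper[OF l ij(2)])
      qed auto
      also have "\<dots> = (\<integral>\<^sup>+p. diagN m p * diagN m' (k - p) \<partial>count_space ?Z)"
        by (rule nn_integral_lattice_shift(2)[OF ij(1)])
      finally show "(\<integral>\<^sup>+l. m i l * m' l j \<partial>count_space ?Z) \<le> (\<integral>\<^sup>+p. diagN m p * diagN m' (k - p) \<partial>count_space ?Z)" .
    qed
    hence "cN V (\<lambda>i j. \<integral>\<^sup>+k. m i k * m' k j \<partial>count_space ?Z)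
      \<le> (\<integral>\<^sup>+k. (\<integral>\<^sup>+p. diagN m p * diagN m' (k - p) \<partial>count_space ?Z) * V k \<partial>count_space ?Z)"
      unfolding cN_def by (intro nn_integral_mono mult_right_mono) auto
    also have "\<dots> = (\<integral>\<^sup>+k. \<integral>\<^sup>+p. diagN m p * diagN m' (k - p) * V k \<partial>count_space ?Z \<partial>count_space ?Z)"
      by (simp add: nn_integral_multc)
    also have "\<dots> \<le> (\<integral>\<^sup>+k. \<integral>\<^sup>+p. ?A p * ?B (k - p) \<partial>count_space ?Z \<partial>count_space ?Z)"
    proof (intro nn_integral_mono)
      fix k p
      have "diagN m p * diagN m' (k - p) * V k \<le> diagN m p * diagN m' (k - p) * (V p * V (k - p))"
        using Vmult[of p "k - p"] by (intro mult_left_mono) auto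
      thus "diagN m p * diagN m' (k - p) * V k \<le> ?A p * ?B (k - p)" by (simp only: mult_ac)
    qed
    also have "\<dots> = (\<integral>\<^sup>+p. \<integral>\<^sup>+k. ?A p * ?B (k - p) \<partial>count_space ?Z \<partial>count_space ?Z)"
      by (rule nn_integral_count_space_nn_integral[OF countable_int_lattice]) simp
    also have "\<dots> = (\<integral>\<^sup>+p. ?A p * (\<integral>\<^sup>+k. ?B (k - p) \<partial>count_space ?Z) \<partial>count_space ?Z)"
      by (simp add: nn_integral_cmult)
    also have "\<dots> = (\<integral>\<^sup>+p. ?A p * cN V m' \<partial>count_space ?Z)"
    proof (intro nn_integral_cong)
      fix p assume "p \<in> space (count_space ?Z)"
      hence p: "p \<in> ?Z" by simp
      show "?A p * (\<integral>\<^sup>+k. ?B (k - p) \<partial>count_space ?Z) = ?A p * cN V m'"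
        unfolding cN_def nn_integral_lattice_shift(1)[OF p, of ?B] ..
    qed
    also have "\<dots> = cN V m * cN V m'" by (simp add: nn_integral_multc cN_def)
    finally show ?thesis by simp
  qed
  have "cN V (\<lambda>i j. of_bool (i = j)) \<le> (\<integral>\<^sup>+k. indicator {0} k * V 0 \<partial>count_space ?Z)"
    unfolding cN_def
  proof (intro nn_integral_mono)
    fix k assume "k \<in> space (count_space ?Z)"
    hence "diagN (\<lambda>i j. of_bool (i = j)) k \<le> indicator {0} k"
      by (intro diagN_least) (auto simp: indicator_def)
    from mult_right_mono[OF this, of "V k"]
    show "diagN (\<lambda>i j. of_bool (i = j)) k * V k \<le> indicator {0} k * V 0" by (auto simp: indicator_def)
  qed
  also have "\<dots> = emeasure (count_space ?Z) {0} * V 0"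
    using int_lattice_0 by (subst nn_integral_multc) (auto intro!: arg_cong2[where f="(*)"] nn_integral_indicator)
  also have "\<dots> = V 0" using int_lattice_0 by (subst emeasure_count_space_finite) auto
  finally show "cN V (\<lambda>i j. of_bool (i = j)) < \<infinity>" using Vfin[of 0] by (simp add: order_le_less_trans)
qed

lemma norm_Schur_test:
  assumes supp: "supp \<pi> I A" and K: "0 \<le> K"
    and row: "\<And>i. i \<in> I \<Longrightarrow> (\<integral>\<^sup>+j. bn \<pi> A i j \<partial>count_space I) \<le> ennreal K"
    and col: "\<And>j. j \<in> I \<Longrightarrow> (\<integral>\<^sup>+i. bn \<pi> A i j \<partial>count_space I) \<le> ennreal K"
  shows "norm A \<le> K"
proof (rule norm_le_mbd, rule mbd_Schur_test[where z="\<lambda>i j. norm (blk \<pi> A i j)" and \<pi>=\<pi>])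
  show "mbd (norm (blk \<pi> A i j)) (\<lambda>x y. if \<pi> x = i \<and> \<pi> y = j then ent A x y else 0)" for i j
    using mbd_norm[of "blk \<pi> A i j"] by (simp only: ent_blk[abs_def])
  have z: "blk \<pi> A i j = 0" if "\<not> (i \<in> I \<and> j \<in> I)" for i j
    using that supp by (intro bmat_eqI) (auto simp: ent_blk ent_simps suppD)
  show "(\<Sum>j\<in>P. norm (blk \<pi> A i j)) \<le> K" if "finite P" for i P
  proof (cases "i \<in> I")
    case True
    show ?thesis by (rule sum_le_of_nn_integral_le[OF that, of I]) (use K row[OF True] z in \<open>auto simp: bn_def\<close>)
  qed (simp add: z K)
  show "(\<Sum>i\<in>P. norm (blk \<pi> A i j)) \<le> K" if "finite P" for j P
  proof (cases "j \<in> I")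
    case True
    show ?thesis by (rule sum_le_of_nn_integral_le[OF that, of I]) (use K col[OF True] z in \<open>auto simp: bn_def\<close>)
  qed (simp add: z K)
qed

section \<open>Weights of subexponential growth\<close>

locale grs_weight =
  fixes \<nu> :: "real ^ 'd \<Rightarrow> real"
  assumes submult: "submultiplicative_weight \<nu>" and sym: "symmetric_weight \<nu>" and GRS: "GRS_condition \<nu>"
begin

lemma nu_pos: "0 < \<nu> x" and nu_mult: "\<nu> (x + y) \<le> \<nu> x * \<nu> y" and nu_minus: "\<nu> (- x) = \<nu> x"
  using submult sym by (auto simp: submultiplicative_weight_def symmetric_weight_def)

text \<open>Writing 0 = 0 + 0 gives 1 \<le> \<nu>(0), and writing 0 = x - x gives \<nu>(0) \<le>
  \<nu>(x)^2 by symmetry.\<close>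

lemma nu_ge_1: "1 \<le> \<nu> x"
proof -
  have "\<nu> 0 * 1 \<le> \<nu> 0 * \<nu> 0" using nu_mult[of 0 0] by simp
  hence "1 \<le> \<nu> 0" using nu_pos[of 0] by simp
  also have "\<nu> 0 \<le> \<nu> x * \<nu> x" using nu_mult[of x "- x"] by (simp add: nu_minus)
  finally have "1\<^sup>2 \<le> (\<nu> x)\<^sup>2" by (simp add: power2_eq_square)
  thus ?thesis using nu_pos[of x] by (smt (verit) power2_le_imp_le)
qed

lemma nu_sum: "finite S \<Longrightarrow> \<nu> (\<Sum>a\<in>S. f a) \<le> \<nu> 0 * (\<Prod>a\<in>S. \<nu> (f a))"
proof (induction S rule: finite_induct)
  case (insert a S)
  have "\<nu> (f a + (\<Sum>a\<in>S. f a)) \<le> \<nu> (f a) * \<nu> (\<Sum>a\<in>S. f a)" by (rule nu_mult)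
  also have "\<dots> \<le> \<nu> (f a) * (\<nu> 0 * (\<Prod>a\<in>S. \<nu> (f a)))"
    using insert nu_pos[of "f a"] by (intro mult_left_mono) auto
  finally show ?case using insert by (simp add: mult_ac)
qed simp

text \<open>From some m on the m-th roots lie below exp \<eta>; \<open>C\<close> absorbs the
  finitely many earlier values.\<close>

lemma nu_ray: "0 < \<eta> \<Longrightarrow> \<exists>C. \<forall>m :: nat. \<nu> (real m *\<^sub>R z) \<le> C * exp (\<eta> * real m)"
proof -
  assume \<eta>: "0 < \<eta>"
  have "(\<lambda>n :: nat. \<nu> (real n *\<^sub>R z) powr (1 / real n)) \<longlonglongrightarrow> 1"
    using GRS unfolding GRS_condition_def by blast
  moreover have "1 < exp \<eta>" using \<eta> by simp
  ultimately have "eventually (\<lambda>n :: nat. \<nu> (real n *\<^sub>R z) powr (1 / real n) < exp \<eta>) sequentially"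
    by (rule order_tendstoD)
  then obtain n0 where n0: "\<And>n. n \<ge> n0 \<Longrightarrow> \<nu> (real n *\<^sub>R z) powr (1 / real n) < exp \<eta>"
    unfolding eventually_sequentially by blast
  have big: "\<nu> (real m *\<^sub>R z) \<le> exp (\<eta> * real m)" if "m \<ge> n0" "m \<ge> 1" for m
  proof -
    have "\<nu> (real m *\<^sub>R z) = (\<nu> (real m *\<^sub>R z) powr (1 / real m)) powr real m"
      using that nu_pos[of "real m *\<^sub>R z"] by (simp add: powr_powr)
    also have "\<dots> \<le> exp \<eta> powr real m"
      using n0[OF that(1)] by (intro powr_mono2) auto
    also have "\<dots> = exp (\<eta> * real m)" by (simp add: powr_def mult.commute)
    finally show ?thesis .
  qed
  define C where "C = 1 + (\<Sum>m\<le>n0. \<nu> (real m *\<^sub>R z))"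
  have C1: "1 \<le> C" unfolding C_def using nu_pos by (simp add: sum_nonneg less_imp_le)
  have "\<nu> (real m *\<^sub>R z) \<le> C * exp (\<eta> * real m)" for m
  proof (cases "m \<le> n0")
    case True
    have "\<nu> (real m *\<^sub>R z) \<le> (\<Sum>m\<le>n0. \<nu> (real m *\<^sub>R z))"
      using True nu_pos by (intro member_le_sum) (auto simp: less_imp_le)
    also have "\<dots> \<le> C * 1" by (simp add: C_def)
    also have "\<dots> \<le> C * exp (\<eta> * real m)" using C1 \<eta> by (intro mult_left_mono) auto
    finally show ?thesis .
  next
    case False
    hence "\<nu> (real m *\<^sub>R z) \<le> 1 * exp (\<eta> * real m)" using big[of m] by simp
    also have "\<dots> \<le> C * exp (\<eta> * real m)" using C1 by (intro mult_right_mono) auto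
    finally show ?thesis .
  qed
  thus ?thesis by blast
qed

text \<open>The GRS condition concerns one direction at a time and says nothing uniform about rays.
  A lattice point is an integer combination of the coordinate axes, so submultiplicativity reduces
  it to finitely many rays; each coordinate gets the share \<eta>/d of the exponent.\<close>

lemma nu_exp_bound:
  assumes \<eta>: "0 < \<eta>"
  shows "\<exists>C>0. \<forall>z\<in>int_lattice. \<nu> (t *\<^sub>R z) \<le> C * exp (\<eta> * norm z)"
proof -
  let ?d = "real CARD('d)"
  have "\<exists>C. \<forall>m :: nat. \<nu> (real m *\<^sub>R (t *\<^sub>R axis a 1)) \<le> C * exp (\<eta> / ?d * real m)" for a
    by (rule nu_ray) (use \<eta> in simp)
  then obtain C where C: "\<And>a m. \<nu> (real m *\<^sub>R (t *\<^sub>R axis a 1)) \<le> C a * exp (\<eta> / ?d * real m)"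
    by metis
  have C0: "0 < C a" for a
    using C[of 0 a] nu_pos[of 0] by simp
  have "\<nu> (t *\<^sub>R z) \<le> (\<nu> 0 * (\<Prod>a\<in>UNIV. C a)) * exp (\<eta> * norm z)" if z: "z \<in> int_lattice" for z
  proof -
    have "t *\<^sub>R z = (\<Sum>a\<in>UNIV. t *\<^sub>R (z $ a *\<^sub>R axis a 1))"
      by (simp add: vec_eq_iff axis_def if_distrib[of "\<lambda>x. _ * x"] cong: if_cong)
    hence "\<nu> (t *\<^sub>R z) \<le> \<nu> 0 * (\<Prod>a\<in>UNIV. \<nu> (t *\<^sub>R (z $ a *\<^sub>R axis a 1)))"
      by (simp only: nu_sum[OF finite])
    also have "\<dots> \<le> \<nu> 0 * (\<Prod>a\<in>UNIV. C a * exp (\<eta> / ?d * norm z))"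
    proof (intro mult_left_mono prod_mono conjI)
      fix a
      obtain k :: int where k: "z $ a = of_int k" using z by (auto simp: int_lattice_def elim!: allE[of _ a] Ints_cases)
      have "\<nu> (t *\<^sub>R (z $ a *\<^sub>R axis a 1)) = \<nu> (real (nat \<bar>k\<bar>) *\<^sub>R (t *\<^sub>R axis a 1))"
      proof (cases "k \<ge> 0")
        case True
        thus ?thesis by (simp add: k mult.commute)
      next
        case False
        thus ?thesis using nu_minus[of "real (nat \<bar>k\<bar>) *\<^sub>R (t *\<^sub>R axis a 1)"] by (simp add: k mult.commute)
      qed
      also have "\<dots> \<le> C a * exp (\<eta> / ?d * real (nat \<bar>k\<bar>))" by (rule C)
      also have "\<dots> \<le> C a * exp (\<eta> / ?d * norm z)"
      proof -
        have "real (nat \<bar>k\<bar>) \<le> norm z" using component_le_norm_cart[of z a] by (simp add: k)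
        thus ?thesis using C0[of a] \<eta> by (simp add: divide_right_mono mult_left_mono)
      qed
      finally show "\<nu> (t *\<^sub>R (z $ a *\<^sub>R axis a 1)) \<le> C a * exp (\<eta> / ?d * norm z)" .
    qed (use nu_pos in \<open>auto simp: less_imp_le\<close>)
    also have "(\<Prod>a\<in>UNIV. C a * exp (\<eta> / ?d * norm z)) = (\<Prod>a\<in>UNIV. C a) * exp (\<eta> * norm z)"
      by (simp add: prod.distrib exp_of_nat_mult[symmetric])
    finally show ?thesis by (simp add: mult.assoc)
  qed
  moreover have "0 < \<nu> 0 * (\<Prod>a\<in>UNIV. C a)" using nu_pos C0 by (simp add: prod_pos)
  ultimately show ?thesis by blast
qed

end

section \<open>Localization in position space\<close>

text \<open>A trapezoidal cut-off: 1 up to radius d, 0 from radius 2 d on, with slope 1/d. The unit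
  d is chosen because it bounds the distance of a point to the corner of its unit cell.\<close>

definition psi :: "real ^ 'd \<Rightarrow> real" where
  "psi y = max 0 (min 1 (2 - norm y / real CARD('d)))"

lemma psi_range: "0 \<le> psi y" "psi y \<le> 1" "\<bar>psi y\<bar> \<le> 1"
  by (auto simp: psi_def)

lemma psi_eq_1: "norm (y :: real ^ 'd) \<le> real CARD('d) \<Longrightarrow> psi y = 1"
  by (simp add: psi_def pos_divide_le_eq)

lemma psi_nonzero: "psi (y :: real ^ 'd) \<noteq> 0 \<Longrightarrow> norm y \<le> 2 * real CARD('d)"
  by (rule ccontr) (auto simp: psi_def max_def min_def field_simps split: if_splits)

lemma psi_Lipschitz: "\<bar>psi y - psi (y' :: real ^ 'd)\<bar> \<le> min 1 (norm (y - y'))"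
proof -
  have d: "1 \<le> real CARD('d)" by (simp add: Suc_le_eq)
  have "\<bar>psi y - psi y'\<bar> \<le> \<bar>norm y / real CARD('d) - norm y' / real CARD('d)\<bar>"
    unfolding psi_def by linarith
  also have "\<dots> = \<bar>norm y - norm y'\<bar> / real CARD('d)"
    by (simp add: diff_divide_distrib[symmetric])
  also have "\<dots> \<le> \<bar>norm y - norm y'\<bar> / 1" using d by (intro divide_left_mono) auto
  also have "\<dots> \<le> norm (y - y')" using norm_triangle_ineq3 by simp
  finally show ?thesis using psi_range[of y] psi_range[of y'] by simp
qed

definition fl :: "real ^ 'd \<Rightarrow> real ^ 'd" where
  "fl u = (\<chi> a. of_int \<lfloor>u $ a\<rfloor>)"

lemma fl_lattice: "fl u \<in> int_lattice"
  by (simp add: fl_def int_lattice_def)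

lemma norm_diff_fl: "norm (u - fl (u :: real ^ 'd)) \<le> real CARD('d)"
proof -
  have "norm (u - fl u) \<le> (\<Sum>a\<in>UNIV. \<bar>(u - fl u) $ a\<bar>)" by (rule norm_le_l1_cart)
  also have "\<dots> \<le> (\<Sum>a\<in>(UNIV :: 'd set). 1)"
  proof (intro sum_mono)
    fix a
    show "\<bar>(u - fl u) $ a\<bar> \<le> 1"
    proof -
      have "\<bar>x - y\<bar> \<le> 1" if "y \<le> x" "x < y + 1" for x y :: real using that by simp
      from this[OF of_int_floor_le real_of_int_floor_add_one_gt] show ?thesis by (simp add: fl_def)
    qed
  qed
  finally show ?thesis by simp
qed

text \<open>Two localizations at scale \<open>n\<close> are needed: \<open>Psi\<close> has small
  commutators with \<open>R\<close> when \<open>n\<close> is large, while the sharp projections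
  \<open>Chi\<close> form a partition into cells over which norms can be summed.\<close>

definition Psi :: "('x \<Rightarrow> real ^ 'd) \<Rightarrow> real \<Rightarrow> real ^ 'd \<Rightarrow> 'x bmat" where
  "Psi \<pi> n \<beta> = Dg (\<lambda>x. psi (\<pi> x /\<^sub>R n - \<beta>))"

definition Chi :: "('x \<Rightarrow> real ^ 'd) \<Rightarrow> real \<Rightarrow> real ^ 'd \<Rightarrow> 'x bmat" where
  "Chi \<pi> n \<gamma> = Pr (\<lambda>x. fl (\<pi> x /\<^sub>R n)) \<gamma>"

lemma ent_Psi_mult:
  "ent (Psi \<pi> n \<beta> * A) x y = of_real (psi (\<pi> x /\<^sub>R n - \<beta>)) * ent A x y"
  "ent (A * Psi \<pi> n \<beta>) x y = ent A x y * of_real (psi (\<pi> y /\<^sub>R n - \<beta>))"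
  unfolding Psi_def by (simp_all add: ent_Dg_mult psi_range)

lemma ent_Chi_mult:
  "ent (Chi \<pi> n \<gamma> * A) x y = (if fl (\<pi> x /\<^sub>R n) = \<gamma> then ent A x y else 0)"
  "ent (A * Chi \<pi> n \<gamma>) x y = (if fl (\<pi> y /\<^sub>R n) = \<gamma> then ent A x y else 0)"
  unfolding Chi_def by (simp_all add: ent_Pr_mult)

text \<open>Majorant of the commutator of \<open>Psi \<pi> n \<beta>\<close> with a matrix whose side diagonals have norms \<open>r k\<close>,
  restricted to the cell \<open>\<gamma>\<close>, as a function of \<open>\<delta> = \<beta> - \<gamma>\<close>.\<close>

definition comm_bound :: "real \<Rightarrow> (real ^ 'd \<Rightarrow> ennreal) \<Rightarrow> real ^ 'd \<Rightarrow> ennreal" where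
  "comm_bound n r \<delta> = (\<integral>\<^sup>+k. r k * ennreal (min 1 (norm (k /\<^sub>R n))) *
     (of_bool (norm (0 - \<delta>) \<le> 3 * real CARD('d)) + of_bool (norm (k /\<^sub>R n - \<delta>) \<le> 3 * real CARD('d)))
     \<partial>count_space int_lattice)"

text \<open>The function in \<open>Psi\<close> is constant on the blocks, so a block of the
  commutator is a scalar multiple of the block of \<open>R\<close>, the scalar being a difference of
  values of \<open>psi\<close>. Its Lipschitz bound yields the factor min 1 |k/n|, and Schur's test
  turns the majorant along side diagonals into a norm bound.\<close>

lemma norm_commutator_le:
  fixes \<pi> :: "'x \<Rightarrow> real ^ 'd"
  assumes supp: "supp \<pi> int_lattice R"
  shows "ennreal (norm ((Psi \<pi> n \<beta> * R - R * Psi \<pi> n \<beta>) * Chi \<pi> n \<gamma>)) \<le> comm_bound n (diagN (bn \<pi> R)) (\<beta> - \<gamma>)"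
    (is "ennreal (norm ?A) \<le> ?E")
proof (cases "?E = \<infinity>")
  case False
  then obtain K where K: "?E = ennreal K" "0 \<le> K" by (cases ?E) auto
  let ?Z = "int_lattice :: (real ^ 'd) set" and ?D = "real CARD('d)"
  define g where "g k = diagN (bn \<pi> R) k * ennreal (min 1 (norm (k /\<^sub>R n))) *
     (of_bool (norm (0 - (\<beta> - \<gamma>)) \<le> 3 * ?D) + of_bool (norm (k /\<^sub>R n - (\<beta> - \<gamma>)) \<le> 3 * ?D))" for k
  have E: "?E = (\<integral>\<^sup>+k. g k \<partial>count_space ?Z)" by (simp add: comm_bound_def g_def)
  have entA: "ent ?A x y = (if fl (\<pi> y /\<^sub>R n) = \<gamma>
      then of_real (psi (\<pi> x /\<^sub>R n - \<beta>) - psi (\<pi> y /\<^sub>R n - \<beta>)) * ent R x y else 0)" for x y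
    unfolding ent_Chi_mult(2) ent_simps ent_Psi_mult by (simp add: algebra_simps)
  have bnA: "bn \<pi> ?A i j \<le> g (i - j)" if i: "i \<in> ?Z" and j: "j \<in> ?Z" for i j
  proof -
    define c where "c = (if fl (j /\<^sub>R n) = \<gamma> then psi (i /\<^sub>R n - \<beta>) - psi (j /\<^sub>R n - \<beta>) else 0)"
    have "blk \<pi> ?A i j = cscale (of_real c) (blk \<pi> R i j)"
      by (rule bmat_eqI) (auto simp: ent_blk cscale.rep_eq entA c_def)
    hence e: "bn \<pi> ?A i j = ennreal \<bar>c\<bar> * bn \<pi> R i j"
      by (simp add: bn_def norm_cscale ennreal_mult)
    show ?thesis
    proof (cases "c = 0")
      case False
      hence fl: "fl (j /\<^sub>R n) = \<gamma>" and c: "c = psi (i /\<^sub>R n - \<beta>) - psi (j /\<^sub>R n - \<beta>)"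
        by (auto simp: c_def split: if_splits)
      have "\<bar>c\<bar> \<le> min 1 (norm ((i /\<^sub>R n - \<beta>) - (j /\<^sub>R n - \<beta>)))" unfolding c by (rule psi_Lipschitz)
      also have "(i /\<^sub>R n - \<beta>) - (j /\<^sub>R n - \<beta>) = (i - j) /\<^sub>R n" by (simp add: algebra_simps)
      finally have cle: "\<bar>c\<bar> \<le> min 1 (norm ((i - j) /\<^sub>R n))" .
      have jf: "norm (j /\<^sub>R n - \<gamma>) \<le> ?D" using norm_diff_fl[of "j /\<^sub>R n"] fl by simp
      \<comment> \<open>A nonzero difference puts i/n or j/n within 2 d of \<beta>; since j/n is
        within d of \<gamma>, this confines \<beta> - \<gamma> to radius 3 d around (i - j)/n or
        around 0.\<close>
      have "psi (i /\<^sub>R n - \<beta>) \<noteq> 0 \<or> psi (j /\<^sub>R n - \<beta>) \<noteq> 0" using False c by auto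
      hence "norm (0 - (\<beta> - \<gamma>)) \<le> 3 * ?D \<or> norm ((i - j) /\<^sub>R n - (\<beta> - \<gamma>)) \<le> 3 * ?D"
      proof
        assume "psi (i /\<^sub>R n - \<beta>) \<noteq> 0"
        hence "norm (i /\<^sub>R n - \<beta>) \<le> 2 * ?D" by (rule psi_nonzero)
        hence "norm ((i /\<^sub>R n - \<beta>) - (j /\<^sub>R n - \<gamma>)) \<le> 3 * ?D"
          using norm_triangle_ineq4[of "i /\<^sub>R n - \<beta>" "j /\<^sub>R n - \<gamma>"] jf by linarith
        thus ?thesis by (simp add: algebra_simps)
      next
        assume "psi (j /\<^sub>R n - \<beta>) \<noteq> 0"
        hence "norm (j /\<^sub>R n - \<beta>) \<le> 2 * ?D" by (rule psi_nonzero)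
        hence "norm ((j /\<^sub>R n - \<beta>) - (j /\<^sub>R n - \<gamma>)) \<le> 3 * ?D"
          using norm_triangle_ineq4[of "j /\<^sub>R n - \<beta>" "j /\<^sub>R n - \<gamma>"] jf by linarith
        thus ?thesis by (simp add: algebra_simps)
      qed
      hence one: "(1 :: ennreal) \<le> of_bool (norm (0 - (\<beta> - \<gamma>)) \<le> 3 * ?D) + of_bool (norm ((i - j) /\<^sub>R n - (\<beta> - \<gamma>)) \<le> 3 * ?D)"
        by auto
      have "bn \<pi> ?A i j = bn \<pi> R i j * ennreal \<bar>c\<bar> * 1" by (simp add: e mult.commute)
      also have "\<dots> \<le> g (i - j)"
        unfolding g_def by (intro mult_mono diagN_upper i j ennreal_leI cle one) auto
      finally show ?thesis .
    qed (simp add: e)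
  qed
  have suppA: "supp \<pi> ?Z ?A"
    by (rule suppI) (simp add: entA suppD[OF supp])
  have "norm ?A \<le> K"
  proof (rule norm_Schur_test[OF suppA K(2)])
    fix i assume i: "i \<in> ?Z"
    have "(\<integral>\<^sup>+j. bn \<pi> ?A i j \<partial>count_space ?Z) \<le> (\<integral>\<^sup>+j. g (i - j) \<partial>count_space ?Z)"
      by (intro nn_integral_mono bnA i) simp
    also have "\<dots> = ?E" unfolding E by (rule nn_integral_lattice_shift(2)[OF i])
    finally show "(\<integral>\<^sup>+j. bn \<pi> ?A i j \<partial>count_space ?Z) \<le> ennreal K" unfolding K(1) .
    have "(\<integral>\<^sup>+j. bn \<pi> ?A j i \<partial>count_space ?Z) \<le> (\<integral>\<^sup>+j. g (j - i) \<partial>count_space ?Z)"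
      by (intro nn_integral_mono bnA i) simp
    also have "\<dots> = ?E" unfolding E by (rule nn_integral_lattice_shift(1)[OF i])
    finally show "(\<integral>\<^sup>+j. bn \<pi> ?A j i \<partial>count_space ?Z) \<le> ennreal K" unfolding K(1) .
  qed
  thus ?thesis unfolding K(1) by (rule ennreal_leI)
qed simp

text \<open>The \<open>m\<close>-th convolution power of (q times the unit mass at 0, plus
  \<open>e\<close>), convolved with the indicator of the ball of radius 3 d. Outside this radius the
  localizations \<open>Psi\<close> at \<beta> and \<open>Chi\<close> at \<gamma> do not
  overlap.\<close>

primrec conv_pow :: "ennreal \<Rightarrow> (real ^ 'd \<Rightarrow> ennreal) \<Rightarrow> nat \<Rightarrow> real ^ 'd \<Rightarrow> ennreal" where
  "conv_pow q e 0 = (\<lambda>\<delta>. of_bool (norm (0 - \<delta>) \<le> 3 * real CARD('d)))"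
| "conv_pow q e (Suc m) = (\<lambda>\<delta>. q * conv_pow q e m \<delta> + (\<integral>\<^sup>+\<beta>. e \<beta> * conv_pow q e m (\<delta> - \<beta>) \<partial>count_space int_lattice))"

text \<open>Moving \<open>Psi \<pi> n \<beta>\<close> past one factor \<open>R\<close> costs a commutator, whose norm is summed over the
  cells; thus the localized norms of \<open>R ^ m\<close> are dominated by a convolution power.\<close>

lemma norm_localized_power_le:
  fixes \<pi> :: "'x \<Rightarrow> real ^ 'd"
  assumes supp: "supp \<pi> int_lattice R" and \<gamma>: "\<gamma> \<in> int_lattice"
  shows "\<beta> \<in> int_lattice \<Longrightarrow> ennreal (norm (Psi \<pi> n \<beta> * R ^ m * Chi \<pi> n \<gamma>))
    \<le> conv_pow (ennreal (norm R)) (comm_bound n (diagN (bn \<pi> R))) m (\<beta> - \<gamma>)"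
proof (induction m arbitrary: \<beta>)
  case 0
  let ?D = "real CARD('d)"
  have "Psi \<pi> n \<beta> * Chi \<pi> n \<gamma> = 0" if "\<not> norm (\<beta> - \<gamma>) \<le> 3 * ?D"
  proof (rule bmat_eqI)
    fix x y
    have "psi (\<pi> x /\<^sub>R n - \<beta>) = 0" if fl: "fl (\<pi> x /\<^sub>R n) = \<gamma>"
    proof (rule ccontr)
      assume "psi (\<pi> x /\<^sub>R n - \<beta>) \<noteq> 0"
      hence "norm (\<pi> x /\<^sub>R n - \<beta>) \<le> 2 * ?D" by (rule psi_nonzero)
      moreover have "norm (\<pi> x /\<^sub>R n - \<gamma>) \<le> ?D" using norm_diff_fl[of "\<pi> x /\<^sub>R n"] fl by simp
      ultimately have "norm ((\<pi> x /\<^sub>R n - \<gamma>) - (\<pi> x /\<^sub>R n - \<beta>)) \<le> 3 * ?D"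
        using norm_triangle_ineq4[of "\<pi> x /\<^sub>R n - \<gamma>" "\<pi> x /\<^sub>R n - \<beta>"] by linarith
      thus False using \<open>\<not> norm (\<beta> - \<gamma>) \<le> 3 * ?D\<close> by simp
    qed
    moreover have "ent (Chi \<pi> n \<gamma>) x y = (if fl (\<pi> x /\<^sub>R n) = \<gamma> then ent 1 x y else 0)"
      using ent_Chi_mult(1)[of \<pi> n \<gamma> 1 x y] by simp
    ultimately show "ent (Psi \<pi> n \<beta> * Chi \<pi> n \<gamma>) x y = ent 0 x y"
      by (simp add: ent_Psi_mult ent_simps)
  qed
  moreover have "norm (Psi \<pi> n \<beta> * Chi \<pi> n \<gamma>) \<le> 1"
    using norm_Dg_mult(1)[of _ "Chi \<pi> n \<gamma>"] norm_Dg unfolding Psi_def Chi_def Pr_def by (rule order_trans)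
  ultimately show ?case
    using ennreal_leI by (fastforce simp: norm_minus_commute)
next
  case (Suc m)
  let ?h = "conv_pow (ennreal (norm R)) (comm_bound n (diagN (bn \<pi> R)))" and ?Z = "int_lattice :: (real ^ 'd) set"
  let ?e = "comm_bound n (diagN (bn \<pi> R))"
  let ?C = "Psi \<pi> n \<beta> * R - R * Psi \<pi> n \<beta>"
  let ?B = "R ^ m * Chi \<pi> n \<gamma>"
  have "ennreal (norm (?C * ?B)) \<le> (\<integral>\<^sup>+p. ennreal (norm (?C * Chi \<pi> n p) * norm (Chi \<pi> n p * ?B)) \<partial>count_space UNIV)"
    unfolding Chi_def[of _ _ "_ :: real^'d" for \<pi> n] by (rule norm_mult_le_nn_integral)
  also have "\<dots> \<le> (\<integral>\<^sup>+p. (?e (\<beta> - p) * ?h m (p - \<gamma>)) * indicator ?Z p \<partial>count_space UNIV)"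
  proof (intro nn_integral_mono)
    fix p
    show "ennreal (norm (?C * Chi \<pi> n p) * norm (Chi \<pi> n p * ?B)) \<le> (?e (\<beta> - p) * ?h m (p - \<gamma>)) * indicator ?Z p"
    proof (cases "p \<in> ?Z")
      case True
      \<comment> \<open>\<open>Psi\<close> at \<open>p\<close> is 1 on the cell \<open>p\<close>;
        inserting it produces the localized power to which the induction hypothesis applies.\<close>
      have "Chi \<pi> n p * ?B = Chi \<pi> n p * (Psi \<pi> n p * ?B)"
      proof (rule bmat_eqI)
        fix x y
        have "psi (\<pi> x /\<^sub>R n - p) = 1" if "fl (\<pi> x /\<^sub>R n) = p"
          using norm_diff_fl[of "\<pi> x /\<^sub>R n"] that by (intro psi_eq_1) simp
        thus "ent (Chi \<pi> n p * ?B) x y = ent (Chi \<pi> n p * (Psi \<pi> n p * ?B)) x y"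
          unfolding ent_Chi_mult(1) ent_Psi_mult(1) by simp
      qed
      hence "norm (Chi \<pi> n p * ?B) \<le> norm (Psi \<pi> n p * ?B)"
        by (metis Chi_def norm_Pr_mult(1))
      hence "ennreal (norm (Chi \<pi> n p * ?B)) \<le> ?h m (p - \<gamma>)"
        using Suc.IH[OF True] by (simp add: mult.assoc) (meson ennreal_leI order_trans)
      thus ?thesis using True norm_commutator_le[OF supp, of n \<beta> p]
        by (simp add: ennreal_mult mult_mono)
    next
      case False
      have "?C * Chi \<pi> n p = 0"
        using False fl_lattice by (intro bmat_eqI) (auto simp: ent_Chi_mult ent_simps)
      thus ?thesis by simp
    qed
  qed
  also have "\<dots> = (\<integral>\<^sup>+p. ?e (\<beta> - p) * ?h m (p - \<gamma>) \<partial>count_space ?Z)"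
    by (rule nn_integral_count_space_indicator[symmetric]) simp
  also have "\<dots> = (\<integral>\<^sup>+p. ?e (\<beta> - p) * ?h m ((\<beta> - \<gamma>) - (\<beta> - p)) \<partial>count_space ?Z)"
    by (intro nn_integral_cong) (simp add: algebra_simps)
  also have "\<dots> = (\<integral>\<^sup>+p. ?e p * ?h m ((\<beta> - \<gamma>) - p) \<partial>count_space ?Z)"
    by (rule nn_integral_lattice_shift(2)[OF Suc.prems, of "\<lambda>p. ?e p * ?h m ((\<beta> - \<gamma>) - p)"])
  finally have 2: "ennreal (norm (?C * ?B)) \<le> (\<integral>\<^sup>+p. ?e p * ?h m ((\<beta> - \<gamma>) - p) \<partial>count_space ?Z)" .
  have "ennreal (norm (R * (Psi \<pi> n \<beta> * R ^ m * Chi \<pi> n \<gamma>))) \<le> ennreal (norm R) * ennreal (norm (Psi \<pi> n \<beta> * R ^ m * Chi \<pi> n \<gamma>))"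
    by (simp add: ennreal_leI norm_mult_ineq flip: ennreal_mult)
  also have "\<dots> \<le> ennreal (norm R) * ?h m (\<beta> - \<gamma>)"
    by (intro mult_left_mono Suc) simp
  finally have 1: "ennreal (norm (R * (Psi \<pi> n \<beta> * R ^ m * Chi \<pi> n \<gamma>))) \<le> ennreal (norm R) * ?h m (\<beta> - \<gamma>)" .
  \<comment> \<open>Commuting \<open>Psi\<close> past one \<open>R\<close>: the main term costs the
    factor \<open>norm R\<close>, the commutator one convolution with \<open>?e\<close>.\<close>
  have "Psi \<pi> n \<beta> * R ^ Suc m * Chi \<pi> n \<gamma> = R * (Psi \<pi> n \<beta> * R ^ m * Chi \<pi> n \<gamma>) + ?C * ?B"
    by (simp add: algebra_simps)
  hence "ennreal (norm (Psi \<pi> n \<beta> * R ^ Suc m * Chi \<pi> n \<gamma>))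
    \<le> ennreal (norm (R * (Psi \<pi> n \<beta> * R ^ m * Chi \<pi> n \<gamma>))) + ennreal (norm (?C * ?B))"
    by (metis ennreal_leI ennreal_plus norm_ge_zero norm_triangle_ineq)
  also have "\<dots> \<le> ?h (Suc m) (\<beta> - \<gamma>)" using add_mono[OF 1 2] by simp
  finally show ?case .
qed

lemma nn_integral_count_space_inj_le:
  fixes f :: "'b \<Rightarrow> ennreal"
  assumes "inj_on g A" "g ` A \<subseteq> B"
  shows "(\<integral>\<^sup>+x. f (g x) \<partial>count_space A) \<le> (\<integral>\<^sup>+x. f x \<partial>count_space B)"
proof (rule nn_integral_count_space_le)
  fix F assume F: "finite F" "F \<subseteq> A"
  have "(\<Sum>x\<in>F. f (g x)) = sum f (g ` F)"
    using inj_on_subset[OF assms(1) F(2)] by (simp add: sum.reindex)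
  also have "\<dots> \<le> (\<integral>\<^sup>+x. f x \<partial>count_space B)"
    using F assms(2) by (intro sum_le_nn_integral_count_space) auto
  finally show "(\<Sum>x\<in>F. f (g x)) \<le> (\<integral>\<^sup>+x. f x \<partial>count_space B)" .
qed

section \<open>Weights on the coarse lattice\<close>

context grs_weight
begin

definition V :: "real ^ 'd \<Rightarrow> ennreal" where "V x = ennreal (\<nu> x)"

lemma V_ge_1: "1 \<le> V x" and V_fin: "V x < top" and V_minus: "V (- x) = V x"
  and V_mult: "V (x + y) \<le> V x * V y"
  using nu_ge_1[of x] nu_mult[of x y] nu_pos[of x] nu_pos[of y]
  by (auto simp: V_def nu_minus ennreal_leI simp flip: ennreal_mult ennreal_1)

lemma matrix_norm_V: "matrix_norm (cN V) int_lattice 1"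
  by (rule matrix_norm_sjostrand) (rule V_ge_1 V_fin V_minus V_mult)+

definition ball_weight :: "real \<Rightarrow> ennreal" where
  "ball_weight \<rho> = (\<integral>\<^sup>+x. of_bool (norm x \<le> \<rho>) * V x \<partial>count_space int_lattice)"

lemma ball_weight_finite: "ball_weight \<rho> < top"
proof -
  let ?S = "{x\<in>int_lattice. norm (0 - x) \<le> \<rho>} :: (real ^ 'd) set"
  have fin: "finite ?S" using int_lattice_ball[of \<rho>, where 'd='d] by metis
  have "ball_weight \<rho> = (\<Sum>x\<in>?S. of_bool (norm x \<le> \<rho>) * V x)"
    unfolding ball_weight_def using fin by (intro nn_integral_count_space') auto
  also have "\<dots> = (\<Sum>x\<in>?S. ennreal (\<nu> x))" by (intro sum.cong) (auto simp: V_def)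
  also have "\<dots> = ennreal (\<Sum>x\<in>?S. \<nu> x)" by (rule sum_ennreal) (simp add: nu_pos less_imp_le)
  finally show ?thesis by simp
qed

text \<open>For integer \<open>n\<close> the points n \<delta> - k are distinct lattice points, so a
  sum over the coarse lattice near k/n is at most a sum over a ball of the fine lattice; moving the
  centre to k costs the factor \<open>V k\<close>.\<close>

lemma coarse_ball:
  assumes n: "1 \<le> n" and k: "k \<in> int_lattice"
  shows "(\<integral>\<^sup>+\<delta>. of_bool (norm (k /\<^sub>R real n - \<delta>) \<le> \<rho>) * V (real n *\<^sub>R \<delta>) \<partial>count_space int_lattice)
    \<le> V k * ball_weight (\<rho> * real n)"
proof -
  let ?Z = "int_lattice :: (real ^ 'd) set"
  let ?f = "\<lambda>x. of_bool (norm x \<le> \<rho> * real n) * V x"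
  have n0: "0 < real n" using n by simp
  have "(\<integral>\<^sup>+\<delta>. of_bool (norm (k /\<^sub>R real n - \<delta>) \<le> \<rho>) * V (real n *\<^sub>R \<delta>) \<partial>count_space ?Z)
    \<le> (\<integral>\<^sup>+\<delta>. V k * ?f (real n *\<^sub>R \<delta> - k) \<partial>count_space ?Z)"
  proof (intro nn_integral_mono)
    fix \<delta>
    have "real n *\<^sub>R \<delta> - k = - (real n *\<^sub>R (k /\<^sub>R real n - \<delta>))"
      using n0 by (simp add: scaleR_right_diff_distrib)
    hence "norm (real n *\<^sub>R \<delta> - k) = real n * norm (k /\<^sub>R real n - \<delta>)" by simp
    hence "norm (k /\<^sub>R real n - \<delta>) \<le> \<rho> \<longleftrightarrow> norm (real n *\<^sub>R \<delta> - k) \<le> \<rho> * real n"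
      using n0 by (simp add: mult.commute[of "real n"])
    moreover have "V (real n *\<^sub>R \<delta>) \<le> V k * V (real n *\<^sub>R \<delta> - k)"
      using V_mult[of k "real n *\<^sub>R \<delta> - k"] by simp
    ultimately show "of_bool (norm (k /\<^sub>R real n - \<delta>) \<le> \<rho>) * V (real n *\<^sub>R \<delta>) \<le> V k * ?f (real n *\<^sub>R \<delta> - k)"
      by simp
  qed
  also have "\<dots> = V k * (\<integral>\<^sup>+\<delta>. ?f (real n *\<^sub>R \<delta> - k) \<partial>count_space ?Z)"
    by (rule nn_integral_cmult) simp
  also have "\<dots> \<le> V k * ball_weight (\<rho> * real n)"
    unfolding ball_weight_def using n0 k
    by (intro mult_left_mono nn_integral_count_space_inj_le[where f="?f"])
       (auto simp: inj_on_def intro: int_lattice_diff int_lattice_scale)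
  finally show ?thesis .
qed

lemma coarse_ball_0:
  assumes n: "1 \<le> n"
  shows "(\<integral>\<^sup>+\<delta>. of_bool (norm (0 - \<delta>) \<le> \<rho>) * V (real n *\<^sub>R \<delta>) \<partial>count_space int_lattice)
    \<le> V 0 * ball_weight (\<rho> * real n)"
  using coarse_ball[OF n int_lattice_0, of \<rho>] by simp

text \<open>This weighted mass depends on \<open>n\<close> and is not made small; it is the
  integrable majorant for the limit in which \<eta> tends to 0.\<close>

lemma comm_bound_weighted_finite:
  assumes n: "1 \<le> n" and r: "(\<integral>\<^sup>+k. r k * V k \<partial>count_space int_lattice) < \<infinity>"
  shows "(\<integral>\<^sup>+\<delta>. comm_bound (real n) r \<delta> * V (real n *\<^sub>R \<delta>) \<partial>count_space int_lattice) < \<infinity>"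
proof -
  let ?Z = "int_lattice :: (real ^ 'd) set" and ?D = "3 * real CARD('d)"
  let ?w = "\<lambda>k. r k * ennreal (min 1 (norm (k /\<^sub>R real n)))"
  let ?a = "\<lambda>\<delta>. of_bool (norm (0 - \<delta>) \<le> ?D) :: ennreal"
  let ?b = "\<lambda>k \<delta>. of_bool (norm (k /\<^sub>R real n - \<delta>) \<le> ?D) :: ennreal"
  let ?V = "\<lambda>\<delta>. V (real n *\<^sub>R \<delta>)"
  let ?G = "ball_weight (?D * real n)"
  have "(\<integral>\<^sup>+\<delta>. comm_bound (real n) r \<delta> * ?V \<delta> \<partial>count_space ?Z)
    = (\<integral>\<^sup>+\<delta>. \<integral>\<^sup>+k. ?w k * (?a \<delta> + ?b k \<delta>) * ?V \<delta> \<partial>count_space ?Z \<partial>count_space ?Z)"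
    by (simp add: comm_bound_def nn_integral_multc)
  also have "\<dots> = (\<integral>\<^sup>+k. \<integral>\<^sup>+\<delta>. ?w k * (?a \<delta> + ?b k \<delta>) * ?V \<delta> \<partial>count_space ?Z \<partial>count_space ?Z)"
    by (rule nn_integral_count_space_nn_integral[OF countable_int_lattice]) simp
  also have "\<dots> = (\<integral>\<^sup>+k. ?w k * ((\<integral>\<^sup>+\<delta>. ?a \<delta> * ?V \<delta> \<partial>count_space ?Z) + (\<integral>\<^sup>+\<delta>. ?b k \<delta> * ?V \<delta> \<partial>count_space ?Z)) \<partial>count_space ?Z)"
    by (simp add: nn_integral_cmult nn_integral_add distrib_right mult.assoc flip: nn_integral_add)
  also have "\<dots> \<le> (\<integral>\<^sup>+k. (r k * V k) * (V 0 * ?G + ?G) \<partial>count_space ?Z)"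
  proof (intro nn_integral_mono)
    fix k assume "k \<in> space (count_space ?Z)"
    hence k: "k \<in> ?Z" by simp
    have w: "?w k \<le> r k"
      using mult_left_mono[of "ennreal (min 1 (norm (k /\<^sub>R real n)))" 1 "r k"] by simp
    have "(\<integral>\<^sup>+\<delta>. ?a \<delta> * ?V \<delta> \<partial>count_space ?Z) + (\<integral>\<^sup>+\<delta>. ?b k \<delta> * ?V \<delta> \<partial>count_space ?Z) \<le> V 0 * ?G + V k * ?G"
      by (intro add_mono coarse_ball_0 coarse_ball n k)
    also have "\<dots> \<le> V k * (V 0 * ?G) + V k * ?G"
      using mult_right_mono[OF V_ge_1[of k], of "V 0 * ?G"] by (intro add_right_mono) simp
    finally have "(\<integral>\<^sup>+\<delta>. ?a \<delta> * ?V \<delta> \<partial>count_space ?Z) + (\<integral>\<^sup>+\<delta>. ?b k \<delta> * ?V \<delta> \<partial>count_space ?Z)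
      \<le> V k * (V 0 * ?G + ?G)" by (simp only: distrib_left)
    from mult_mono[OF w this]
    show "?w k * ((\<integral>\<^sup>+\<delta>. ?a \<delta> * ?V \<delta> \<partial>count_space ?Z) + (\<integral>\<^sup>+\<delta>. ?b k \<delta> * ?V \<delta> \<partial>count_space ?Z))
      \<le> (r k * V k) * (V 0 * ?G + ?G)" by (simp add: mult.assoc)
  qed
  also have "\<dots> = (\<integral>\<^sup>+k. r k * V k \<partial>count_space ?Z) * (V 0 * ?G + ?G)"
    by (rule nn_integral_multc) simp
  also have "\<dots> < \<infinity>" using r ball_weight_finite V_fin by (simp add: ennreal_mult_less_top)
  finally show ?thesis .
qed

text \<open>For each k the relevant \<delta> lie in two balls that contain at most c lattice points,
  whatever \<open>n\<close> is. What remains is the sum of r k times min 1 |k/n|, which tends to 0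
  by dominated convergence.\<close>

lemma comm_bound_small:
  fixes r :: "real ^ 'd \<Rightarrow> ennreal"
  assumes r: "(\<integral>\<^sup>+k. r k \<partial>count_space int_lattice) < \<infinity>" and rfin: "\<And>k. k \<in> int_lattice \<Longrightarrow> r k < top"
    and e: "0 < e"
  shows "\<exists>n\<ge>1. (\<integral>\<^sup>+\<delta>. comm_bound (real n) r \<delta> \<partial>count_space int_lattice) < e"
proof -
  let ?Z = "int_lattice :: (real ^ 'd) set" and ?D = "3 * real CARD('d)"
  obtain c where c: "\<And>u :: real ^ 'd. (\<integral>\<^sup>+x. of_bool (norm (u - x) \<le> ?D) \<partial>count_space ?Z) \<le> ennreal c"
    using nn_integral_lattice_ball by blast
  let ?w = "\<lambda>n k. r k * ennreal (min 1 (norm (k /\<^sub>R real n)))"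
  have le: "(\<integral>\<^sup>+\<delta>. comm_bound (real n) r \<delta> \<partial>count_space ?Z) \<le> (\<integral>\<^sup>+k. ?w n k \<partial>count_space ?Z) * (ennreal c + ennreal c)" for n
  proof -
    let ?a = "\<lambda>\<delta>. of_bool (norm (0 - \<delta>) \<le> ?D) :: ennreal"
    let ?b = "\<lambda>k \<delta>. of_bool (norm (k /\<^sub>R real n - \<delta>) \<le> ?D) :: ennreal"
    have "(\<integral>\<^sup>+\<delta>. comm_bound (real n) r \<delta> \<partial>count_space ?Z)
      = (\<integral>\<^sup>+k. \<integral>\<^sup>+\<delta>. ?w n k * (?a \<delta> + ?b k \<delta>) \<partial>count_space ?Z \<partial>count_space ?Z)"
      unfolding comm_bound_def by (rule nn_integral_count_space_nn_integral[OF countable_int_lattice]) simp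
    also have "\<dots> = (\<integral>\<^sup>+k. ?w n k * ((\<integral>\<^sup>+\<delta>. ?a \<delta> \<partial>count_space ?Z) + (\<integral>\<^sup>+\<delta>. ?b k \<delta> \<partial>count_space ?Z)) \<partial>count_space ?Z)"
      by (simp add: nn_integral_cmult nn_integral_add)
    also have "\<dots> \<le> (\<integral>\<^sup>+k. ?w n k * (ennreal c + ennreal c) \<partial>count_space ?Z)"
      by (intro nn_integral_mono mult_left_mono add_mono c) simp
    also have "\<dots> = (\<integral>\<^sup>+k. ?w n k \<partial>count_space ?Z) * (ennreal c + ennreal c)"
      by (rule nn_integral_multc) simp
    finally show ?thesis .
  qed
  have "(\<lambda>n. \<integral>\<^sup>+k. ?w n k \<partial>count_space ?Z) \<longlonglongrightarrow> (\<integral>\<^sup>+k. 0 \<partial>count_space ?Z)"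
  proof (rule nn_integral_dominated_convergence[where w=r])
    show "AE k in count_space ?Z. ?w n k \<le> r k" for n
    proof (rule AE_I2)
      show "?w n k \<le> r k" for k
        using mult_left_mono[of "ennreal (min 1 (norm (k /\<^sub>R real n)))" 1 "r k"] by simp
    qed
    show "AE k in count_space ?Z. (\<lambda>n. ?w n k) \<longlonglongrightarrow> 0"
    proof (rule AE_count_space[THEN iffD2], intro ballI)
      fix k assume k: "k \<in> ?Z"
      have "(\<lambda>n. norm (k /\<^sub>R real n)) \<longlonglongrightarrow> norm (0 *\<^sub>R k)"
        by (intro tendsto_intros lim_inverse_n)
      hence "(\<lambda>n. min 1 (norm (k /\<^sub>R real n))) \<longlonglongrightarrow> min 1 0" by (intro tendsto_intros) simp
      hence "(\<lambda>n. ennreal (min 1 (norm (k /\<^sub>R real n)))) \<longlonglongrightarrow> 0"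
        using tendsto_ennrealI by fastforce
      from ennreal_tendsto_cmult[OF rfin[OF k] this] show "(\<lambda>n. ?w n k) \<longlonglongrightarrow> 0" by simp
    qed
  qed (use r in auto)
  hence "(\<lambda>n. (ennreal c + ennreal c) * (\<integral>\<^sup>+k. ?w n k \<partial>count_space ?Z)) \<longlonglongrightarrow> (ennreal c + ennreal c) * 0"
    by (intro ennreal_tendsto_cmult) auto
  hence ev: "eventually (\<lambda>n. (ennreal c + ennreal c) * (\<integral>\<^sup>+k. ?w n k \<partial>count_space ?Z) < e) sequentially"
    using e by (intro order_tendstoD(2)) auto
  obtain n where n: "1 \<le> n" "(ennreal c + ennreal c) * (\<integral>\<^sup>+k. ?w n k \<partial>count_space ?Z) < e"
    using eventually_happens'[OF sequentially_bot eventually_conj[OF eventually_ge_at_top[of 1] ev]] by blast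
  have "(\<integral>\<^sup>+\<delta>. comm_bound (real n) r \<delta> \<partial>count_space ?Z) < e"
    by (rule order_le_less_trans[OF le]) (subst mult.commute, rule n(2))
  thus ?thesis using n(1) by blast
qed

text \<open>\<open>W\<close> is comparable to the weight, but grows by at most the factor \<open>min (exp (\<eta> |y|)) (\<nu> (n y))\<close>
  under a shift by \<open>y\<close>; for small \<open>\<eta>\<close> this factor is close to \<open>1\<close> where it matters.\<close>

definition W :: "nat \<Rightarrow> real \<Rightarrow> real ^ 'd \<Rightarrow> ennreal" where
  "W n \<eta> x = (SUP z\<in>int_lattice. V (real n *\<^sub>R (x + z)) * ennreal (exp (- \<eta> * norm z)))"

definition mu :: "nat \<Rightarrow> real \<Rightarrow> real ^ 'd \<Rightarrow> ennreal" where
  "mu n \<eta> y = min (ennreal (exp (\<eta> * norm y))) (V (real n *\<^sub>R y))"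

lemma V_le_W: "V (real n *\<^sub>R x) \<le> W n \<eta> x"
  unfolding W_def by (rule SUP_upper2[OF int_lattice_0]) simp

text \<open>The exponential factor comes from reindexing the supremum by y + z, which stays in the
  lattice; the factor \<open>V (real n *\<^sub>R y)\<close> comes from submultiplicativity.\<close>

lemma W_shift:
  assumes \<eta>: "0 \<le> \<eta>" and y: "y \<in> int_lattice"
  shows "W n \<eta> (x + y) \<le> W n \<eta> x * mu n \<eta> y"
proof -
  let ?Z = "int_lattice :: (real ^ 'd) set"
  have 1: "W n \<eta> (x + y) \<le> W n \<eta> x * ennreal (exp (\<eta> * norm y))"
    unfolding W_def[of n \<eta> "x + y"]
  proof (rule SUP_least)
    fix z assume z: "z \<in> ?Z"
    have "- \<eta> * norm z \<le> - \<eta> * norm (y + z) + \<eta> * norm y"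
      using mult_left_mono[OF norm_triangle_ineq[of y z] \<eta>] by (simp add: algebra_simps)
    hence "exp (- \<eta> * norm z) \<le> exp (- \<eta> * norm (y + z)) * exp (\<eta> * norm y)"
      by (simp add: exp_add[symmetric] del: exp_add)
    hence "V (real n *\<^sub>R (x + y + z)) * ennreal (exp (- \<eta> * norm z))
      \<le> V (real n *\<^sub>R (x + (y + z))) * (ennreal (exp (- \<eta> * norm (y + z))) * ennreal (exp (\<eta> * norm y)))"
      by (simp add: add.assoc ennreal_leI mult_left_mono flip: ennreal_mult)
    also have "\<dots> = (V (real n *\<^sub>R (x + (y + z))) * ennreal (exp (- \<eta> * norm (y + z)))) * ennreal (exp (\<eta> * norm y))"
      by (simp only: mult.assoc)
    also have "\<dots> \<le> W n \<eta> x * ennreal (exp (\<eta> * norm y))"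
      unfolding W_def by (intro mult_right_mono SUP_upper int_lattice_add y z) simp
    finally show "V (real n *\<^sub>R (x + y + z)) * ennreal (exp (- \<eta> * norm z)) \<le> W n \<eta> x * ennreal (exp (\<eta> * norm y))" .
  qed
  have 2: "W n \<eta> (x + y) \<le> W n \<eta> x * V (real n *\<^sub>R y)"
    unfolding W_def[of n \<eta> "x + y"]
  proof (rule SUP_least)
    fix z assume z: "z \<in> ?Z"
    have "V (real n *\<^sub>R (x + y + z)) \<le> V (real n *\<^sub>R (x + z)) * V (real n *\<^sub>R y)"
      using V_mult[of "real n *\<^sub>R (x + z)" "real n *\<^sub>R y"] by (simp add: algebra_simps)
    hence "V (real n *\<^sub>R (x + y + z)) * ennreal (exp (- \<eta> * norm z))
      \<le> (V (real n *\<^sub>R (x + z)) * V (real n *\<^sub>R y)) * ennreal (exp (- \<eta> * norm z))"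
      by (rule mult_right_mono) simp
    also have "\<dots> = (V (real n *\<^sub>R (x + z)) * ennreal (exp (- \<eta> * norm z))) * V (real n *\<^sub>R y)"
      by (simp only: mult_ac)
    also have "\<dots> \<le> W n \<eta> x * V (real n *\<^sub>R y)"
      unfolding W_def by (intro mult_right_mono SUP_upper z) simp
    finally show "V (real n *\<^sub>R (x + y + z)) * ennreal (exp (- \<eta> * norm z)) \<le> W n \<eta> x * V (real n *\<^sub>R y)" .
  qed
  show ?thesis using 1 2 by (simp add: mu_def min_def)
qed

text \<open>Here the GRS condition enters: along the lattice the weight grows at most like exp
  (\<eta> |z|), so the supremum defining \<open>W\<close> stays within a constant of the weight,
  however small \<eta> > 0 is.\<close>

lemma W_bound:
  assumes \<eta>: "0 < \<eta>"
  shows "\<exists>C. \<forall>x. W n \<eta> x \<le> V (real n *\<^sub>R x) * ennreal C"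
proof -
  obtain C where C: "C > 0" "\<And>z. z \<in> int_lattice \<Longrightarrow> \<nu> (real n *\<^sub>R z) \<le> C * exp (\<eta> * norm z)"
    using nu_exp_bound[OF \<eta>, of "real n"] by blast
  have "W n \<eta> x \<le> V (real n *\<^sub>R x) * ennreal C" for x
    unfolding W_def
  proof (rule SUP_least)
    fix z :: "real ^ 'd" assume z: "z \<in> int_lattice"
    have "\<nu> (real n *\<^sub>R z) * exp (- \<eta> * norm z) \<le> C * exp (\<eta> * norm z) * exp (- \<eta> * norm z)"
      by (intro mult_right_mono C z) simp
    also have "\<dots> = C" by (simp add: mult.assoc exp_add[symmetric] del: exp_add)
    finally have "V (real n *\<^sub>R z) * ennreal (exp (- \<eta> * norm z)) \<le> ennreal C"
      using nu_pos by (simp add: V_def ennreal_leI less_imp_le flip: ennreal_mult)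
    hence "V (real n *\<^sub>R x) * (V (real n *\<^sub>R z) * ennreal (exp (- \<eta> * norm z))) \<le> V (real n *\<^sub>R x) * ennreal C"
      by (rule mult_left_mono) simp
    moreover have "V (real n *\<^sub>R (x + z)) * ennreal (exp (- \<eta> * norm z))
      \<le> (V (real n *\<^sub>R x) * V (real n *\<^sub>R z)) * ennreal (exp (- \<eta> * norm z))"
      using V_mult[of "real n *\<^sub>R x" "real n *\<^sub>R z"]
      by (intro mult_right_mono) (simp_all add: scaleR_right_distrib)
    ultimately show "V (real n *\<^sub>R (x + z)) * ennreal (exp (- \<eta> * norm z)) \<le> V (real n *\<^sub>R x) * ennreal C"
      by (simp add: mult.assoc)
  qed
  thus ?thesis by blast
qed

text \<open>Each convolution with \<open>e\<close> multiplies the sum weighted by \<open>W\<close>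
  by at most the sum of \<open>e\<close> weighted by \<open>mu\<close>, the cost of a shift of
  \<open>W\<close>. So \<open>mu\<close> and not \<open>W\<close> determines the geometric
  ratio.\<close>

lemma conv_pow_weighted:
  assumes \<eta>: "0 \<le> \<eta>"
  shows "(\<integral>\<^sup>+\<delta>. conv_pow q e m \<delta> * W n \<eta> \<delta> \<partial>count_space int_lattice)
    \<le> (q + (\<integral>\<^sup>+\<beta>. e \<beta> * mu n \<eta> \<beta> \<partial>count_space int_lattice)) ^ m
      * (\<integral>\<^sup>+\<delta>. conv_pow q e 0 \<delta> * W n \<eta> \<delta> \<partial>count_space int_lattice)"
proof (induction m)
  case (Suc m)
  let ?Z = "int_lattice :: (real ^ 'd) set" and ?h = "conv_pow q e m" and ?W = "W n \<eta>"
  let ?S = "\<integral>\<^sup>+\<delta>. ?h \<delta> * ?W \<delta> \<partial>count_space ?Z"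
  let ?G = "\<integral>\<^sup>+\<beta>. e \<beta> * mu n \<eta> \<beta> \<partial>count_space ?Z"
  have "(\<integral>\<^sup>+\<delta>. (\<integral>\<^sup>+\<beta>. e \<beta> * ?h (\<delta> - \<beta>) \<partial>count_space ?Z) * ?W \<delta> \<partial>count_space ?Z)
    = (\<integral>\<^sup>+\<delta>. \<integral>\<^sup>+\<beta>. e \<beta> * ?h (\<delta> - \<beta>) * ?W \<delta> \<partial>count_space ?Z \<partial>count_space ?Z)"
    by (simp add: nn_integral_multc)
  also have "\<dots> = (\<integral>\<^sup>+\<beta>. \<integral>\<^sup>+\<delta>. e \<beta> * ?h (\<delta> - \<beta>) * ?W \<delta> \<partial>count_space ?Z \<partial>count_space ?Z)"
    by (rule nn_integral_count_space_nn_integral[OF countable_int_lattice]) simp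
  also have "\<dots> \<le> (\<integral>\<^sup>+\<beta>. \<integral>\<^sup>+\<delta>. (e \<beta> * mu n \<eta> \<beta>) * (?h (\<delta> - \<beta>) * ?W (\<delta> - \<beta>)) \<partial>count_space ?Z \<partial>count_space ?Z)"
  proof (intro nn_integral_mono)
    fix \<beta> \<delta> assume "\<beta> \<in> space (count_space ?Z)"
    hence "?W \<delta> \<le> ?W (\<delta> - \<beta>) * mu n \<eta> \<beta>" using W_shift[OF \<eta>, of \<beta> n "\<delta> - \<beta>"] by simp
    hence "e \<beta> * ?h (\<delta> - \<beta>) * ?W \<delta> \<le> e \<beta> * ?h (\<delta> - \<beta>) * (?W (\<delta> - \<beta>) * mu n \<eta> \<beta>)"
      by (rule mult_left_mono) simp
    thus "e \<beta> * ?h (\<delta> - \<beta>) * ?W \<delta> \<le> (e \<beta> * mu n \<eta> \<beta>) * (?h (\<delta> - \<beta>) * ?W (\<delta> - \<beta>))"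
      by (simp only: mult_ac)
  qed
  also have "\<dots> = (\<integral>\<^sup>+\<beta>. (e \<beta> * mu n \<eta> \<beta>) * (\<integral>\<^sup>+\<delta>. ?h (\<delta> - \<beta>) * ?W (\<delta> - \<beta>) \<partial>count_space ?Z) \<partial>count_space ?Z)"
    by (simp add: nn_integral_cmult)
  also have "\<dots> = (\<integral>\<^sup>+\<beta>. (e \<beta> * mu n \<eta> \<beta>) * ?S \<partial>count_space ?Z)"
  proof (intro nn_integral_cong)
    fix \<beta> assume "\<beta> \<in> space (count_space ?Z)"
    hence b: "\<beta> \<in> ?Z" by simp
    show "(e \<beta> * mu n \<eta> \<beta>) * (\<integral>\<^sup>+\<delta>. ?h (\<delta> - \<beta>) * ?W (\<delta> - \<beta>) \<partial>count_space ?Z) = (e \<beta> * mu n \<eta> \<beta>) * ?S"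
      unfolding nn_integral_lattice_shift(1)[OF b, of "\<lambda>x. ?h x * ?W x"] ..
  qed
  also have "\<dots> = ?G * ?S" by (rule nn_integral_multc) simp
  finally have "(\<integral>\<^sup>+\<delta>. (\<integral>\<^sup>+\<beta>. e \<beta> * ?h (\<delta> - \<beta>) \<partial>count_space ?Z) * ?W \<delta> \<partial>count_space ?Z) \<le> ?G * ?S" .
  hence "(\<integral>\<^sup>+\<delta>. conv_pow q e (Suc m) \<delta> * ?W \<delta> \<partial>count_space ?Z) \<le> q * ?S + ?G * ?S"
    by (simp add: distrib_right nn_integral_add mult.assoc nn_integral_cmult)
  also have "\<dots> = (q + ?G) * ?S" by (simp only: distrib_right)
  also have "\<dots> \<le> (q + ?G) * ((q + ?G) ^ m * (\<integral>\<^sup>+\<delta>. conv_pow q e 0 \<delta> * ?W \<delta> \<partial>count_space ?Z))"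
    by (intro mult_left_mono Suc) simp
  finally show ?case by (simp only: power_Suc mult.assoc)
qed simp

text \<open>Entries on side diagonal k connect cells whose difference lies within 2 d of k/n, so
  localized norms dominate \<open>diagN\<close>. The weight at k splits into that at n \<gamma> and
  that at k - n \<gamma>; the latter is summed over a ball that does not depend on m.\<close>

lemma cN_power_le:
  fixes \<pi> :: "'x \<Rightarrow> real ^ 'd"
  assumes n: "1 \<le> n" and supp: "supp \<pi> int_lattice R"
  shows "cN V (bn \<pi> (R ^ m)) \<le> ball_weight (2 * real CARD('d) * real n)
    * (\<integral>\<^sup>+\<delta>. conv_pow (ennreal (norm R)) (comm_bound (real n) (diagN (bn \<pi> R))) m \<delta> * W n \<eta> \<delta> \<partial>count_space int_lattice)"
proof -
  let ?Z = "int_lattice :: (real ^ 'd) set" and ?D = "2 * real CARD('d)"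
  let ?h = "conv_pow (ennreal (norm R)) (comm_bound (real n) (diagN (bn \<pi> R))) m"
  let ?f = "\<lambda>x. of_bool (norm x \<le> ?D * real n) * V x"
  have n0: "0 < real n" using n by simp
  have dg: "diagN (bn \<pi> (R ^ m)) k \<le> (\<integral>\<^sup>+\<gamma>. ?h \<gamma> * of_bool (norm (k /\<^sub>R real n - \<gamma>) \<le> ?D) \<partial>count_space ?Z)"
    if k: "k \<in> ?Z" for k
  proof (rule diagN_least[OF _ k])
    fix i j assume ij: "i \<in> ?Z" "j \<in> ?Z" "i - j = k"
    define b where "b = fl (i /\<^sub>R real n)"
    define g where "g = fl (j /\<^sub>R real n)"
    have bg: "b \<in> ?Z" "g \<in> ?Z" by (auto simp: b_def g_def fl_lattice)
    have fb: "norm (i /\<^sub>R real n - b) \<le> real CARD('d)" "norm (j /\<^sub>R real n - g) \<le> real CARD('d)"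
      unfolding b_def g_def by (rule norm_diff_fl)+
    \<comment> \<open>\<open>Psi\<close> is 1 on the fibre over i, and the fibre over j lies in the
      cell \<open>g\<close>; inserting both changes nothing.\<close>
    have "blk \<pi> (R ^ m) i j = Pr \<pi> i * (Psi \<pi> (real n) b * R ^ m * Chi \<pi> (real n) g) * Pr \<pi> j"
    proof (rule bmat_eqI)
      fix x y
      show "ent (blk \<pi> (R ^ m) i j) x y = ent (Pr \<pi> i * (Psi \<pi> (real n) b * R ^ m * Chi \<pi> (real n) g) * Pr \<pi> j) x y"
        unfolding ent_blk ent_Pr_mult ent_Chi_mult ent_Psi_mult
        using psi_eq_1[OF fb(1)] by (auto simp: g_def)
    qed
    hence "norm (blk \<pi> (R ^ m) i j) \<le> norm (Psi \<pi> (real n) b * R ^ m * Chi \<pi> (real n) g)"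
      by (metis norm_Pr_mult order_trans)
    hence "bn \<pi> (R ^ m) i j \<le> ?h (b - g)"
      unfolding bn_def[of _ "R ^ m" i j] using norm_localized_power_le[OF supp bg(2) bg(1), of "real n" m]
      by (meson ennreal_leI order_trans)
    also have "\<dots> = ?h (b - g) * of_bool (norm (k /\<^sub>R real n - (b - g)) \<le> ?D)"
    proof -
      have "norm ((i /\<^sub>R real n - b) - (j /\<^sub>R real n - g)) \<le> ?D"
        using norm_triangle_ineq4[of "i /\<^sub>R real n - b" "j /\<^sub>R real n - g"] fb by linarith
      moreover have "(i /\<^sub>R real n - b) - (j /\<^sub>R real n - g) = k /\<^sub>R real n - (b - g)"
        by (simp add: ij(3)[symmetric] algebra_simps)
      ultimately show ?thesis by simp
    qed
    also have "\<dots> \<le> (\<integral>\<^sup>+\<gamma>. ?h \<gamma> * of_bool (norm (k /\<^sub>R real n - \<gamma>) \<le> ?D) \<partial>count_space ?Z)"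
      by (rule nn_integral_ge_point[where p="\<lambda>\<gamma>. ?h \<gamma> * of_bool (norm (k /\<^sub>R real n - \<gamma>) \<le> ?D)"])
        (rule int_lattice_diff[OF bg])
    finally show "bn \<pi> (R ^ m) i j \<le> (\<integral>\<^sup>+\<gamma>. ?h \<gamma> * of_bool (norm (k /\<^sub>R real n - \<gamma>) \<le> ?D) \<partial>count_space ?Z)" .
  qed
  have "cN V (bn \<pi> (R ^ m)) \<le> (\<integral>\<^sup>+k. (\<integral>\<^sup>+\<gamma>. ?h \<gamma> * of_bool (norm (k /\<^sub>R real n - \<gamma>) \<le> ?D) \<partial>count_space ?Z) * V k \<partial>count_space ?Z)"
    unfolding cN_def by (intro nn_integral_mono mult_right_mono dg) auto
  also have "\<dots> = (\<integral>\<^sup>+k. \<integral>\<^sup>+\<gamma>. ?h \<gamma> * of_bool (norm (k /\<^sub>R real n - \<gamma>) \<le> ?D) * V k \<partial>count_space ?Z \<partial>count_space ?Z)"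
    by (simp add: nn_integral_multc)
  also have "\<dots> = (\<integral>\<^sup>+\<gamma>. \<integral>\<^sup>+k. ?h \<gamma> * of_bool (norm (k /\<^sub>R real n - \<gamma>) \<le> ?D) * V k \<partial>count_space ?Z \<partial>count_space ?Z)"
    by (rule nn_integral_count_space_nn_integral[OF countable_int_lattice]) simp
  also have "\<dots> \<le> (\<integral>\<^sup>+\<gamma>. \<integral>\<^sup>+k. (?h \<gamma> * W n \<eta> \<gamma>) * ?f (k - real n *\<^sub>R \<gamma>) \<partial>count_space ?Z \<partial>count_space ?Z)"
  proof (intro nn_integral_mono)
    fix \<gamma> k :: "real ^ 'd"
    have "k - real n *\<^sub>R \<gamma> = real n *\<^sub>R (k /\<^sub>R real n - \<gamma>)"
      using n0 by (simp add: scaleR_right_diff_distrib)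
    hence "norm (k - real n *\<^sub>R \<gamma>) = real n * norm (k /\<^sub>R real n - \<gamma>)" by simp
    hence eq: "norm (k /\<^sub>R real n - \<gamma>) \<le> ?D \<longleftrightarrow> norm (k - real n *\<^sub>R \<gamma>) \<le> ?D * real n"
      using n0 by (simp add: mult.commute[of "real n"])
    have "V k \<le> V (real n *\<^sub>R \<gamma>) * V (k - real n *\<^sub>R \<gamma>)"
      using V_mult[of "real n *\<^sub>R \<gamma>" "k - real n *\<^sub>R \<gamma>"] by simp
    also have "\<dots> \<le> W n \<eta> \<gamma> * V (k - real n *\<^sub>R \<gamma>)" by (intro mult_right_mono V_le_W) simp
    finally have "?h \<gamma> * of_bool (norm (k - real n *\<^sub>R \<gamma>) \<le> ?D * real n) * V k
      \<le> ?h \<gamma> * of_bool (norm (k - real n *\<^sub>R \<gamma>) \<le> ?D * real n) * (W n \<eta> \<gamma> * V (k - real n *\<^sub>R \<gamma>))"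
      by (rule mult_left_mono) simp
    thus "?h \<gamma> * of_bool (norm (k /\<^sub>R real n - \<gamma>) \<le> ?D) * V k \<le> (?h \<gamma> * W n \<eta> \<gamma>) * ?f (k - real n *\<^sub>R \<gamma>)"
      unfolding eq by (simp only: mult_ac)
  qed
  also have "\<dots> = (\<integral>\<^sup>+\<gamma>. (?h \<gamma> * W n \<eta> \<gamma>) * (\<integral>\<^sup>+k. ?f (k - real n *\<^sub>R \<gamma>) \<partial>count_space ?Z) \<partial>count_space ?Z)"
    by (intro nn_integral_cong nn_integral_cmult) simp
  also have "\<dots> = (\<integral>\<^sup>+\<gamma>. (?h \<gamma> * W n \<eta> \<gamma>) * ball_weight (?D * real n) \<partial>count_space ?Z)"
  proof (intro nn_integral_cong)
    fix \<gamma> assume "\<gamma> \<in> space (count_space ?Z)"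
    hence g: "real n *\<^sub>R \<gamma> \<in> ?Z" by (simp add: int_lattice_scale)
    show "(?h \<gamma> * W n \<eta> \<gamma>) * (\<integral>\<^sup>+k. ?f (k - real n *\<^sub>R \<gamma>) \<partial>count_space ?Z) = (?h \<gamma> * W n \<eta> \<gamma>) * ball_weight (?D * real n)"
      unfolding ball_weight_def nn_integral_lattice_shift(1)[OF g, of ?f] ..
  qed
  also have "\<dots> = (\<integral>\<^sup>+\<gamma>. ?h \<gamma> * W n \<eta> \<gamma> \<partial>count_space ?Z) * ball_weight (?D * real n)"
    by (rule nn_integral_multc) simp
  finally show ?thesis by (simp only: mult.commute)
qed

text \<open>The order of choices matters: \<open>n\<close> comes first and makes the unweighted
  commutator mass small; then \<eta>, depending on \<open>n\<close>, keeps the mass weighted by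
  \<open>mu\<close> small. The remaining constants depend on both but not on the power m, so the
  ratio (1 + q)/2 < 1 prevails.\<close>

lemma sjostrand_spectral: "matrix_norm.spectral (cN V) int_lattice \<pi>"
proof -
  interpret matrix_norm "cN V" int_lattice 1 by (rule matrix_norm_V)
  let ?Z = "int_lattice :: (real ^ 'd) set"
  show ?thesis
    unfolding spectral_def
  proof (intro allI impI)
    fix R and e :: ennreal
    assume R: "norm R < 1" "supp \<pi> ?Z R" "cN V (bn \<pi> R) < \<infinity>" and e: "0 < e"
    define r where "r = diagN (bn \<pi> R)"
    define q where "q = norm R"
    have q: "0 \<le> q" "q < 1" using R(1) by (auto simp: q_def)
    have rV: "(\<integral>\<^sup>+k. r k * V k \<partial>count_space ?Z) < \<infinity>" using R(3) by (simp add: cN_def r_def)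
    have r1: "(\<integral>\<^sup>+k. r k \<partial>count_space ?Z) < \<infinity>"
    proof (rule order_le_less_trans[OF nn_integral_mono rV])
      fix k show "r k \<le> r k * V k" using mult_left_mono[OF V_ge_1[of k], of "r k"] by simp
    qed
    have rfin: "r k < top" if "k \<in> ?Z" for k
    proof -
      have "r k \<le> ennreal (norm R)" unfolding r_def by (rule diagN_least[OF _ that]) (rule bn_le_norm)
      thus ?thesis by (simp add: order_le_less_trans)
    qed
    obtain n where n: "1 \<le> n" "(\<integral>\<^sup>+\<delta>. comm_bound (real n) r \<delta> \<partial>count_space ?Z) < ennreal ((1 - q) / 2)"
      using comm_bound_small[OF r1 rfin, of "ennreal ((1 - q) / 2)"] q by auto
    let ?e = "comm_bound (real n) r"
    have eV: "(\<integral>\<^sup>+\<delta>. ?e \<delta> * V (real n *\<^sub>R \<delta>) \<partial>count_space ?Z) < \<infinity>" by (rule comm_bound_weighted_finite[OF n(1) rV])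
    have efin: "?e \<delta> < top" if "\<delta> \<in> ?Z" for \<delta>
    proof -
      have "?e \<delta> \<le> (\<integral>\<^sup>+\<delta>. ?e \<delta> \<partial>count_space ?Z)" by (rule nn_integral_ge_point[OF that])
      also have "\<dots> < top" using n(2) ennreal_less_top order_less_trans by blast
      finally show ?thesis .
    qed
    \<comment> \<open>As \<eta> tends to 0, \<open>mu\<close> tends to the minimum of 1 and the
      weight, which is 1 because the weight is at least 1.\<close>
    have "(\<lambda>p. \<integral>\<^sup>+\<delta>. ?e \<delta> * mu n (1 / real (Suc p)) \<delta> \<partial>count_space ?Z) \<longlonglongrightarrow> (\<integral>\<^sup>+\<delta>. ?e \<delta> \<partial>count_space ?Z)"
    proof (rule nn_integral_dominated_convergence[where w="\<lambda>\<delta>. ?e \<delta> * V (real n *\<^sub>R \<delta>)"])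
      show "AE \<delta> in count_space ?Z. ?e \<delta> * mu n (1 / real (Suc p)) \<delta> \<le> ?e \<delta> * V (real n *\<^sub>R \<delta>)" for p
        by (intro AE_I2 mult_left_mono) (auto simp: mu_def)
      show "AE \<delta> in count_space ?Z. (\<lambda>p. ?e \<delta> * mu n (1 / real (Suc p)) \<delta>) \<longlonglongrightarrow> ?e \<delta>"
      proof (rule AE_count_space[THEN iffD2], intro ballI)
        fix \<delta> assume d: "\<delta> \<in> ?Z"
        have "(\<lambda>p. inverse (real (Suc p)) * norm \<delta>) \<longlonglongrightarrow> 0 * norm \<delta>"
          by (intro tendsto_intros LIMSEQ_inverse_real_of_nat)
        hence "(\<lambda>p. exp (1 / real (Suc p) * norm \<delta>)) \<longlonglongrightarrow> exp 0"
          by (intro tendsto_exp) (simp add: inverse_eq_divide)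
        hence "(\<lambda>p. ennreal (exp (1 / real (Suc p) * norm \<delta>))) \<longlonglongrightarrow> 1"
          using tendsto_ennrealI by fastforce
        hence "(\<lambda>p. mu n (1 / real (Suc p)) \<delta>) \<longlonglongrightarrow> min 1 (V (real n *\<^sub>R \<delta>))"
          unfolding mu_def by (intro tendsto_min tendsto_const)
        hence "(\<lambda>p. mu n (1 / real (Suc p)) \<delta>) \<longlonglongrightarrow> 1"
          using V_ge_1[of "real n *\<^sub>R \<delta>"] by (simp add: min_absorb1)
        from ennreal_tendsto_cmult[OF efin[OF d] this]
        show "(\<lambda>p. ?e \<delta> * mu n (1 / real (Suc p)) \<delta>) \<longlonglongrightarrow> ?e \<delta>" by simp
      qed
    qed (use eV in auto)
    hence "eventually (\<lambda>p. (\<integral>\<^sup>+\<delta>. ?e \<delta> * mu n (1 / real (Suc p)) \<delta> \<partial>count_space ?Z) < ennreal ((1 - q) / 2)) sequentially"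
      by (rule order_tendstoD(2)) (rule n(2))
    then obtain p where p: "(\<integral>\<^sup>+\<delta>. ?e \<delta> * mu n (1 / real (Suc p)) \<delta> \<partial>count_space ?Z) < ennreal ((1 - q) / 2)"
      using eventually_happens'[OF sequentially_bot] by blast
    define \<eta> where "\<eta> = 1 / real (Suc p)"
    have \<eta>: "0 < \<eta>" by (simp add: \<eta>_def)
    let ?\<rho> = "ennreal q + (\<integral>\<^sup>+\<delta>. ?e \<delta> * mu n \<eta> \<delta> \<partial>count_space ?Z)"
    have "?\<rho> \<le> ennreal q + ennreal ((1 - q) / 2)"
      using p unfolding \<eta>_def by (intro add_left_mono) simp
    also have "\<dots> = ennreal ((1 + q) / 2)"
      using q by (simp add: field_simps flip: ennreal_plus)
    finally have \<rho>: "?\<rho> \<le> ennreal ((1 + q) / 2)" .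
    let ?S = "\<integral>\<^sup>+\<delta>. conv_pow (ennreal q) ?e 0 \<delta> * W n \<eta> \<delta> \<partial>count_space ?Z"
    let ?G = "ball_weight (2 * real CARD('d) * real n)"
    have S: "?S < \<infinity>"
    proof -
      obtain C where C: "\<And>x. W n \<eta> x \<le> V (real n *\<^sub>R x) * ennreal C" using W_bound[OF \<eta>] by blast
      have "?S \<le> (\<integral>\<^sup>+\<delta>. (of_bool (norm (0 - \<delta>) \<le> 3 * real CARD('d)) * V (real n *\<^sub>R \<delta>)) * ennreal C \<partial>count_space ?Z)"
      proof (intro nn_integral_mono)
        fix \<delta>
        have "of_bool (norm (0 - \<delta>) \<le> 3 * real CARD('d)) * W n \<eta> \<delta>
          \<le> of_bool (norm (0 - \<delta>) \<le> 3 * real CARD('d)) * (V (real n *\<^sub>R \<delta>) * ennreal C)"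
          by (rule mult_left_mono[OF C]) simp
        thus "conv_pow (ennreal q) ?e 0 \<delta> * W n \<eta> \<delta>
          \<le> (of_bool (norm (0 - \<delta>) \<le> 3 * real CARD('d)) * V (real n *\<^sub>R \<delta>)) * ennreal C"
          by (simp only: conv_pow.simps mult.assoc)
      qed
      also have "\<dots> = (\<integral>\<^sup>+\<delta>. of_bool (norm (0 - \<delta>) \<le> 3 * real CARD('d)) * V (real n *\<^sub>R \<delta>) \<partial>count_space ?Z) * ennreal C"
        by (rule nn_integral_multc) simp
      also have "\<dots> \<le> (V 0 * ball_weight (3 * real CARD('d) * real n)) * ennreal C"
        by (intro mult_right_mono coarse_ball_0 n) simp
      also have "\<dots> < \<infinity>" using V_fin ball_weight_finite by (simp add: ennreal_mult_less_top)
      finally show ?thesis .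
    qed
    have le: "cN V (bn \<pi> (R ^ m)) \<le> ?G * ?S * ennreal ((1 + q) / 2) ^ m" for m
    proof -
      have "cN V (bn \<pi> (R ^ m)) \<le> ?G * (\<integral>\<^sup>+\<delta>. conv_pow (ennreal q) ?e m \<delta> * W n \<eta> \<delta> \<partial>count_space ?Z)"
        unfolding q_def r_def by (rule cN_power_le[OF n(1) R(2)])
      also have "\<dots> \<le> ?G * (?\<rho> ^ m * ?S)"
        using \<eta> by (intro mult_left_mono conv_pow_weighted) auto
      also have "\<dots> \<le> ?G * (ennreal ((1 + q) / 2) ^ m * ?S)"
        by (intro mult_left_mono mult_right_mono power_mono \<rho>) auto
      finally show ?thesis by (simp only: mult_ac)
    qed
    have "?G * ?S < top" using S ball_weight_finite by (simp add: ennreal_mult_less_top)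
    then have lim: "(\<lambda>m. ?G * ?S * ennreal ((1 + q) / 2) ^ m) \<longlonglongrightarrow> ?G * ?S * 0"
    proof (rule ennreal_tendsto_cmult)
      have "(\<lambda>m. ((1 + q) / 2) ^ m) \<longlonglongrightarrow> 0" using q by (intro LIMSEQ_power_zero) auto
      hence "(\<lambda>m. ennreal (((1 + q) / 2) ^ m)) \<longlonglongrightarrow> 0" using tendsto_ennrealI by fastforce
      thus "(\<lambda>m. ennreal ((1 + q) / 2) ^ m) \<longlonglongrightarrow> 0" using q by (simp add: ennreal_power)
    qed
    have ev: "eventually (\<lambda>m. ?G * ?S * ennreal ((1 + q) / 2) ^ m < e) sequentially"
      by (rule order_tendstoD(2)[OF lim]) (use e in simp)
    obtain m where "1 \<le> m" "?G * ?S * ennreal ((1 + q) / 2) ^ m < e"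
      using eventually_happens'[OF sequentially_bot eventually_conj[OF eventually_ge_at_top[of 1] ev]] by blast
    thus "\<exists>m\<ge>1. cN V (bn \<pi> (R ^ m)) < e" using le[of m] order_le_less_trans by blast
  qed
qed

end

section \<open>Operators on \<open>ell2 I\<close> and their matrices\<close>

lemma ell2_iff: "c \<in> ell2 I \<longleftrightarrow> (\<forall>x. x \<notin> I \<longrightarrow> c x = 0) \<and> l2 c"
proof -
  have "(\<lambda>x. (cmod (c x))\<^sup>2) summable_on I \<longleftrightarrow> l2 c" if "\<forall>x. x \<notin> I \<longrightarrow> c x = 0"
    unfolding l2_def using that by (intro summable_on_cong_neutral) auto
  thus ?thesis unfolding ell2_def by blast
qed

lemma ell2_norm_eq: "c \<in> ell2 I \<Longrightarrow> ell2_norm I c = l2n c"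
  unfolding ell2_norm_def ell2_def by (intro arg_cong[where f=sqrt] infsum_cong_neutral) auto

lemma ell2_ident: "(\<lambda>x. of_bool (x = y)) \<in> ell2 I" if "y \<in> I"
proof -
  have "(\<lambda>x. of_bool (x = y)) = (\<lambda>x. if x \<in> {y} then 1 else (0 :: complex))" by auto
  moreover have "l2 \<dots>" by (rule l2_finite) simp
  ultimately show ?thesis using that by (auto simp: ell2_iff)
qed

lemma bounded_op_zero:
  assumes "bounded_op_on I S"
  shows "S (\<lambda>x. 0) = (\<lambda>x. 0)"
proof -
  have z: "(\<lambda>x. 0) \<in> ell2 I" using l2_finite(1)[of "{}"] by (simp add: ell2_iff)
  have "S (\<lambda>x. a * c x + c' x) = (\<lambda>x. a * S c x + S c' x)" if "c \<in> ell2 I" "c' \<in> ell2 I" for a c c'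
    using assms that unfolding bounded_op_on_def by blast
  from this[OF z z, of 1] show ?thesis by (simp add: fun_eq_iff)
qed

text \<open>The columns are the images of the unit vectors. Linearity gives the formula for finitely
  supported sequences, which bounds the finite sections; the tail estimate then extends it to all of
  \<open>ell2 I\<close>.\<close>

lemma bounded_op_matrix:
  assumes S: "bounded_op_on I S"
  shows "\<exists>Y. (\<forall>c\<in>ell2 I. S c = app (ent Y) c) \<and> (\<forall>x y. ent Y x y \<noteq> 0 \<longrightarrow> x \<in> I \<and> y \<in> I)"
proof -
  have lin: "S (\<lambda>x. a * c x + c' x) = (\<lambda>x. a * S c x + S c' x)" if "c \<in> ell2 I" "c' \<in> ell2 I" for a c c'
    using S that unfolding bounded_op_on_def by blast
  have cl: "S c \<in> ell2 I" if "c \<in> ell2 I" for c using S that unfolding bounded_op_on_def by blast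
  obtain K0 where K0: "\<And>c. c \<in> ell2 I \<Longrightarrow> ell2_norm I (S c) \<le> K0 * ell2_norm I c"
    using S unfolding bounded_op_on_def by blast
  define K where "K = max K0 0"
  have K: "l2n (S c) \<le> K * l2n c" "0 \<le> K" if "c \<in> ell2 I" for c
  proof -
    have "l2n (S c) \<le> K0 * l2n c"
      using K0[OF that] unfolding ell2_norm_eq[OF that] ell2_norm_eq[OF cl[OF that]] .
    also have "\<dots> \<le> K * l2n c" by (intro mult_right_mono l2n_nonneg) (simp add: K_def)
    finally show "l2n (S c) \<le> K * l2n c" .
  qed (simp add: K_def)
  define e where "e y = (\<lambda>x. of_bool (x = y) :: complex)" for y :: 'a
  have e: "e y \<in> ell2 I" if "y \<in> I" for y unfolding e_def using that by (rule ell2_ident)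
  \<comment> \<open>\<open>S\<close> is controlled only on \<open>ell2 I\<close>, to which unit
    vectors outside \<open>I\<close> do not belong; those columns are set to 0.\<close>
  define M where "M x y = (if y \<in> I then S (e y) x else 0)" for x y
  have fin: "(\<lambda>x. if x \<in> F then c x else 0) \<in> ell2 I
      \<and> S (\<lambda>x. if x \<in> F then c x else 0) = (\<lambda>x. \<Sum>y\<in>F. M x y * c y)"
    if "finite F" "F \<subseteq> I" for F c
    using that
  proof (induction F rule: finite_induct)
    case empty
    have "(\<lambda>x. 0) \<in> ell2 I" using l2_finite(1)[of "{}"] by (simp add: ell2_iff)
    thus ?case by (simp add: bounded_op_zero[OF S])
  next
    case (insert z F)
    have z: "z \<in> I" using insert by simp
    have eq: "(\<lambda>x. if x \<in> insert z F then c x else 0) = (\<lambda>x. c z * e z x + (if x \<in> F then c x else 0))"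
      using insert(2) by (auto simp: e_def fun_eq_iff)
    have IH: "(\<lambda>x. if x \<in> F then c x else 0) \<in> ell2 I"
      "S (\<lambda>x. if x \<in> F then c x else 0) = (\<lambda>x. \<Sum>y\<in>F. M x y * c y)" using insert by auto
    have "S (\<lambda>x. if x \<in> insert z F then c x else 0) = (\<lambda>x. c z * S (e z) x + (\<Sum>y\<in>F. M x y * c y))"
      unfolding eq lin[OF e[OF z] IH(1)] IH(2) ..
    hence "S (\<lambda>x. if x \<in> insert z F then c x else 0) = (\<lambda>x. \<Sum>y\<in>insert z F. M x y * c y)"
      using insert z by (simp add: M_def fun_eq_iff)
    moreover have "(\<lambda>x. if x \<in> insert z F then c x else 0) \<in> ell2 I"
      using insert by (auto simp: ell2_iff intro!: l2_finite(1)[of "insert z F" c, simplified])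
    ultimately show ?case by blast
  qed
  have finU: "(\<Sum>y\<in>F. M x y * c y) = (\<Sum>y\<in>F \<inter> I. M x y * c y)" if "finite F" for F x c
    using that by (intro sum.mono_neutral_right) (auto simp: M_def)
  have "mbd K M"
    unfolding mbd_def
  proof (intro conjI allI impI)
    show "0 \<le> K" by (simp add: K_def)
    fix F G :: "'a set" and c d :: "'a \<Rightarrow> complex"
    assume FG: "finite F" "finite G"
    let ?c = "\<lambda>x. if x \<in> G \<inter> I then c x else 0"
    have c: "?c \<in> ell2 I" "S ?c = (\<lambda>x. \<Sum>y\<in>G \<inter> I. M x y * c y)" using fin[of "G \<inter> I" c] FG by auto
    have "(\<Sum>x\<in>F. \<Sum>y\<in>G. d x * M x y * c y) = (\<Sum>x\<in>F. d x * S ?c x)"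
      unfolding c(2) by (simp add: sum_distrib_left mult.assoc flip: finU[OF FG(2)])
    also have "cmod \<dots> \<le> (\<Sum>x\<in>F. \<bar>cmod (d x)\<bar> * \<bar>cmod (S ?c x)\<bar>)"
      by (intro sum_norm_le) (simp add: norm_mult)
    also have "\<dots> \<le> L2_set (\<lambda>x. cmod (d x)) F * L2_set (\<lambda>x. cmod (S ?c x)) F"
      by (rule L2_set_mult_ineq)
    also have "\<dots> \<le> L2_set (\<lambda>x. cmod (d x)) F * (K * L2_set (\<lambda>y. cmod (c y)) G)"
    proof (intro mult_left_mono L2_set_nonneg)
      have "L2_set (\<lambda>x. cmod (S ?c x)) F \<le> l2n (S ?c)"
        using cl[OF c(1)] FG by (intro L2_set_le_l2n) (auto simp: ell2_iff)
      also have "\<dots> \<le> K * l2n ?c" by (rule K[OF c(1)])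
      also have "l2n ?c = L2_set (\<lambda>y. cmod (c y)) (G \<inter> I)" using FG by (intro l2_finite) auto
      also have "\<dots> \<le> L2_set (\<lambda>y. cmod (c y)) G"
        unfolding L2_set_def using FG by (intro real_sqrt_le_mono sum_mono2) auto
      finally show "L2_set (\<lambda>x. cmod (S ?c x)) F \<le> K * L2_set (\<lambda>y. cmod (c y)) G"
        by (simp add: K_def mult_left_mono)
    qed
    finally show "cmod (\<Sum>x\<in>F. \<Sum>y\<in>G. d x * M x y * c y)
       \<le> K * L2_set (\<lambda>x. cmod (d x)) F * L2_set (\<lambda>y. cmod (c y)) G" by (simp add: mult_ac)
  qed
  note mbd = this
  have "S c = app M c" if c: "c \<in> ell2 I" for c
  proof
    fix x
    let ?T = "finite_subsets_at_top (UNIV :: 'a set)"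
    let ?t = "\<lambda>F x. if x \<in> F then 0 else c x"
    have l2c: "l2 c" using c by (simp add: ell2_iff)
    have 1: "((\<lambda>F. \<Sum>y\<in>F. M x y * c y) \<longlongrightarrow> app M c x) ?T"
      unfolding app_def by (intro infsum_tendsto l2_summable mbd_row[OF mbd] l2c)
    have le: "cmod (S c x - (\<Sum>y\<in>F. M x y * c y)) \<le> K * l2n (?t F)" if F: "finite F" for F
    proof -
      let ?c = "\<lambda>x. if x \<in> F \<inter> I then c x else 0"
      have cF: "?c \<in> ell2 I" "S ?c = (\<lambda>x. \<Sum>y\<in>F \<inter> I. M x y * c y)" using fin[of "F \<inter> I" c] F by auto
      have t: "?t F \<in> ell2 I" using c l2_if_not[OF l2c] by (auto simp: ell2_iff)
      have "c = (\<lambda>x. 1 * ?c x + ?t F x)" using c by (auto simp: ell2_iff)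
      hence "S c = (\<lambda>x. 1 * S ?c x + S (?t F) x)" using lin[OF cF(1) t, of 1] by metis
      hence "S c x = 1 * S ?c x + S (?t F) x" by (rule fun_cong)
      hence "S c x = S ?c x + S (?t F) x" by (simp only: mult_1)
      moreover have "S ?c x = (\<Sum>y\<in>F. M x y * c y)" unfolding finU[OF F] using cF(2) by (rule fun_cong)
      ultimately have "S c x - (\<Sum>y\<in>F. M x y * c y) = S (?t F) x"
        by (simp only: add_diff_cancel_left')
      also have "cmod \<dots> \<le> l2n (S (?t F))"
        using L2_set_le_l2n[of "S (?t F)" "{x}"] cl[OF t] by (simp add: ell2_iff)
      also have "\<dots> \<le> K * l2n (?t F)" by (rule K[OF t])
      finally show ?thesis .
    qed
    have "((\<lambda>F. K * l2n (?t F)) \<longlongrightarrow> K * 0) ?T" by (intro tendsto_intros l2n_tail l2c)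
    hence lim0: "((\<lambda>F. K * l2n (?t F)) \<longlongrightarrow> 0) ?T" by simp
    have "((\<lambda>F. S c x - (\<Sum>y\<in>F. M x y * c y)) \<longlongrightarrow> 0) ?T"
      by (rule Lim_null_comparison[OF eventually_finite_subsets_at_top_weakI lim0], rule le)
    moreover have "((\<lambda>F. S c x - (\<Sum>y\<in>F. M x y * c y)) \<longlongrightarrow> S c x - app M c x) ?T"
      by (intro tendsto_intros 1)
    ultimately have "S c x - app M c x = 0"
      by (intro tendsto_unique[OF finite_subsets_at_top_neq_bot])
    thus "S c x = app M c x" by simp
  qed
  moreover have "M x y \<noteq> 0 \<Longrightarrow> x \<in> I \<and> y \<in> I" for x y
    using cl[OF e, of y] by (auto simp: M_def ell2_iff split: if_splits)
  moreover have "ent (Abs_bmat M) = M" using mbd by (intro Abs_bmat_inverse) auto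
  ultimately show ?thesis by (intro exI[of _ "Abs_bmat M"]) auto
qed

lemma bounded_op_app:
  assumes "\<And>x y. ent Y x y \<noteq> 0 \<Longrightarrow> x \<in> I \<and> y \<in> I"
  shows "bounded_op_on I (app (ent Y))"
  unfolding bounded_op_on_def
proof (intro conjI ballI allI)
  have cl: "app (ent Y) c \<in> ell2 I" if "c \<in> ell2 I" for c
  proof -
    have "app (ent Y) c x = 0" if "x \<notin> I" for x
    proof -
      have "ent Y x y = 0" for y using assms[of x y] that by blast
      thus ?thesis by (simp add: app_def)
    qed
    thus ?thesis using mbd_app(1)[OF mbd_norm] that by (auto simp: ell2_iff)
  qed
  thus "c \<in> ell2 I \<Longrightarrow> app (ent Y) c \<in> ell2 I" for c .
  show "app (ent Y) (\<lambda>x. a * c x + c' x) = (\<lambda>x. a * app (ent Y) c x + app (ent Y) c' x)"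
    if "c \<in> ell2 I" "c' \<in> ell2 I" for c c' a
    using that by (intro app_add[OF mbd_norm]) (auto simp: ell2_iff)
  have "ell2_norm I (app (ent Y) c) \<le> norm Y * ell2_norm I c" if "c \<in> ell2 I" for c
    unfolding ell2_norm_eq[OF that] ell2_norm_eq[OF cl[OF that]]
    by (rule mbd_app(2)[OF mbd_norm]) (use that in \<open>simp add: ell2_iff\<close>)
  thus "\<exists>K. \<forall>c\<in>ell2 I. ell2_norm I (app (ent Y) c) \<le> K * ell2_norm I c" by blast
qed

definition restr :: "'a set \<Rightarrow> ('a \<Rightarrow> 'a \<Rightarrow> complex) \<Rightarrow> 'a \<Rightarrow> 'a \<Rightarrow> complex" where
  "restr I M x y = (if x \<in> I \<and> y \<in> I then M x y else 0)"

lemma matrix_op_eq_app: "matrix_op I M c = app (restr I M) c"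
proof
  fix x
  have "(\<Sum>\<^sub>\<infinity>y\<in>I. M x y * c y) = (\<Sum>\<^sub>\<infinity>y. restr I M x y * c y)" if "x \<in> I"
    by (rule infsum_cong_neutral) (auto simp: restr_def that)
  thus "matrix_op I M c x = app (restr I M) c x"
    by (auto simp: matrix_op_def app_def restr_def)
qed

text \<open>A sequence is cut off to \<open>I\<close>, which does not change its image, and then
  scaled into the unit ball. The second and third claims together identify the operator norm of the
  definitions with the least bound on finite sections.\<close>

lemma matrix_bounded_mbd:
  assumes "mbd K (restr I M)"
  shows "matrix_bounded I M" "op_norm_on I (matrix_op I M) \<le> K" "mbd (op_norm_on I (matrix_op I M)) (restr I M)"
proof -
  have "restr I M \<in> {M. \<exists>K. mbd K M}" using assms by blast
  then obtain Y where Y: "ent Y = restr I M" using Abs_bmat_inverse by blast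
  have mo: "matrix_op I M = app (ent Y)" by (rule ext) (simp add: matrix_op_eq_app Y)
  have bo: "bounded_op_on I (matrix_op I M)"
    unfolding mo by (rule bounded_op_app) (auto simp: Y restr_def split: if_splits)
  have sm: "(\<lambda>l. M k l * c l) summable_on I" if c: "c \<in> ell2 I" and k: "k \<in> I" for c k
  proof -
    have "(\<lambda>l. ent Y k l * c l) summable_on UNIV" using c by (intro l2_summable l2_ent) (simp add: ell2_iff)
    moreover have "(\<lambda>l. ent Y k l * c l) summable_on UNIV \<longleftrightarrow> (\<lambda>l. M k l * c l) summable_on I"
      by (rule summable_on_cong_neutral) (auto simp: Y restr_def k)
    ultimately show ?thesis by blast
  qed
  show "matrix_bounded I M" unfolding matrix_bounded_def using bo sm by blast
  let ?T = "app (ent Y)"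
  have cl: "?T c \<in> ell2 I" if "c \<in> ell2 I" for c using bo that unfolding mo bounded_op_on_def by blast
  have le: "ell2_norm I (?T c) \<le> K" if "c \<in> ell2 I" "ell2_norm I c \<le> 1" for c
  proof -
    have "l2n (?T c) \<le> K * l2n c"
      using mbd_app(2)[OF assms] that(1) by (simp add: Y ell2_iff)
    also have "\<dots> \<le> K * 1" using that mbd_nonneg[OF assms] by (intro mult_left_mono) (simp_all add: ell2_norm_eq[OF that(1), symmetric])
    finally show ?thesis unfolding ell2_norm_eq[OF cl[OF that(1)]] by simp
  qed
  have z: "(\<lambda>x. 0) \<in> ell2 I" using l2_finite(1)[of "{}"] by (simp add: ell2_iff)
  have zn: "ell2_norm I (\<lambda>x. 0) \<le> 1" by (simp add: ell2_norm_def)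
  have ne: "{c \<in> ell2 I. ell2_norm I c \<le> 1} \<noteq> {}" using z zn by blast
  show "op_norm_on I (matrix_op I M) \<le> K"
    unfolding op_norm_on_def mo by (rule cSUP_least[OF ne]) (use le in auto)
  have bdd: "bdd_above ((\<lambda>c. ell2_norm I (?T c)) ` {c \<in> ell2 I. ell2_norm I c \<le> 1})"
    by (rule bdd_aboveI2[where M=K]) (use le in auto)
  let ?o = "op_norm_on I (matrix_op I M)"
  have up: "ell2_norm I (?T c) \<le> ?o" if "c \<in> ell2 I" "ell2_norm I c \<le> 1" for c
    unfolding op_norm_on_def mo by (rule cSUP_upper[OF _ bdd]) (use that in auto)
  have o0: "0 \<le> ?o" using up[OF z zn] ell2_norm_eq[OF cl[OF z]] l2n_nonneg order_trans by metis
  show "mbd ?o (restr I M)"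
    unfolding Y[symmetric]
  proof (rule mbdI_app[OF o0], intro conjI)
    fix c :: "'a \<Rightarrow> complex" assume c: "l2 c"
    show "l2 (?T c)" by (rule mbd_app(1)[OF mbd_norm c])
    let ?c = "\<lambda>x. if x \<in> I then c x else 0"
    have cI: "?c \<in> ell2 I" using l2_if(1)[OF c] by (simp add: ell2_iff)
    have Tc: "?T c = ?T ?c"
      unfolding app_def by (intro ext infsum_cong) (auto simp: Y restr_def)
    have "l2n (?T ?c) \<le> ?o * l2n ?c"
    proof (cases "l2n ?c = 0")
      case True
      thus ?thesis using mbd_app(2)[OF assms, of ?c] cI by (simp add: Y ell2_iff)
    next
      case False
      hence pos: "0 < l2n ?c" using l2n_nonneg[of ?c] by linarith
      let ?a = "of_real (inverse (l2n ?c)) :: complex"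
      \<comment> \<open>The added 0 brings scaling into the form a c + c' in which linearity is
        available.\<close>
      have sc: "(\<lambda>x. ?a * ?c x + 0) \<in> ell2 I" "l2n (\<lambda>x. ?a * v x + 0) = inverse (l2n ?c) * l2n v" for v :: "'a \<Rightarrow> complex"
      proof -
        show "(\<lambda>x. ?a * ?c x + 0) \<in> ell2 I"
          using cI by (auto simp: ell2_iff l2_def norm_mult power_mult_distrib norm_inverse intro: summable_on_cmult_right)
        have "(\<Sum>\<^sub>\<infinity>x. (cmod (?a * v x + 0))\<^sup>2) = (inverse (l2n ?c))\<^sup>2 * (\<Sum>\<^sub>\<infinity>x. (cmod (v x))\<^sup>2)"
          using pos by (simp add: norm_mult norm_inverse power_mult_distrib infsum_cmult_right')
        thus "l2n (\<lambda>x. ?a * v x + 0) = inverse (l2n ?c) * l2n v"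
          using pos unfolding ell2_norm_def[of UNIV "\<lambda>x. ?a * v x + 0"] ell2_norm_def[of UNIV v]
          by (simp add: real_sqrt_mult)
      qed
      have "?T (\<lambda>x. ?a * ?c x + 0) = (\<lambda>x. ?a * ?T ?c x + ?T (\<lambda>x. 0) x)"
        using cI z by (intro app_add[OF mbd_norm]) (auto simp: ell2_iff)
      also have "?T (\<lambda>x. 0) = (\<lambda>x. 0)" by (simp add: app_def)
      finally have T: "?T (\<lambda>x. ?a * ?c x + 0) = (\<lambda>x. ?a * ?T ?c x + 0)" .
      have "ell2_norm I (?T (\<lambda>x. ?a * ?c x + 0)) \<le> ?o"
        by (rule up[OF sc(1)]) (use pos in \<open>simp only: ell2_norm_eq[OF sc(1)] sc(2), simp\<close>)
      hence "l2n (?T (\<lambda>x. ?a * ?c x + 0)) \<le> ?o" unfolding ell2_norm_eq[OF cl[OF sc(1)]] .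
      hence "inverse (l2n ?c) * l2n (?T ?c) \<le> ?o" unfolding T sc(2) .
      thus ?thesis using pos by (simp add: field_simps)
    qed
    also have "\<dots> \<le> ?o * l2n c" by (intro mult_left_mono l2_if(2) c o0)
    finally show "l2n (?T c) \<le> ?o * l2n c" unfolding Tc .
  qed
qed

text \<open>The matrix of the bounded operator, read off on unit vectors, must be \<open>M\<close>
  cut down to \<open>I\<close>.\<close>

lemma matrix_bounded_iff: "matrix_bounded I M \<longleftrightarrow> (\<exists>K. mbd K (restr I M))"
proof
  assume "matrix_bounded I M"
  hence bo: "bounded_op_on I (matrix_op I M)" unfolding matrix_bounded_def by blast
  obtain Y where Y: "\<And>c. c \<in> ell2 I \<Longrightarrow> matrix_op I M c = app (ent Y) c"
    "\<And>x y. ent Y x y \<noteq> 0 \<Longrightarrow> x \<in> I \<and> y \<in> I" using bounded_op_matrix[OF bo] by blast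
  have "ent Y x y = restr I M x y" for x y
  proof (cases "y \<in> I")
    case True
    have col: "app N (\<lambda>x. of_bool (x = y)) x = N x y" for N
      using app_finite[of "{y}" N "\<lambda>_. 1" x] by (simp add: of_bool_def)
    show ?thesis
      using Y(1)[OF ell2_ident[OF True]] col[of "ent Y"] col[of "restr I M"] by (metis matrix_op_eq_app)
  next
    case False
    thus ?thesis using Y(2)[of x y] by (auto simp: restr_def)
  qed
  hence "restr I M = ent Y" by (simp add: fun_eq_iff)
  thus "\<exists>K. mbd K (restr I M)" using mbd_norm by metis
next
  assume "\<exists>K. mbd K (restr I M)"
  thus "matrix_bounded I M" using matrix_bounded_mbd(1) by blast
qed

text \<open>Reindexing along injections, with zeros elsewhere, leaves the bilinear form unchanged.
  It identifies a slice of a tensor with a block of the matrix over pairs.\<close>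

lemma mbd_embed:
  fixes f g :: "'k \<Rightarrow> 'x"
  assumes f: "inj f" and g: "inj g" and M: "\<And>k l. M (f k) (g l) = M' k l"
    and z: "\<And>x y. \<not> (x \<in> range f \<and> y \<in> range g) \<Longrightarrow> M x y = 0"
  shows "mbd K M \<longleftrightarrow> mbd K M'"
proof
  assume *: "mbd K M"
  show "mbd K M'"
    unfolding mbd_def
  proof (intro conjI allI impI)
    show "0 \<le> K" by (rule mbd_nonneg[OF *])
    fix F G :: "'k set" and c d assume fin: "finite F" "finite G"
    note re = sum.reindex[OF inj_on_subset[OF f subset_UNIV]] sum.reindex[OF inj_on_subset[OF g subset_UNIV]]
    show "cmod (\<Sum>x\<in>F. \<Sum>y\<in>G. d x * M' x y * c y)
       \<le> K * L2_set (\<lambda>x. cmod (d x)) F * L2_set (\<lambda>y. cmod (c y)) G"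
      using mbdD[OF *, of "f ` F" "g ` G" "\<lambda>x. d (inv f x)" "\<lambda>y. c (inv g y)"] fin
      by (simp add: re L2_set_def M inv_f_f[OF f] inv_f_f[OF g])
  qed
next
  assume *: "mbd K M'"
  show "mbd K M"
    unfolding mbd_def
  proof (intro conjI allI impI)
    show "0 \<le> K" by (rule mbd_nonneg[OF *])
    fix F G :: "'x set" and c d assume fin: "finite F" "finite G"
    let ?F = "f -` F" and ?G = "g -` G"
    have fin': "finite ?F" "finite ?G" using fin f g by (auto intro: finite_vimageI)
    note re = sum.reindex[OF inj_on_subset[OF f subset_UNIV]] sum.reindex[OF inj_on_subset[OF g subset_UNIV]]
    have L: "L2_set (\<lambda>x. cmod (d (f x))) ?F \<le> L2_set (\<lambda>x. cmod (d x)) F"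
      "L2_set (\<lambda>x. cmod (c (g x))) ?G \<le> L2_set (\<lambda>x. cmod (c x)) G"
    proof -
      have "(\<Sum>x\<in>?F. (cmod (d (f x)))\<^sup>2) = (\<Sum>x\<in>f ` ?F. (cmod (d x))\<^sup>2)"
        by (simp only: re o_def)
      also have "\<dots> \<le> (\<Sum>x\<in>F. (cmod (d x))\<^sup>2)" using fin by (intro sum_mono2) auto
      finally show "L2_set (\<lambda>x. cmod (d (f x))) ?F \<le> L2_set (\<lambda>x. cmod (d x)) F"
        unfolding L2_set_def by simp
      have "(\<Sum>x\<in>?G. (cmod (c (g x)))\<^sup>2) = (\<Sum>x\<in>g ` ?G. (cmod (c x))\<^sup>2)"
        by (simp only: re o_def)
      also have "\<dots> \<le> (\<Sum>x\<in>G. (cmod (c x))\<^sup>2)" using fin by (intro sum_mono2) auto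
      finally show "L2_set (\<lambda>x. cmod (c (g x))) ?G \<le> L2_set (\<lambda>x. cmod (c x)) G"
        unfolding L2_set_def by simp
    qed
    have "(\<Sum>x\<in>F. \<Sum>y\<in>G. d x * M x y * c y) = (\<Sum>x\<in>f ` ?F. \<Sum>y\<in>G. d x * M x y * c y)"
      using fin z by (intro sum.mono_neutral_right) (auto intro!: sum.neutral)
    also have "\<dots> = (\<Sum>x\<in>f ` ?F. \<Sum>y\<in>g ` ?G. d x * M x y * c y)"
      using fin z by (intro sum.cong refl sum.mono_neutral_right) auto
    also have "\<dots> = (\<Sum>k\<in>?F. \<Sum>l\<in>?G. d (f k) * M' k l * c (g l))"
      by (simp only: re o_def M)
    also have "cmod \<dots> \<le> K * L2_set (\<lambda>x. cmod (d (f x))) ?F * L2_set (\<lambda>x. cmod (c (g x))) ?G"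
      by (rule mbdD[OF * fin'])
    also have "\<dots> \<le> K * L2_set (\<lambda>x. cmod (d x)) F * L2_set (\<lambda>x. cmod (c x)) G"
      by (intro mult_mono L mult_nonneg_nonneg L2_set_nonneg mbd_nonneg[OF *]) simp
    finally show "cmod (\<Sum>x\<in>F. \<Sum>y\<in>G. d x * M x y * c y)
       \<le> K * L2_set (\<lambda>x. cmod (d x)) F * L2_set (\<lambda>y. cmod (c y)) G" .
  qed
qed

lemma op_norm_eq_norm:
  assumes "\<And>K. mbd K (ent Z) \<longleftrightarrow> mbd K (restr I M)"
  shows "matrix_bounded I M" "op_norm_on I (matrix_op I M) = norm Z"
proof -
  have m: "mbd (norm Z) (restr I M)" using assms mbd_norm by blast
  show "matrix_bounded I M" by (rule matrix_bounded_mbd(1)[OF m])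
  show "op_norm_on I (matrix_op I M) = norm Z"
    using matrix_bounded_mbd(2,3)[OF m] norm_le_mbd[of _ Z] by (auto simp: assms intro: antisym)
qed

section \<open>Tensors as bounded matrices over pairs\<close>

text \<open>Outer indices go with outer ones and inner with inner ones: rows are (i, k) and columns
  (j, l), which turns the double contraction into the matrix product.\<close>

definition ten :: "('a \<times> 'a) bmat \<Rightarrow> 'a tensor" where
  "ten Z i k l j = ent Z (i, k) (j, l)"

definition psupp :: "'a set \<Rightarrow> 'a set \<Rightarrow> ('a \<times> 'a) bmat \<Rightarrow> bool" where
  "psupp I1 I2 Z \<longleftrightarrow> supp fst I1 Z \<and> supp snd I2 Z"

lemma psupp_iff: "psupp I1 I2 Z \<longleftrightarrow> (\<forall>x y. ent Z x y \<noteq> 0 \<longrightarrow> x \<in> I1 \<times> I2 \<and> y \<in> I1 \<times> I2)"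
  unfolding psupp_def supp_def by (auto simp: mem_Times_iff)

lemma ten_tensors: "ten Z \<in> tensors I1 I2 \<longleftrightarrow> psupp I1 I2 Z"
  unfolding ten_def tensors_def psupp_iff by auto

lemma ten_inject: "ten Z = ten Y \<longleftrightarrow> Z = Y"
proof
  assume "ten Z = ten Y"
  hence "ent Z (i, k) (j, l) = ent Y (i, k) (j, l)" for i k j l by (metis ten_def)
  thus "Z = Y" by (intro bmat_eqI) (metis surj_pair)
qed simp

lemma ten_0: "ten 0 = 0" and ten_add: "ten (Z + Y) = ten Z + ten Y"
  and ten_diff: "ten (Z - Y) = ten Z - ten Y"
  and ten_cscale: "ten (cscale a Z) = tensor_scale a (ten Z)"
  and ten_adj: "ten (adj Z) = tensor_star (ten Z)"
  by (simp_all add: fun_eq_iff ten_def ent_simps cscale.rep_eq adj.rep_eq tensor_scale_def tensor_star_def)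

lemma slice_mbd:
  assumes "psupp I1 I2 Z"
  shows "i \<in> I1 \<Longrightarrow> j \<in> I1 \<Longrightarrow> mbd K (ent (blk fst Z i j)) \<longleftrightarrow> mbd K (restr I2 (\<lambda>k l. ten Z i k l j))"
    and "k \<in> I2 \<Longrightarrow> l \<in> I2 \<Longrightarrow> mbd K (ent (blk snd Z k l)) \<longleftrightarrow> mbd K (restr I1 (\<lambda>i j. ten Z i k l j))"
proof -
  have z: "ent Z x y = 0" if "\<not> (x \<in> I1 \<times> I2 \<and> y \<in> I1 \<times> I2)" for x y
    using assms that unfolding psupp_iff by blast
  show "mbd K (ent (blk fst Z i j)) \<longleftrightarrow> mbd K (restr I2 (\<lambda>k l. ten Z i k l j))" if "i \<in> I1" "j \<in> I1"
    by (rule mbd_embed[where f="\<lambda>k. (i, k)" and g="\<lambda>l. (j, l)"])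
       (auto simp: inj_def ent_blk restr_def ten_def z that image_iff split_paired_all)
  show "mbd K (ent (blk snd Z k l)) \<longleftrightarrow> mbd K (restr I1 (\<lambda>i j. ten Z i k l j))" if "k \<in> I2" "l \<in> I2"
    by (rule mbd_embed[where f="\<lambda>i. (i, k)" and g="\<lambda>j. (j, l)"])
       (auto simp: inj_def ent_blk restr_def ten_def z that image_iff split_paired_all)
qed

lemma ten_sum_eq:
  assumes Z: "psupp I1 I2 Z" and c: "l2 c"
  shows "(\<lambda>(m, n). ten Z i k n m * c (m, n)) summable_on (I1 \<times> I2)"
    and "(\<Sum>\<^sub>\<infinity>m\<in>I1. \<Sum>\<^sub>\<infinity>n\<in>I2. ten Z i k n m * c (m, n)) = app (ent Z) c (i, k)"
proof -
  let ?f = "\<lambda>p. ent Z (i, k) p * c p"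
  have "?f summable_on UNIV" by (intro l2_summable l2_ent c)
  hence s: "?f summable_on (I1 \<times> I2)" by (rule summable_on_subset) simp
  have e: "(\<lambda>(m, n). ten Z i k n m * c (m, n)) = ?f" by (auto simp: ten_def)
  show "(\<lambda>(m, n). ten Z i k n m * c (m, n)) summable_on (I1 \<times> I2)" unfolding e by (rule s)
  have "(\<Sum>\<^sub>\<infinity>m\<in>I1. \<Sum>\<^sub>\<infinity>n\<in>I2. ten Z i k n m * c (m, n)) = infsum ?f (I1 \<times> I2)"
    using infsum_Sigma'_banach[of "\<lambda>m n. ten Z i k n m * c (m, n)" I1 "\<lambda>_. I2"] s unfolding e by simp
  also have "\<dots> = infsum ?f UNIV"
    using Z by (intro infsum_cong_neutral) (auto simp: psupp_iff)
  finally show "(\<Sum>\<^sub>\<infinity>m\<in>I1. \<Sum>\<^sub>\<infinity>n\<in>I2. ten Z i k n m * c (m, n)) = app (ent Z) c (i, k)"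
    unfolding app_def .
qed

text \<open>For fixed outer indices the terms are products of two l2 sequences, hence
  unconditionally summable over pairs. This justifies both the iterated sums and the change of order
  from (n, m) to (m, n).\<close>

lemma ten_mult:
  assumes Z: "psupp I1 I2 Z"
  shows "tensor_mult I1 I2 (ten Z) (ten Y) = ten (Z * Y)"
    and "tensor_mult_converges I1 I2 (ten Z) (ten Y)"
proof -
  have s: "(\<lambda>(n, m). ten Z i k n m * ten Y m n l j) summable_on (I2 \<times> I1)"
    and eq: "tensor_mult I1 I2 (ten Z) (ten Y) i k l j = ten (Z * Y) i k l j" for i k l j
  proof -
    have bij: "bij_betw prod.swap (I2 \<times> I1) (I1 \<times> I2)"
      by (auto simp: bij_betw_def inj_on_def)
    let ?g = "\<lambda>(m, n). ten Z i k n m * ent Y (m, n) (j, l)"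
    have sg: "?g summable_on (I1 \<times> I2)" by (rule ten_sum_eq(1)[OF Z l2_ent(2)])
    have sw: "(\<lambda>x. ?g (prod.swap x)) = (\<lambda>(n, m). ten Z i k n m * ten Y m n l j)"
      by (auto simp: ten_def)
    show s: "(\<lambda>(n, m). ten Z i k n m * ten Y m n l j) summable_on (I2 \<times> I1)"
      using summable_on_reindex_bij_betw[OF bij, of ?g] sg unfolding sw by blast
    have "tensor_mult I1 I2 (ten Z) (ten Y) i k l j = infsum (\<lambda>(n, m). ten Z i k n m * ten Y m n l j) (I2 \<times> I1)"
      unfolding tensor_mult_def using s by (intro infsum_Sigma'_banach)
    also have "\<dots> = infsum ?g (I1 \<times> I2)"
      using infsum_reindex_bij_betw[OF bij, of ?g] unfolding sw .
    also have "\<dots> = (\<Sum>\<^sub>\<infinity>m\<in>I1. \<Sum>\<^sub>\<infinity>n\<in>I2. ten Z i k n m * ent Y (m, n) (j, l))"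
      using infsum_Sigma'_banach[OF sg] by simp
    also have "\<dots> = app (ent Z) (\<lambda>p. ent Y p (j, l)) (i, k)"
      by (rule ten_sum_eq(2)[OF Z l2_ent(2)])
    also have "\<dots> = ten (Z * Y) i k l j" by (simp add: app_def ten_def ent_times)
    finally show "tensor_mult I1 I2 (ten Z) (ten Y) i k l j = ten (Z * Y) i k l j" .
  qed
  show "tensor_mult I1 I2 (ten Z) (ten Y) = ten (Z * Y)" by (intro ext eq)
  show "tensor_mult_converges I1 I2 (ten Z) (ten Y)" unfolding tensor_mult_converges_def using s by blast
qed

lemma represents_app:
  assumes Y: "psupp I1 I2 Y" and S: "bounded_op_on (I1 \<times> I2) S"
    and eq: "\<And>c. c \<in> ell2 (I1 \<times> I2) \<Longrightarrow> S c = app (ent Y) c"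
  shows "tensor_represents I1 I2 (ten Y) S"
  unfolding tensor_represents_def
proof (intro conjI S ballI)
  fix c i k assume c: "c \<in> ell2 (I1 \<times> I2)"
  hence l: "l2 c" by (simp add: ell2_iff)
  show "(\<lambda>(m, n). ten Y i k n m * c (m, n)) summable_on (I1 \<times> I2)" by (rule ten_sum_eq(1)[OF Y l])
  show "S c (i, k) = (\<Sum>\<^sub>\<infinity>m\<in>I1. \<Sum>\<^sub>\<infinity>n\<in>I2. ten Y i k n m * c (m, n))"
    unfolding eq[OF c] by (rule ten_sum_eq(2)[OF Y l, symmetric])
qed

lemma represents_eq_app:
  assumes Z: "psupp I1 I2 Z" and T: "tensor_represents I1 I2 (ten Z) T" and c: "c \<in> ell2 (I1 \<times> I2)"
  shows "T c = app (ent Z) c"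
proof
  fix x
  have "bounded_op_on (I1 \<times> I2) (app (ent Z))" by (rule bounded_op_app) (use Z in \<open>auto simp: psupp_iff\<close>)
  hence 0: "app (ent Z) c \<in> ell2 (I1 \<times> I2)" "T c \<in> ell2 (I1 \<times> I2)"
    using T c unfolding tensor_represents_def bounded_op_on_def by blast+
  show "T c x = app (ent Z) c x"
  proof (cases "x \<in> I1 \<times> I2")
    case True
    then obtain i k where x: "x = (i, k)" "i \<in> I1" "k \<in> I2" by auto
    have "l2 c" using c by (simp add: ell2_iff)
    from ten_sum_eq(2)[OF Z this, of i k] T c x show ?thesis
      unfolding tensor_represents_def by simp
  next
    case False
    hence "T c x = 0" "app (ent Z) c x = 0" using 0 unfolding ell2_iff by blast+
    thus ?thesis by simp
  qed
qed

section \<open>The tensor algebra as a set of bounded matrices\<close>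

locale tensor_norms = n1: matrix_norm N1 I1 C1 + n2: matrix_norm N2 I2 C2
  for N1 N2 :: "('a \<Rightarrow> 'a \<Rightarrow> ennreal) \<Rightarrow> ennreal" and I1 I2 C1 C2 +
  assumes spectral1: "n1.spectral (fst :: 'a \<times> 'a \<Rightarrow> 'a)"
    and spectral2: "n2.spectral (snd :: 'a \<times> 'a \<Rightarrow> 'a)"
begin

definition alg :: "('a \<times> 'a) bmat set" where
  "alg = {Z. psupp I1 I2 Z \<and> N1 (bn fst Z) < \<infinity> \<and> N2 (bn snd Z) < \<infinity>}"

abbreviation c1 :: "'a cmatrix \<Rightarrow> ennreal" where "c1 M \<equiv> N1 (\<lambda>i j. ennreal (cmod (M i j)))"
abbreviation c2 :: "'a cmatrix \<Rightarrow> ennreal" where "c2 M \<equiv> N2 (\<lambda>i j. ennreal (cmod (M i j)))"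

lemma tensor_norm_ten:
  assumes "psupp I1 I2 Z"
  shows "tensor_norm1 c1 I1 I2 (ten Z) = N1 (bn fst Z)" "tensor_norm2 c2 I1 I2 (ten Z) = N2 (bn snd Z)"
proof -
  note e1 = op_norm_eq_norm[OF slice_mbd(1)[OF assms]]
  have "c1 (\<lambda>i j. complex_of_real (op_norm_on I2 (matrix_op I2 (\<lambda>k l. ten Z i k l j)))) = N1 (bn fst Z)"
    by (intro antisym n1.mono) (simp_all add: e1 bn_def)
  thus "tensor_norm1 c1 I1 I2 (ten Z) = N1 (bn fst Z)"
    unfolding tensor_norm1_def using e1(1) by simp
  note e2 = op_norm_eq_norm[OF slice_mbd(2)[OF assms]]
  have "c2 (\<lambda>k l. complex_of_real (op_norm_on I1 (matrix_op I1 (\<lambda>i j. ten Z i k l j)))) = N2 (bn snd Z)"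
    by (intro antisym n2.mono) (simp_all add: e2 bn_def)
  thus "tensor_norm2 c2 I1 I2 (ten Z) = N2 (bn snd Z)"
    unfolding tensor_norm2_def using e2(1) by simp
qed

text \<open>The first norm bounds, through \<open>schur\<close>, the row and column sums of the
  operator norms of the slices; the block Schur test then bounds the whole array. This is where a
  tensor becomes an operator on sequences over pairs.\<close>

lemma tensor_is_ten:
  assumes A: "A \<in> tensors I1 I2" and fin: "tensor_norm1 c1 I1 I2 A < \<infinity>"
  shows "\<exists>Z. A = ten Z"
proof -
  define M where "M x y = A (fst x) (snd x) (snd y) (fst y)" for x y
  let ?o = "\<lambda>i j. op_norm_on I2 (matrix_op I2 (\<lambda>k l. A i k l j))"
  have mb: "\<And>i j. i \<in> I1 \<Longrightarrow> j \<in> I1 \<Longrightarrow> matrix_bounded I2 (\<lambda>k l. A i k l j)"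
    and fin': "c1 (\<lambda>i j. complex_of_real (?o i j)) < \<infinity>"
    using fin unfolding tensor_norm1_def by (auto split: if_splits)
  define z where "z i j = (if i \<in> I1 \<and> j \<in> I1 then ?o i j else 0)" for i j
  have z: "mbd (z i j) (\<lambda>x y. if fst x = i \<and> fst y = j then M x y else 0)" for i j
  proof (cases "i \<in> I1 \<and> j \<in> I1")
    case True
    obtain K where "mbd K (restr I2 (\<lambda>k l. A i k l j))" using mb True matrix_bounded_iff by blast
    hence "mbd (?o i j) (restr I2 (\<lambda>k l. A i k l j))" by (rule matrix_bounded_mbd(3))
    moreover have "mbd (?o i j) (\<lambda>x y. if fst x = i \<and> fst y = j then M x y else 0)
      \<longleftrightarrow> mbd (?o i j) (restr I2 (\<lambda>k l. A i k l j))"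
      by (rule mbd_embed[where f="\<lambda>k. (i, k)" and g="\<lambda>l. (j, l)"])
         (use A in \<open>auto simp: inj_def M_def restr_def tensors_def image_iff split_paired_all\<close>)
    ultimately show ?thesis using True by (simp add: z_def)
  next
    case False
    hence "(\<lambda>x y. if fst x = i \<and> fst y = j then M x y else 0) = (\<lambda>x y. 0)"
      using A by (auto simp: M_def tensors_def fun_eq_iff)
    moreover have "z i j = 0" using False by (auto simp: z_def)
    ultimately show ?thesis using mbd_zero by simp
  qed
  have z0: "0 \<le> z i j" for i j by (rule mbd_nonneg[OF z])
  have "N1 (\<lambda>i j. ennreal (z i j)) \<le> c1 (\<lambda>i j. complex_of_real (?o i j))"
    by (rule n1.mono) (simp add: z_def ennreal_leI)
  hence "N1 (\<lambda>i j. ennreal (z i j)) < \<infinity>" using fin' by (rule order_le_less_trans)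
  moreover obtain K0 where K0: "K0 > 0"
    "\<And>m i. i \<in> I1 \<Longrightarrow> (\<integral>\<^sup>+j. m i j \<partial>count_space I1) \<le> ennreal K0 * N1 m"
    "\<And>m j. j \<in> I1 \<Longrightarrow> (\<integral>\<^sup>+i. m i j \<partial>count_space I1) \<le> ennreal K0 * N1 m"
    using n1.schur by blast
  ultimately have "ennreal K0 * N1 (\<lambda>i j. ennreal (z i j)) < \<infinity>" by (simp add: ennreal_mult_less_top)
  then obtain K where K: "ennreal K0 * N1 (\<lambda>i j. ennreal (z i j)) = ennreal K" "0 \<le> K"
    by (metis ennreal_cases infinity_ennreal_def less_irrefl)
  have "mbd K M"
  proof (rule mbd_Schur_test[OF z])
    show "(\<Sum>j\<in>P. z i j) \<le> K" if "finite P" for i P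
    proof (cases "i \<in> I1")
      case True
      show ?thesis
        by (rule sum_le_of_nn_integral_le[OF that, of I1]) (use z0 K0(2)[OF True, of "\<lambda>i j. ennreal (z i j)"] K in \<open>auto simp: z_def\<close>)
    next
      case False
      thus ?thesis using K(2) by (simp add: z_def)
    qed
    show "(\<Sum>i\<in>P. z i j) \<le> K" if "finite P" for j P
    proof (cases "j \<in> I1")
      case True
      show ?thesis
        by (rule sum_le_of_nn_integral_le[OF that, of I1]) (use z0 K0(3)[OF True, of "\<lambda>i j. ennreal (z i j)"] K in \<open>auto simp: z_def\<close>)
    next
      case False
      thus ?thesis using K(2) by (simp add: z_def)
    qed
  qed
  hence "ent (Abs_bmat M) = M" by (intro Abs_bmat_inverse) auto
  hence "A = ten (Abs_bmat M)" by (simp add: fun_eq_iff ten_def M_def)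
  thus ?thesis by blast
qed

lemma tensor_algebra_eq: "tensor_algebra c1 c2 I1 I2 = ten ` alg"
proof (intro equalityI subsetI)
  fix A assume "A \<in> tensor_algebra c1 c2 I1 I2"
  hence A: "A \<in> tensors I1 I2" "tensor_norm1 c1 I1 I2 A < \<infinity>" "tensor_norm2 c2 I1 I2 A < \<infinity>"
    by (auto simp: tensor_algebra_def)
  obtain Z where Z: "A = ten Z" using tensor_is_ten[OF A(1,2)] by blast
  have p: "psupp I1 I2 Z" using A(1) by (simp add: Z ten_tensors)
  have "Z \<in> alg" using A(2,3) p by (simp add: alg_def Z tensor_norm_ten)
  thus "A \<in> ten ` alg" using Z by blast
next
  fix A assume "A \<in> ten ` alg"
  thus "A \<in> tensor_algebra c1 c2 I1 I2"
    by (auto simp: tensor_algebra_def alg_def ten_tensors tensor_norm_ten)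
qed

definition alg_norm :: "('a \<times> 'a) bmat \<Rightarrow> ennreal" where
  "alg_norm Z = max (N1 (bn fst Z)) (N2 (bn snd Z))"

lemma alg_iff: "Z \<in> alg \<longleftrightarrow> psupp I1 I2 Z \<and> alg_norm Z < \<infinity>"
  by (auto simp: alg_def alg_norm_def)

lemma tensor_algebra_norm_ten: "Z \<in> alg \<Longrightarrow> tensor_algebra_norm c1 c2 I1 I2 (ten Z) = enn2real (alg_norm Z)"
  by (simp add: tensor_algebra_norm_def alg_def tensor_norm_ten alg_norm_def)

lemma alg_norm_add: "alg_norm (Z + Y) \<le> alg_norm Z + alg_norm Y"
  unfolding alg_norm_def
  by (intro max.boundedI order_trans[OF n1.bn_add] order_trans[OF n2.bn_add] add_mono) auto

lemma alg_norm_diff: "alg_norm (Z - Y) \<le> alg_norm Z + alg_norm Y"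
  unfolding alg_norm_def
  by (intro max.boundedI order_trans[OF n1.bn_diff] order_trans[OF n2.bn_diff] add_mono) auto

lemma alg_norm_cscale: "alg_norm (cscale a Z) = ennreal (cmod a) * alg_norm Z"
  unfolding alg_norm_def n1.bn_scale n2.bn_scale by (rule max_mult_left_ennreal)

lemma alg_norm_adj: "alg_norm (adj Z) = alg_norm Z"
  unfolding alg_norm_def n1.bn_star n2.bn_star ..

lemma alg_norm_0: "alg_norm 0 = 0"
  by (simp add: alg_norm_def n1.bn_zero n2.bn_zero)

lemma alg_norm_mult:
  assumes "psupp I1 I2 Z" and C: "C1 \<le> C" "C2 \<le> C"
  shows "alg_norm (Z * Y) \<le> ennreal C * alg_norm Z * alg_norm Y"
proof -
  have "N1 (bn fst (Z * Y)) \<le> ennreal C1 * N1 (bn fst Z) * N1 (bn fst Y)"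
    using assms(1) by (intro n1.bn_mult) (auto simp: psupp_def)
  also have "\<dots> \<le> ennreal C * alg_norm Z * alg_norm Y"
    unfolding alg_norm_def by (intro mult_mono ennreal_leI C) auto
  finally have 1: "N1 (bn fst (Z * Y)) \<le> ennreal C * alg_norm Z * alg_norm Y" .
  have "N2 (bn snd (Z * Y)) \<le> ennreal C2 * N2 (bn snd Z) * N2 (bn snd Y)"
    using assms(1) by (intro n2.bn_mult) (auto simp: psupp_def)
  also have "\<dots> \<le> ennreal C * alg_norm Z * alg_norm Y"
    unfolding alg_norm_def by (intro mult_mono ennreal_leI C) auto
  finally show ?thesis using 1 by (simp add: alg_norm_def[of "Z * Y"])
qed

text \<open>Schur's test again. The embedding into the bounded matrices gives definiteness of the
  algebra norm and supplies the candidates for limits of Cauchy sequences.\<close>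

lemma norm_le_nm: "\<exists>K>0. \<forall>Z\<in>alg. norm Z \<le> K * enn2real (alg_norm Z)"
proof -
  obtain K where K: "K > 0"
    "\<And>m i. i \<in> I1 \<Longrightarrow> (\<integral>\<^sup>+j. m i j \<partial>count_space I1) \<le> ennreal K * N1 m"
    "\<And>m j. j \<in> I1 \<Longrightarrow> (\<integral>\<^sup>+i. m i j \<partial>count_space I1) \<le> ennreal K * N1 m"
    using n1.schur by blast
  have "norm Z \<le> K * enn2real (alg_norm Z)" if Z: "Z \<in> alg" for Z
  proof (rule norm_Schur_test[where \<pi>=fst and I=I1])
    show "supp fst I1 Z" using Z by (simp add: alg_iff psupp_def)
    show "0 \<le> K * enn2real (alg_norm Z)" using K(1) by simp
    have e: "ennreal K * N1 (bn fst Z) \<le> ennreal (K * enn2real (alg_norm Z))"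
    proof -
      have "ennreal (enn2real (alg_norm Z)) = alg_norm Z" using Z by (simp add: alg_iff)
      hence "ennreal (K * enn2real (alg_norm Z)) = ennreal K * alg_norm Z" using K(1) by (simp add: ennreal_mult)
      thus ?thesis by (simp add: alg_norm_def mult_left_mono)
    qed
    show "(\<integral>\<^sup>+j. bn fst Z i j \<partial>count_space I1) \<le> ennreal (K * enn2real (alg_norm Z))" if "i \<in> I1" for i
      by (rule order_trans[OF K(2)[OF that] e])
    show "(\<integral>\<^sup>+i. bn fst Z i j \<partial>count_space I1) \<le> ennreal (K * enn2real (alg_norm Z))" if "j \<in> I1" for j
      by (rule order_trans[OF K(3)[OF that] e])
  qed
  thus ?thesis using K(1) by blast
qed

lemma alg_0: "0 \<in> alg" and alg_add: "Z \<in> alg \<Longrightarrow> Y \<in> alg \<Longrightarrow> Z + Y \<in> alg"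
  and alg_diff: "Z \<in> alg \<Longrightarrow> Y \<in> alg \<Longrightarrow> Z - Y \<in> alg"
  and alg_cscale: "Z \<in> alg \<Longrightarrow> cscale a Z \<in> alg"
  and alg_adj: "Z \<in> alg \<Longrightarrow> adj Z \<in> alg"
  and alg_mult: "Z \<in> alg \<Longrightarrow> Y \<in> alg \<Longrightarrow> Z * Y \<in> alg"
proof -
  show "0 \<in> alg" by (simp add: alg_iff alg_norm_0 psupp_iff ent_simps)
  show "Z + Y \<in> alg" if "Z \<in> alg" "Y \<in> alg"
    using that order_le_less_trans[OF alg_norm_add[of Z Y]] by (auto simp: alg_iff psupp_def intro: supp_add)
  show "Z - Y \<in> alg" if "Z \<in> alg" "Y \<in> alg"
    using that order_le_less_trans[OF alg_norm_diff[of Z Y]] by (auto simp: alg_iff psupp_def intro: supp_diff)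
  show "cscale a Z \<in> alg" if "Z \<in> alg"
    using that by (auto simp: alg_iff psupp_def alg_norm_cscale ennreal_mult_less_top intro: supp_cscale)
  show "adj Z \<in> alg" if "Z \<in> alg"
    using that by (auto simp: alg_iff psupp_def alg_norm_adj intro: supp_adj)
  show "Z * Y \<in> alg" if "Z \<in> alg" "Y \<in> alg"
  proof -
    have "alg_norm (Z * Y) \<le> ennreal (max C1 C2) * alg_norm Z * alg_norm Y"
      using that by (intro alg_norm_mult) (auto simp: alg_iff)
    also have "\<dots> < \<infinity>" using that by (simp add: alg_iff ennreal_mult_less_top)
    finally show ?thesis using that by (auto simp: alg_iff psupp_def intro: supp_mult)
  qed
qed

text \<open>The limit is found in the operator norm. For fixed n the differences X n - X m tend to X
  n - L, and lower semicontinuity of both norms carries the Cauchy bound over to X n - L.\<close>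

lemma alg_complete:
  assumes X: "\<And>n :: nat. X n \<in> alg"
    and Cauchy: "\<And>e. 0 < e \<Longrightarrow> \<exists>M. \<forall>m\<ge>M. \<forall>n\<ge>M. enn2real (alg_norm (X m - X n)) < e"
  shows "\<exists>L\<in>alg. (\<lambda>n. enn2real (alg_norm (X n - L))) \<longlonglongrightarrow> 0"
proof -
  obtain K where K: "0 < K" "\<And>Z. Z \<in> alg \<Longrightarrow> norm Z \<le> K * enn2real (alg_norm Z)" using norm_le_nm by blast
  have "Cauchy X"
  proof (rule CauchyI)
    fix e :: real assume "0 < e"
    hence "0 < e / K" using K(1) by simp
    then obtain M where M: "\<And>m n. m \<ge> M \<Longrightarrow> n \<ge> M \<Longrightarrow> enn2real (alg_norm (X m - X n)) < e / K"
      using Cauchy by blast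
    have "norm (X m - X n) < e" if "m \<ge> M" "n \<ge> M" for m n
      using K(2)[OF alg_diff[OF X X], of m n] M[OF that] K(1) by (simp add: field_simps)
    thus "\<exists>M. \<forall>m\<ge>M. \<forall>n\<ge>M. norm (X m - X n) < e" by blast
  qed
  then obtain L where L: "X \<longlonglongrightarrow> L" using Cauchy_convergent_iff convergent_def by blast
  have pL: "psupp I1 I2 L"
    unfolding psupp_iff
  proof (intro allI impI)
    fix x y assume nz: "ent L x y \<noteq> 0"
    show "x \<in> I1 \<times> I2 \<and> y \<in> I1 \<times> I2"
    proof (rule ccontr)
      assume "\<not> (x \<in> I1 \<times> I2 \<and> y \<in> I1 \<times> I2)"
      hence "ent (X n) x y = 0" for n using X[of n] unfolding alg_iff psupp_iff by blast
      thus False using ent_tendsto[OF L, of x y] nz by (simp add: LIMSEQ_const_iff)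
    qed
  qed
  have key: "\<exists>M. \<forall>n\<ge>M. alg_norm (X n - L) \<le> ennreal e" if e: "0 < e" for e
  proof -
    obtain M where M: "\<And>m n. m \<ge> M \<Longrightarrow> n \<ge> M \<Longrightarrow> enn2real (alg_norm (X m - X n)) < e"
      using Cauchy[OF e] by blast
    have "alg_norm (X n - L) \<le> ennreal e" if n: "n \<ge> M" for n
    proof -
      \<comment> \<open>The shift by \<open>M\<close> makes the bound hold for every term, as
        \<open>bn_Fatou\<close> requires.\<close>
      have lim: "(\<lambda>m. X n - X (m + M)) \<longlonglongrightarrow> X n - L"
        by (intro tendsto_intros LIMSEQ_ignore_initial_segment L)
      have "alg_norm (X n - X (m + M)) \<le> ennreal e" for m
      proof -
        have "alg_norm (X n - X (m + M)) < top" using alg_diff[OF X X] by (simp add: alg_iff)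
        hence "alg_norm (X n - X (m + M)) = ennreal (enn2real (alg_norm (X n - X (m + M))))" by simp
        also have "\<dots> \<le> ennreal e" using M[OF n, of "m + M"] by (intro ennreal_leI) simp
        finally show ?thesis .
      qed
      thus ?thesis unfolding alg_norm_def
        by (intro max.boundedI n1.bn_Fatou[OF lim] n2.bn_Fatou[OF lim]) auto
    qed
    thus ?thesis by blast
  qed
  have "L \<in> alg"
  proof -
    obtain n where "alg_norm (X n - L) \<le> ennreal 1" using key[of 1] by auto
    hence "alg_norm (X n - L) < \<infinity>" by (simp add: order_le_less_trans)
    moreover have "psupp I1 I2 (X n - L)" using X[of n] pL by (auto simp: alg_iff psupp_def intro: supp_diff)
    ultimately have "X n - L \<in> alg" by (simp add: alg_iff)
    from alg_diff[OF X[of n] this] show ?thesis by simp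
  qed
  moreover have "(\<lambda>n. enn2real (alg_norm (X n - L))) \<longlonglongrightarrow> 0"
  proof (rule LIMSEQ_I)
    fix e :: real assume e: "0 < e"
    obtain M where M: "\<And>n. n \<ge> M \<Longrightarrow> alg_norm (X n - L) \<le> ennreal (e / 2)" using key[of "e / 2"] e by auto
    have "norm (enn2real (alg_norm (X n - L)) - 0) < e" if "n \<ge> M" for n
    proof -
      have "enn2real (alg_norm (X n - L)) \<le> e / 2" by (rule enn2real_leI[OF _ M[OF that]]) (use e in simp)
      thus ?thesis using e by simp
    qed
    thus "\<exists>M. \<forall>n\<ge>M. norm (enn2real (alg_norm (X n - L)) - 0) < e" by blast
  qed
  ultimately show ?thesis by blast
qed

text \<open>The inverse is one operator for both norms, so membership in the intersection is checked
  for each norm separately, with \<open>fst\<close> and with \<open>snd\<close>.\<close>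

lemma alg_inverse:
  assumes Z: "Z \<in> alg" and Y: "psupp I1 I2 Y"
    and ZY: "Z * Y = Dg (\<lambda>x. of_bool (x \<in> I1 \<times> I2))" and YZ: "Y * Z = Dg (\<lambda>x. of_bool (x \<in> I1 \<times> I2))"
  shows "Y \<in> alg"
proof -
  let ?p = "Dg (\<lambda>x. of_bool (x \<in> I1 \<times> I2))"
  have p: "A * ?p = A" "?p * A = A" if "psupp I1 I2 A" for A
    using that by (auto intro!: bmat_eqI simp: ent_Dg_mult psupp_iff)
  have Zp: "psupp I1 I2 Z" using Z by (simp add: alg_iff)
  have "N1 (bn fst Y) < \<infinity>"
    by (rule n1.inverse_finite[OF spectral1 refl _ ZY YZ p(1)[OF Zp] p(1)[OF Y] p(2)[OF Y]])
       (use Z Y in \<open>auto simp: alg_def psupp_def\<close>)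
  moreover have "N2 (bn snd Y) < \<infinity>"
    by (rule n2.inverse_finite[OF spectral2 refl _ ZY YZ p(1)[OF Zp] p(1)[OF Y] p(2)[OF Y]])
       (use Z Y in \<open>auto simp: alg_def psupp_def\<close>)
  ultimately show ?thesis using Y by (simp add: alg_def)
qed

lemma alg_inverse_closed: "inverse_closed I1 I2 (ten ` alg)"
  unfolding inverse_closed_def
proof (intro conjI ballI allI impI)
  fix A assume "A \<in> ten ` alg"
  then obtain Z where Z: "Z \<in> alg" "A = ten Z" by blast
  have Zp: "psupp I1 I2 Z" using Z by (simp add: alg_iff)
  have "tensor_represents I1 I2 A (app (ent Z))"
    unfolding Z(2) by (rule represents_app[OF Zp bounded_op_app]) (use Zp in \<open>auto simp: psupp_iff\<close>)
  thus "\<exists>T. tensor_represents I1 I2 A T" by blast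
next
  fix A T S
  let ?X = "I1 \<times> I2"
  assume "A \<in> ten ` alg"
    and *: "tensor_represents I1 I2 A T \<and> bounded_op_on ?X S \<and> (\<forall>c\<in>ell2 ?X. S (T c) = c \<and> T (S c) = c)"
  then obtain Z where Z: "Z \<in> alg" "A = ten Z" by blast
  have Zp: "psupp I1 I2 Z" using Z by (simp add: alg_iff)
  have T: "T c = app (ent Z) c" if "c \<in> ell2 ?X" for c
    using represents_eq_app[OF Zp _ that] * by (simp add: Z(2))
  obtain Y where Y: "\<And>c. c \<in> ell2 ?X \<Longrightarrow> S c = app (ent Y) c"
    "\<And>x y. ent Y x y \<noteq> 0 \<Longrightarrow> x \<in> ?X \<and> y \<in> ?X"
    using bounded_op_matrix[of ?X S] * by blast
  have Yp: "psupp I1 I2 Y" using Y(2) by (simp add: psupp_iff)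
  have clS: "S c \<in> ell2 ?X" and clT: "T c \<in> ell2 ?X" if "c \<in> ell2 ?X" for c
    using * that unfolding tensor_represents_def bounded_op_on_def by blast+
  have col: "app M (\<lambda>x. of_bool (x = y)) = (\<lambda>x. M x y)" for M :: "'a \<times> 'a \<Rightarrow> 'a \<times> 'a \<Rightarrow> complex" and y
  proof
    show "app M (\<lambda>x. of_bool (x = y)) x = M x y" for x
      using app_finite[of "{y}" M "\<lambda>_. 1" x] by (simp add: of_bool_def)
  qed
  \<comment> \<open>Testing on unit vectors turns an identity of operators into one of matrices; the
    identity operator becomes the diagonal projection.\<close>
  have prod: "P * Q = Dg (\<lambda>x. of_bool (x \<in> ?X))"
    if P: "psupp I1 I2 P" and Q: "psupp I1 I2 Q"
      and PQ: "\<And>c. c \<in> ell2 ?X \<Longrightarrow> app (ent P) (app (ent Q) c) = c" for P Q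
  proof (rule bmat_eqI)
    fix x y
    have "ent (P * Q) x y = app (ent P) (\<lambda>z. ent Q z y) x" by (simp add: ent_times app_def)
    also have "\<dots> = ent (Dg (\<lambda>x. of_bool (x \<in> ?X))) x y"
    proof (cases "y \<in> ?X")
      case True
      have "app (ent P) (\<lambda>z. ent Q z y) = (\<lambda>x. of_bool (x = y))"
        using PQ[OF ell2_ident[OF True]] by (simp add: col)
      thus ?thesis using True by (auto simp: Dg.rep_eq)
    next
      case False
      hence "ent Q z y = 0" for z using Q unfolding psupp_iff by blast
      thus ?thesis using False by (auto simp: app_def Dg.rep_eq)
    qed
    finally show "ent (P * Q) x y = ent (Dg (\<lambda>x. of_bool (x \<in> ?X))) x y" .
  qed
  have "Z * Y = Dg (\<lambda>x. of_bool (x \<in> ?X))"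
    by (rule prod[OF Zp Yp]) (use T Y(1) clS * in metis)
  moreover have "Y * Z = Dg (\<lambda>x. of_bool (x \<in> ?X))"
    by (rule prod[OF Yp Zp]) (use T Y(1) clT * in metis)
  ultimately have "Y \<in> alg" by (rule alg_inverse[OF Z(1) Yp])
  moreover have "tensor_represents I1 I2 (ten Y) S" by (rule represents_app[OF Yp _ Y(1)]) (use * in auto)
  ultimately show "\<exists>B\<in>ten ` alg. tensor_represents I1 I2 B S" by blast
qed

text \<open>The factor \<open>C\<close> absorbs the constants of both product inequalities: |ZY|
  \<le> C |Z| |Y| becomes C |ZY| \<le> (C |Z|) (C |Y|).\<close>

lemma alg_involutive_banach_algebra:
  assumes C: "0 < C" "C1 \<le> C" "C2 \<le> C"
  shows "involutive_banach_algebra tensor_scale (ten ` alg) (tensor_mult I1 I2) tensor_star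
    (\<lambda>A. C * tensor_algebra_norm c1 c2 I1 I2 A)"
proof -
  let ?nrm = "\<lambda>Z. C * enn2real (alg_norm Z)"
  have vs: "vector_space (tensor_scale :: complex \<Rightarrow> 'a tensor \<Rightarrow> 'a tensor)"
    by unfold_locales (auto simp: tensor_scale_def fun_eq_iff algebra_simps)
  have ps: "psupp I1 I2 Z" if "Z \<in> alg" for Z using that by (simp add: alg_iff)
  have mul: "tensor_mult I1 I2 (ten Z) (ten Y) = ten (Z * Y)" if "Z \<in> alg" for Z Y
    by (rule ten_mult(1)[OF ps[OF that]])
  have nrm: "C * tensor_algebra_norm c1 c2 I1 I2 (ten Z) = ?nrm Z" if "Z \<in> alg" for Z
    using that by (simp add: tensor_algebra_norm_ten)
  have fin: "alg_norm Z = ennreal (enn2real (alg_norm Z))" if "Z \<in> alg" for Z using that by (simp add: alg_iff)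
  note cls = alg_0 alg_add alg_diff alg_cscale alg_adj alg_mult
  interpret vector_space "tensor_scale :: complex \<Rightarrow> 'a tensor \<Rightarrow> 'a tensor" by (rule vs)
  show ?thesis
  proof
    show "subspace (ten ` alg)"
      unfolding subspace_def
    proof (intro conjI ballI allI)
      show "0 \<in> ten ` alg" using alg_0 ten_0 by (metis image_eqI)
      show "A + B \<in> ten ` alg" if "A \<in> ten ` alg" "B \<in> ten ` alg" for A B
        using that alg_add by (auto simp flip: ten_add)
      show "tensor_scale a A \<in> ten ` alg" if "A \<in> ten ` alg" for a A
        using that alg_cscale by (auto simp flip: ten_cscale)
    qed
  next
    fix A :: "'a tensor" assume "A \<in> ten ` alg"
    then obtain Z where Z: "Z \<in> alg" "A = ten Z" by blast
    show "0 \<le> C * tensor_algebra_norm c1 c2 I1 I2 A" using C(1) by (simp add: Z nrm)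
    show "C * tensor_algebra_norm c1 c2 I1 I2 A = 0 \<longleftrightarrow> A = 0"
    proof
      assume "C * tensor_algebra_norm c1 c2 I1 I2 A = 0"
      hence "enn2real (alg_norm Z) = 0" using C(1) by (simp add: Z nrm)
      moreover obtain K where "K > 0" "\<And>Z. Z \<in> alg \<Longrightarrow> norm Z \<le> K * enn2real (alg_norm Z)"
        using norm_le_nm by blast
      ultimately have "norm Z \<le> 0" using Z(1) by force
      thus "A = 0" by (simp add: Z ten_0)
    next
      assume "A = 0"
      hence "Z = 0" using Z(2) ten_inject[of Z 0] by (simp add: ten_0)
      thus "C * tensor_algebra_norm c1 c2 I1 I2 A = 0" using nrm[OF Z(1)] by (simp add: Z(2) alg_norm_0)
    qed
    show "C * tensor_algebra_norm c1 c2 I1 I2 (tensor_scale a A) = cmod a * (C * tensor_algebra_norm c1 c2 I1 I2 A)" for a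
      using Z(1) by (simp add: Z(2) nrm cls alg_norm_cscale enn2real_mult flip: ten_cscale)
    show "tensor_star A \<in> ten ` alg" using Z alg_adj by (auto simp flip: ten_adj)
    show "tensor_star (tensor_star A) = A" by (simp add: tensor_star_def)
    show "tensor_star (tensor_scale a A) = tensor_scale (cnj a) (tensor_star A)" for a
      by (simp add: tensor_star_def tensor_scale_def)
    show "C * tensor_algebra_norm c1 c2 I1 I2 (tensor_star A) = C * tensor_algebra_norm c1 c2 I1 I2 A"
      using Z(1) by (simp add: Z(2) nrm cls alg_norm_adj flip: ten_adj)
    fix B :: "'a tensor" assume "B \<in> ten ` alg"
    then obtain Y where Y: "Y \<in> alg" "B = ten Y" by blast
    show "C * tensor_algebra_norm c1 c2 I1 I2 (A + B)
      \<le> C * tensor_algebra_norm c1 c2 I1 I2 A + C * tensor_algebra_norm c1 c2 I1 I2 B"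
    proof -
      have "ennreal (enn2real (alg_norm (Z + Y))) \<le> ennreal (enn2real (alg_norm Z) + enn2real (alg_norm Y))"
        using alg_norm_add[of Z Y] fin[OF Z(1)] fin[OF Y(1)] fin[OF alg_add[OF Z(1) Y(1)]] by simp
      hence "enn2real (alg_norm (Z + Y)) \<le> enn2real (alg_norm Z) + enn2real (alg_norm Y)"
        by (subst (asm) ennreal_le_iff) auto
      thus ?thesis using C(1) Z(1) Y(1)
        by (simp add: Z(2) Y(2) nrm cls flip: ten_add distrib_left)
    qed
    show "tensor_mult I1 I2 A B \<in> ten ` alg" using Z Y alg_mult by (simp add: mul)
    show "tensor_star (A + B) = tensor_star A + tensor_star B"
      by (simp add: tensor_star_def fun_eq_iff)
    show "tensor_mult I1 I2 (tensor_scale a A) B = tensor_scale a (tensor_mult I1 I2 A B)" for a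
      using Z(1) Y(1) by (simp add: Z(2) Y(2) mul cls cscale_mult flip: ten_cscale)
    show "tensor_mult I1 I2 A (tensor_scale a B) = tensor_scale a (tensor_mult I1 I2 A B)" for a
      using Z(1) Y(1) by (simp add: Z(2) Y(2) mul cls cscale_mult flip: ten_cscale)
    show "tensor_star (tensor_mult I1 I2 A B) = tensor_mult I1 I2 (tensor_star B) (tensor_star A)"
      using Z(1) Y(1) by (simp add: Z(2) Y(2) mul cls adj_mult flip: ten_adj)
    show "C * tensor_algebra_norm c1 c2 I1 I2 (tensor_mult I1 I2 A B)
      \<le> (C * tensor_algebra_norm c1 c2 I1 I2 A) * (C * tensor_algebra_norm c1 c2 I1 I2 B)"
    proof -
      have "ennreal (enn2real (alg_norm (Z * Y))) \<le> ennreal C * ennreal (enn2real (alg_norm Z)) * ennreal (enn2real (alg_norm Y))"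
        using alg_norm_mult[OF ps[OF Z(1)] C(2,3), of Y] fin[OF Z(1)] fin[OF Y(1)] fin[OF alg_mult[OF Z(1) Y(1)]] by simp
      hence "ennreal (enn2real (alg_norm (Z * Y))) \<le> ennreal (C * enn2real (alg_norm Z) * enn2real (alg_norm Y))"
        using C(1) by (simp add: ennreal_mult)
      hence "enn2real (alg_norm (Z * Y)) \<le> C * enn2real (alg_norm Z) * enn2real (alg_norm Y)"
        using C(1) by (subst (asm) ennreal_le_iff) auto
      from mult_left_mono[OF this, of C] show ?thesis using C(1) Z(1) Y(1)
        by (simp add: Z(2) Y(2) nrm cls mul mult_ac)
    qed
    fix D :: "'a tensor" assume "D \<in> ten ` alg"
    then obtain W where W: "W \<in> alg" "D = ten W" by blast
    show "tensor_mult I1 I2 (tensor_mult I1 I2 A B) D = tensor_mult I1 I2 A (tensor_mult I1 I2 B D)"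
      using Z(1) Y(1) W(1) by (simp add: Z(2) Y(2) W(2) mul cls mult.assoc)
    show "tensor_mult I1 I2 (A + B) D = tensor_mult I1 I2 A D + tensor_mult I1 I2 B D"
      using Z(1) Y(1) W(1) by (simp add: Z(2) Y(2) W(2) mul cls distrib_right flip: ten_add)
    show "tensor_mult I1 I2 A (B + D) = tensor_mult I1 I2 A B + tensor_mult I1 I2 A D"
      using Z(1) Y(1) W(1) by (simp add: Z(2) Y(2) W(2) mul cls distrib_left flip: ten_add)
  next
    fix X :: "nat \<Rightarrow> 'a tensor"
    assume X: "range X \<subseteq> ten ` alg"
      and Cauchy: "\<forall>e>0. \<exists>N. \<forall>m\<ge>N. \<forall>n\<ge>N. C * tensor_algebra_norm c1 c2 I1 I2 (X m - X n) < e"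
    have "\<forall>n. \<exists>Z. Z \<in> alg \<and> X n = ten Z" using X by blast
    then obtain Z where Z: "\<And>n. Z n \<in> alg" "\<And>n. X n = ten (Z n)" by metis
    have nX: "C * tensor_algebra_norm c1 c2 I1 I2 (ten Y - ten W) = C * enn2real (alg_norm (Y - W))"
      if "Y \<in> alg" "W \<in> alg" for Y W
      using nrm[OF alg_diff[OF that]] by (simp add: ten_diff)
    have "\<exists>L\<in>alg. (\<lambda>n. enn2real (alg_norm (Z n - L))) \<longlonglongrightarrow> 0"
    proof (rule alg_complete[OF Z(1)])
      fix e :: real assume "0 < e"
      hence "0 < C * e" using C(1) by simp
      then obtain M where "\<And>m n. m \<ge> M \<Longrightarrow> n \<ge> M \<Longrightarrow> C * tensor_algebra_norm c1 c2 I1 I2 (X m - X n) < C * e"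
        using Cauchy by blast
      hence "\<And>m n. m \<ge> M \<Longrightarrow> n \<ge> M \<Longrightarrow> enn2real (alg_norm (Z m - Z n)) < e"
        using C(1) by (simp add: Z(2) nX[OF Z(1) Z(1)])
      thus "\<exists>M. \<forall>m\<ge>M. \<forall>n\<ge>M. enn2real (alg_norm (Z m - Z n)) < e" by blast
    qed
    then obtain L where L: "L \<in> alg" "(\<lambda>n. enn2real (alg_norm (Z n - L))) \<longlonglongrightarrow> 0" by blast
    have "(\<lambda>n. C * enn2real (alg_norm (Z n - L))) \<longlonglongrightarrow> C * 0" by (intro tendsto_intros L(2))
    hence "(\<lambda>n. C * tensor_algebra_norm c1 c2 I1 I2 (X n - ten L)) \<longlonglongrightarrow> 0"
      by (simp add: Z(2) nX[OF Z(1) L(1)])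
    thus "\<exists>x\<in>ten ` alg. (\<lambda>n. C * tensor_algebra_norm c1 c2 I1 I2 (X n - x)) \<longlonglongrightarrow> 0"
      using L(1) by blast
  qed
qed

end

section \<open>The three admissible norms and the conclusion\<close>

lemma admissible_norm:
  fixes I :: "(real ^ 'd) set" and N :: "(real ^ 'd) cmatrix \<Rightarrow> ennreal"
  assumes I: "relatively_separated I" and s: "real CARD('d) < s" and \<delta>: "0 < \<delta>"
    and \<nu>: "submultiplicative_weight \<nu>" "symmetric_weight \<nu>" "GRS_condition \<nu>"
    and N: "N = jaffard_norm s I \<or> N = schur_norm \<delta> I \<or> (N = sjostrand_norm \<nu> \<and> I = int_lattice)"
  shows "\<exists>N' C. matrix_norm N' I C \<and> matrix_norm.spectral N' I (\<pi> :: 'x \<Rightarrow> real ^ 'd)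
    \<and> N = (\<lambda>M. N' (\<lambda>i j. ennreal (cmod (M i j)))) \<and> (N \<noteq> jaffard_norm s I \<longrightarrow> C = 1)"
proof -
  consider (J) "N = jaffard_norm s I" | (S) "N = schur_norm \<delta> I" | (C) "N = sjostrand_norm \<nu>" "I = int_lattice"
    using N by blast
  thus ?thesis
  proof cases
    case J
    obtain C where C: "matrix_norm (jN (pw s) I) I C" using matrix_norm_jaffard[OF I s] by blast
    thus ?thesis
      using jaffard_spectral[OF I s, of \<pi>]
      by (intro exI[of _ "jN (pw s) I"] exI[of _ C]) (auto simp: J jaffard_norm_eq)
  next
    case S
    show ?thesis
      using schur_spectral[OF I \<delta>, of \<pi>] matrix_norm_schur[OF countable_relatively_separated[OF I], of \<delta>] \<delta>
      by (intro exI[of _ "sN (pw \<delta>) I"] exI[of _ 1]) (auto simp: S schur_norm_eq)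
  next
    case C
    interpret grs_weight \<nu> by (rule grs_weight.intro) (rule \<nu>)+
    have "V = (\<lambda>x. ennreal (\<nu> x))" by (simp add: fun_eq_iff V_def)
    hence "N = (\<lambda>M. cN V (\<lambda>i j. ennreal (cmod (M i j))))"
      unfolding C(1) by (intro ext) (simp only:, rule sjostrand_norm_eq, rule less_imp_le[OF nu_pos])
    thus ?thesis
      using sjostrand_spectral[of \<pi>] matrix_norm_V
      by (intro exI[of _ "cN V"] exI[of _ 1]) (auto simp: C(2))
  qed
qed

theorem corollary3p8:
  fixes I1 I2 :: "(real ^ 'd) set"
    and s \<delta> :: real
    and \<nu> :: "real ^ 'd \<Rightarrow> real"
    and N1 N2 :: "(real ^ 'd) cmatrix \<Rightarrow> ennreal"
  assumes "relatively_separated I1" and "discrete I1"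
    and "relatively_separated I2" and "discrete I2"
    and "s > real CARD('d)"
    and "0 < \<delta>" and "\<delta> \<le> 1"
    and "submultiplicative_weight \<nu>" and "symmetric_weight \<nu>" and "GRS_condition \<nu>"
    and "N1 = jaffard_norm s I1 \<or> N1 = schur_norm \<delta> I1 \<or>
         (N1 = sjostrand_norm \<nu> \<and> I1 = int_lattice)"
    and "N2 = jaffard_norm s I2 \<or> N2 = schur_norm \<delta> I2 \<or>
         (N2 = sjostrand_norm \<nu> \<and> I2 = int_lattice)"
  shows "(\<forall>A\<in>tensor_algebra N1 N2 I1 I2. \<forall>B\<in>tensor_algebra N1 N2 I1 I2.
           tensor_mult_converges I1 I2 A B) \<and>
         (\<exists>C>0. (N1 \<noteq> jaffard_norm s I1 \<and> N2 \<noteq> jaffard_norm s I2 \<longrightarrow> C = 1) \<and>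
           involutive_banach_algebra tensor_scale (tensor_algebra N1 N2 I1 I2)
             (tensor_mult I1 I2) tensor_star (\<lambda>A. C * tensor_algebra_norm N1 N2 I1 I2 A)) \<and>
         inverse_closed I1 I2 (tensor_algebra N1 N2 I1 I2)"
proof -
  obtain N1' C1 where 1: "matrix_norm N1' I1 C1"
      "matrix_norm.spectral N1' I1 (fst :: (real ^ 'd) \<times> (real ^ 'd) \<Rightarrow> real ^ 'd)"
      "N1 = (\<lambda>M. N1' (\<lambda>i j. ennreal (cmod (M i j))))" "N1 \<noteq> jaffard_norm s I1 \<Longrightarrow> C1 = 1"
    using admissible_norm[OF assms(1,5,6,8,9,10,11), of fst] by blast
  obtain N2' C2 where 2: "matrix_norm N2' I2 C2"
      "matrix_norm.spectral N2' I2 (snd :: (real ^ 'd) \<times> (real ^ 'd) \<Rightarrow> real ^ 'd)"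
      "N2 = (\<lambda>M. N2' (\<lambda>i j. ennreal (cmod (M i j))))" "N2 \<noteq> jaffard_norm s I2 \<Longrightarrow> C2 = 1"
    using admissible_norm[OF assms(3,5,6,8,9,10,12), of snd] by blast
  interpret tensor_norms N1' N2' I1 I2 C1 C2
    using 1 2 by (intro tensor_norms.intro tensor_norms_axioms.intro)
  have alg: "tensor_algebra N1 N2 I1 I2 = ten ` alg" unfolding 1(3) 2(3) by (rule tensor_algebra_eq)
  have "\<forall>A\<in>ten ` alg. \<forall>B\<in>ten ` alg. tensor_mult_converges I1 I2 A B"
    using ten_mult(2) by (auto simp: alg_iff)
  \<comment> \<open>One constant for both norms; it equals 1 if neither of them is the Jaffard
    norm.\<close>
  moreover have "involutive_banach_algebra tensor_scale (ten ` alg) (tensor_mult I1 I2) tensor_star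
      (\<lambda>A. max C1 C2 * tensor_algebra_norm N1 N2 I1 I2 A)"
    unfolding 1(3) 2(3) using n1.C_pos by (intro alg_involutive_banach_algebra) auto
  moreover have "0 < max C1 C2" using n1.C_pos by simp
  moreover have "max C1 C2 = 1" if "N1 \<noteq> jaffard_norm s I1 \<and> N2 \<noteq> jaffard_norm s I2"
    using that 1(4) 2(4) by simp
  ultimately show ?thesis unfolding alg using alg_inverse_closed by blast
qed

end
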